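(* Let $p_1\equiv p_2\equiv1\pmod4$ be primes such that at least two of $\left(\frac{p_1}{p_2}\right),\left(\frac{2}{p_1}\right),\left(\frac{2}{p_2}\right)$ equal $-1$ (equivalently, the 2-class group $\mathbf{C}_{k,2}$ of $k=\mathbb{Q}(\sqrt{2p_1p_2},i)$ is of type $(2,2,2)$). Let $\mathbb{K}_1=k(\sqrt{p_1})$ and $\mathbb{K}_2=k(\sqrt{p_2})$. Then exactly four classes of $k$ capitulate in each of $\mathbb{K}_1$ and $\mathbb{K}_2$, and $\ker J_{\mathbb{K}_1}=\langle[\mathcal{H}_1],[\mathcal{H}_2]\rangle$, $\ker J_{\mathbb{K}_2}=\langle[\mathcal{H}_0\mathcal{H}_1],[\mathcal{H}_0\mathcal{H}_2]\rangle$.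
   Context: $i=\sqrt{-1}$; $\left(\frac{\cdot}{\cdot}\right)$ is the Legendre symbol. Write $p_1=e^2+4f^2$, $p_2=g^2+4h^2$ with integers $e,f,g,h$, and $\pi_1=e+2if$, $\pi_2=e-2if$, $\pi_3=g+2ih$, $\pi_4=g-2ih$. For $j=1,\dots,4$, $\mathcal{H}_j$ is the prime ideal of $k$ above $\pi_j$ ($\mathcal{H}_j^2=\pi_j\mathcal{O}_k$), and $\mathcal{H}_0$ the prime of $k$ above $1+i$ ($\mathcal{H}_0^2=(1+i)\mathcal{O}_k$). $J_L:\mathbf{C}_k\to\mathbf{C}_L$ is the map on ideal class groups induced by extension of ideals. *)

theory Defs
  imports "HOL-Computational_Algebra.Polynomial" "HOL-Number_Theory.Number_Theory"
begin

text \<open>Number fields are modelled as subfields of the complex numbers; ideals of the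
ring of integers as subsets of complex numbers.\<close>

definition is_subfield :: "complex set \<Rightarrow> bool" where
  "is_subfield F \<longleftrightarrow> 0 \<in> F \<and> 1 \<in> F \<and>
     (\<forall>x\<in>F. \<forall>y\<in>F. x + y \<in> F \<and> x * y \<in> F) \<and>
     (\<forall>x\<in>F. - x \<in> F \<and> (x \<noteq> 0 \<longrightarrow> inverse x \<in> F))"

definition subfield_gen :: "complex set \<Rightarrow> complex set" where
  "subfield_gen S = \<Inter>{F. is_subfield F \<and> S \<subseteq> F}"

definition alg_int :: "complex \<Rightarrow> bool" where
  "alg_int z \<longleftrightarrow> (\<exists>p :: int poly. lead_coeff p = 1 \<and> poly (map_poly of_int p) z = 0)"

definition ring_of_integers :: "complex set \<Rightarrow> complex set" where
  "ring_of_integers F = {z \<in> F. alg_int z}"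

definition is_ideal :: "complex set \<Rightarrow> complex set \<Rightarrow> bool" where
  "is_ideal R I \<longleftrightarrow> I \<subseteq> R \<and> 0 \<in> I \<and> (\<forall>x\<in>I. \<forall>y\<in>I. x + y \<in> I) \<and>
     (\<forall>r\<in>R. \<forall>x\<in>I. r * x \<in> I)"

definition nonzero_ideal :: "complex set \<Rightarrow> complex set \<Rightarrow> bool" where
  "nonzero_ideal R I \<longleftrightarrow> is_ideal R I \<and> I \<noteq> {0}"

definition prime_ideal :: "complex set \<Rightarrow> complex set \<Rightarrow> bool" where
  "prime_ideal R P \<longleftrightarrow> is_ideal R P \<and> P \<noteq> R \<and>
     (\<forall>x\<in>R. \<forall>y\<in>R. x * y \<in> P \<longrightarrow> x \<in> P \<or> y \<in> P)"

definition gen_ideal :: "complex set \<Rightarrow> complex set \<Rightarrow> complex set" where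
  "gen_ideal R S = \<Inter>{I. is_ideal R I \<and> S \<subseteq> I}"

definition principal_ideal :: "complex set \<Rightarrow> complex \<Rightarrow> complex set" where
  "principal_ideal R a = {a * r | r. r \<in> R}"

definition is_principal :: "complex set \<Rightarrow> complex set \<Rightarrow> bool" where
  "is_principal R I \<longleftrightarrow> (\<exists>a\<in>R. I = principal_ideal R a)"

definition ideal_mult :: "complex set \<Rightarrow> complex set \<Rightarrow> complex set \<Rightarrow> complex set" where
  "ideal_mult R I J = gen_ideal R {x * y | x y. x \<in> I \<and> y \<in> J}"

primrec ideal_pow :: "complex set \<Rightarrow> complex set \<Rightarrow> nat \<Rightarrow> complex set" where
  "ideal_pow R I 0 = R"
| "ideal_pow R I (Suc n) = ideal_mult R I (ideal_pow R I n)"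

definition ideal_equiv :: "complex set \<Rightarrow> complex set \<Rightarrow> complex set \<Rightarrow> bool" where
  "ideal_equiv R I J \<longleftrightarrow>
     (\<exists>a\<in>R - {0}. \<exists>b\<in>R - {0}. (\<lambda>x. a * x) ` I = (\<lambda>x. b * x) ` J)"

definition ideal_class :: "complex set \<Rightarrow> complex set \<Rightarrow> complex set set" where
  "ideal_class R I = {J. nonzero_ideal R J \<and> ideal_equiv R I J}"

definition class_group :: "complex set \<Rightarrow> complex set set set" where
  "class_group R = ideal_class R ` {I. nonzero_ideal R I}"

definition cap_kernel :: "complex set \<Rightarrow> complex set \<Rightarrow> complex set set set" where
  "cap_kernel R R' = {c \<in> class_group R. \<exists>I. nonzero_ideal R I \<and> c = ideal_class R I \<and>
       is_principal R' (gen_ideal R' I)}"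

text \<open>Subgroup of the (finite) class group generated by the classes of A and B.\<close>
definition class_subgroup2 :: "complex set \<Rightarrow> complex set \<Rightarrow> complex set \<Rightarrow> complex set set set" where
  "class_subgroup2 R A B =
     {ideal_class R (ideal_mult R (ideal_pow R A m) (ideal_pow R B n)) | m n. True}"

end

theory Submission
  imports Defs "Jordan_Normal_Form.Char_Poly" "HOL-Analysis.Kronecker_Approximation_Theorem"
    "HOL-Computational_Algebra.Nth_Powers"
begin

text \<open>
  Write \<open>x \<sim> y\<close> if \<open>x\<close> and \<open>y\<close> differ by a unit and a square of \<open>k\<close>. An ideal \<open>I\<close> with
  \<open>I\<^sup>2 = (a)\<close> is principal in an overfield \<open>L\<close> iff \<open>a \<sim> 1\<close> in \<open>L\<close>, so classes of such ideals are
  classes of numbers. An ideal \<open>I\<close> that becomes principal in \<open>K = k(\<surd>p)\<close> is of this kind, since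
  \<open>K\<close> contains the integer \<open>(1 + \<surd>p)/2\<close> of trace 1. The norm of \<open>a\<close> to \<open>\<rat>(\<i>)\<close> is then a unit times
  a square; as 2 is not a residue modulo both primes the unit is \<open>\<plusminus>1\<close>, and Hilbert 90 gives
  \<open>a \<sim> r\<close> with a square-free Gaussian integer \<open>r\<close>, which divides \<open>(1 + \<i>) p q\<close>.

  If \<open>x\<^sup>2 + 1 = d y\<^sup>2\<close>, then \<open>x + \<i>\<close> is a unit times a square in \<open>\<rat>(\<i>, \<surd>d)\<close>. For \<open>d = p\<close> this makes
  both factors of \<open>p = \<pi> \<pi>'\<close> trivial in \<open>K\<close>; for \<open>d = 2 p q\<close> it relates \<open>(1 + \<i>) \<xi>\<close> to \<open>\<pi>\<close> or
  \<open>\<pi>'\<close> in \<open>k\<close>, where \<open>q = \<xi> \<xi>'\<close>. Conversely, if \<open>r \<sim> 1\<close> in \<open>K\<close>, then the relative norms to the three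
  intermediate fields show that the norm of \<open>r\<close> is a square in \<open>K\<close>, which leaves only the
  products of \<open>\<pi>\<close> and \<open>\<pi>'\<close>. These are independent in \<open>k\<close> by the residue conditions. The field
  \<open>k(\<surd>q)\<close> is treated by exchanging \<open>p\<close> and \<open>q\<close> and translating back with the relation in \<open>k\<close>.
\<close>

section \<open>Algebraic integers\<close>

text \<open>The proof works without the unit groups of the fields and without factoring ideals.
  Every ideal that matters has a principal square, and integrality passes to square roots, so
  divisibility is tested by squaring a quotient. Units are controlled by two finite invariants: the
  relative norm to \<open>gauss_rat\<close>, one of four roots of unity, and the quotient
  \<open>v / cnj v\<close>, which has absolute value 1 under every embedding; a prime \<ge> 5
  dividing \<open>d\<close> exactly once forces this quotient into \<open>gauss_rat\<close>. The
  residue hypothesis enters at three places: \<i> times a square is not a norm from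
  \<open>k\<close>, the equation x^2 + 1 = 2 p q y^2 is solvable, and p is not a unit times a square
  in \<open>k\<close>. The first and the third reduce a norm form modulo a Gaussian prime, where
  \<i> becomes an integer j with j^2 = -1 and 2 j = (1 + j)^2; the second is a descent over the
  integers.\<close>

definition int_stable :: "'i set \<Rightarrow> ('i \<Rightarrow> complex) \<Rightarrow> complex \<Rightarrow> bool" where
  "int_stable S v z \<longleftrightarrow> (\<exists>A :: 'i \<Rightarrow> 'i \<Rightarrow> int. \<forall>s\<in>S. z * v s = (\<Sum>t\<in>S. of_int (A s t) * v t))"

text \<open>The determinant trick: \<open>v\<close> is an eigenvector of the integer matrix
  \<open>A\<close> with eigenvalue \<open>z\<close>, and the characteristic polynomial of an integer
  matrix is monic with integer coefficients. The nonzero entry makes \<open>v\<close> a nonzero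
  vector.\<close>

lemma alg_int_eigen:
  fixes v :: "nat \<Rightarrow> complex"
  assumes st: "int_stable {..<n} v z" and nz: "i < n" "v i \<noteq> 0"
  shows "alg_int z"
proof -
  obtain A :: "nat \<Rightarrow> nat \<Rightarrow> int"
    where A: "\<And>s. s < n \<Longrightarrow> z * v s = (\<Sum>t<n. of_int (A s t) * v t)"
    using st unfolding int_stable_def by auto
  define M where "M = Matrix.mat n n (\<lambda>(i, j). A i j)"
  define w where "w = Matrix.vec n v"
  have M: "M \<in> carrier_mat n n" by (simp add: M_def)
  let ?M = "map_mat of_int M :: complex mat"
  have MC: "?M \<in> carrier_mat n n" using M by simp
  have w: "w \<in> carrier_vec n" by (simp add: w_def)
  have "?M *\<^sub>v w = z \<cdot>\<^sub>v w"
  proof (rule eq_vecI)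
    fix j assume "j < dim_vec (z \<cdot>\<^sub>v w)"
    hence j: "j < n" by (simp add: w_def)
    have "vec_index (?M *\<^sub>v w) j = (\<Sum>t<n. of_int (A j t) * v t)"
      using j by (simp add: M_def w_def scalar_prod_def lessThan_atLeast0)
    thus "vec_index (?M *\<^sub>v w) j = vec_index (z \<cdot>\<^sub>v w) j" using A[OF j] j by (simp add: w_def)
  qed (simp add: M_def w_def)
  moreover have "w \<noteq> 0\<^sub>v n"
  proof
    assume "w = 0\<^sub>v n"
    hence "vec_index w i = 0" using nz by simp
    thus False using nz by (simp add: w_def)
  qed
  ultimately have "eigenvalue ?M z"
    unfolding eigenvalue_def eigenvector_def using w MC by auto
  hence "poly (char_poly ?M) z = 0" using eigenvalue_root_char_poly[OF MC] by simp
  moreover have "char_poly ?M = map_poly of_int (char_poly M)"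
    by (rule of_int_hom.char_poly_hom[OF M])
  ultimately show ?thesis
    unfolding alg_int_def using degree_monic_char_poly[OF M] by metis
qed

text \<open>Sums and products act on families indexed by pairs, while matrices are indexed by
  initial segments of the natural numbers; the family is renumbered along a bijection.\<close>

lemma int_stable_imp_alg_int:
  fixes v :: "'i \<Rightarrow> complex"
  assumes "finite S" "int_stable S v z" "s \<in> S" "v s \<noteq> 0"
  shows "alg_int z"
proof -
  obtain f where f: "bij_betw f {..<card S} S"
    using ex_bij_betw_nat_finite[OF assms(1)] by (auto simp: lessThan_atLeast0)
  obtain A :: "'i \<Rightarrow> 'i \<Rightarrow> int"
    where A: "\<And>s. s \<in> S \<Longrightarrow> z * v s = (\<Sum>t\<in>S. of_int (A s t) * v t)"
    using assms(2) unfolding int_stable_def by auto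
  have "z * v (f i) = (\<Sum>j<card S. of_int (A (f i) (f j)) * v (f j))" if "i < card S" for i
    using A[of "f i"] that f sum.reindex_bij_betw[OF f, of "\<lambda>t. of_int (A (f i) t) * v t"]
    by (auto simp: bij_betw_def)
  hence "int_stable {..<card S} (v \<circ> f) z"
    unfolding int_stable_def by (intro exI[of _ "\<lambda>i j. A (f i) (f j)"]) auto
  moreover obtain i where "i < card S" "s = f i"
    using bij_betw_imp_surj_on[OF f] assms(3) by auto
  ultimately show ?thesis using alg_int_eigen[of "card S" "v \<circ> f" z i] assms(4) by auto
qed

lemma int_stable_add:
  assumes "int_stable S v a" "int_stable S v b"
  shows "int_stable S v (a + b)"
proof -
  obtain A :: "'a \<Rightarrow> 'a \<Rightarrow> int"
    where "\<And>s. s \<in> S \<Longrightarrow> a * v s = (\<Sum>t\<in>S. of_int (A s t) * v t)"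
    using assms(1) unfolding int_stable_def by auto
  moreover obtain B :: "'a \<Rightarrow> 'a \<Rightarrow> int"
    where "\<And>s. s \<in> S \<Longrightarrow> b * v s = (\<Sum>t\<in>S. of_int (B s t) * v t)"
    using assms(2) unfolding int_stable_def by auto
  ultimately show ?thesis unfolding int_stable_def
    by (intro exI[of _ "\<lambda>s t. A s t + B s t"]) (simp add: sum.distrib ring_distribs)
qed

lemma int_stable_mult:
  assumes "finite S" "int_stable S v a" "int_stable S v b"
  shows "int_stable S v (a * b)"
proof -
  obtain A :: "'a \<Rightarrow> 'a \<Rightarrow> int"
    where A: "\<And>s. s \<in> S \<Longrightarrow> a * v s = (\<Sum>t\<in>S. of_int (A s t) * v t)"
    using assms(2) unfolding int_stable_def by auto
  obtain B :: "'a \<Rightarrow> 'a \<Rightarrow> int"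
    where B: "\<And>s. s \<in> S \<Longrightarrow> b * v s = (\<Sum>t\<in>S. of_int (B s t) * v t)"
    using assms(3) unfolding int_stable_def by auto
  have *: "a * b * v s = (\<Sum>t\<in>S. of_int (\<Sum>r\<in>S. B s r * A r t) * v t)" if s: "s \<in> S" for s
  proof -
    have "a * b * v s = a * (\<Sum>r\<in>S. of_int (B s r) * v r)"
      by (simp only: B[OF s] mult.assoc)
    also have "\<dots> = (\<Sum>r\<in>S. of_int (B s r) * (a * v r))"
      by (simp only: sum_distrib_left mult.left_commute[of a])
    also have "\<dots> = (\<Sum>r\<in>S. \<Sum>t\<in>S. of_int (B s r) * (of_int (A r t) * v t))"
      by (intro sum.cong refl) (simp only: A sum_distrib_left)
    also have "\<dots> = (\<Sum>t\<in>S. \<Sum>r\<in>S. of_int (B s r) * (of_int (A r t) * v t))"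
      by (rule sum.swap)
    finally show ?thesis by (simp only: of_int_sum of_int_mult sum_distrib_right mult.assoc)
  qed
  show ?thesis unfolding int_stable_def
    by (intro exI[of _ "\<lambda>s t. \<Sum>r\<in>S. B s r * A r t"] ballI *)
qed

lemma alg_int_powers_stable:
  assumes "alg_int a"
  obtains n where "n > 0" "int_stable {..<n} (\<lambda>i. a ^ i) a"
proof -
  obtain p :: "int poly" where lc: "lead_coeff p = 1" and root: "poly (map_poly of_int p) a = 0"
    using assms unfolding alg_int_def by auto
  define n where "n = degree p"
  have sum0: "(\<Sum>i\<le>n. of_int (Polynomial.coeff p i) * a ^ i) = 0"
    using root by (simp add: poly_altdef n_def coeff_map_poly degree_map_poly)
  have n0: "n > 0"
  proof (rule ccontr)
    assume "\<not> n > 0"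
    hence "n = 0" by simp
    thus False using sum0 lc by (simp add: n_def)
  qed
  have an: "a ^ n = (\<Sum>i<n. of_int (- Polynomial.coeff p i) * a ^ i)"
  proof -
    have "(\<Sum>i\<le>n. of_int (Polynomial.coeff p i) * a ^ i) = (\<Sum>i<n. of_int (Polynomial.coeff p i) * a ^ i) + a ^ n"
      using lc by (simp add: n_def flip: lessThan_Suc_atMost)
    with sum0 show ?thesis by (simp add: sum_negf eq_neg_iff_add_eq_0 add.commute)
  qed
  \<comment> \<open>The companion matrix of \<open>p\<close>: each row moves to the next power, and
    the last row rewrites the n-th power by the monic relation \<open>an\<close>.\<close>
  define A where "A = (\<lambda>i j. if Suc i < n then (if j = Suc i then 1 else 0) else - Polynomial.coeff p j)"
  have "a * a ^ i = (\<Sum>j<n. of_int (A i j) * a ^ j)" if i: "i < n" for i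
  proof (cases "Suc i < n")
    case True
    have "(\<Sum>j<n. of_int (A i j) * a ^ j) = (\<Sum>j<n. if j = Suc i then a ^ j else 0)"
      using True by (intro sum.cong) (auto simp: A_def)
    thus ?thesis using True by simp
  next
    case False
    hence "Suc i = n" using i by simp
    thus ?thesis using an False by (simp add: A_def flip: power_Suc)
  qed
  hence "int_stable {..<n} (\<lambda>i. a ^ i) a"
    unfolding int_stable_def by (intro exI[of _ A]) auto
  with n0 show ?thesis using that by blast
qed

text \<open>One row of the Kronecker product of \<open>A\<close> with an identity matrix:
  \<open>a\<close> acts on the first factor and leaves \<open>v j\<close> alone.\<close>

lemma int_stable_times_delta:
  fixes u v :: "nat \<Rightarrow> complex" and A :: "nat \<Rightarrow> nat \<Rightarrow> int"
  assumes "a * u i = (\<Sum>s<m. of_int (A i s) * u s)" and "j < n"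
  shows "a * (u i * v j) = (\<Sum>s<m. \<Sum>t<n. of_int (if t = j then A i s else 0) * (u s * v t))"
proof -
  have "(\<Sum>t<n. of_int (if t = j then A i s else 0) * (u s * v t)) = of_int (A i s) * u s * v j" for s
  proof -
    have "(\<Sum>t<n. of_int (if t = j then A i s else 0) * (u s * v t))
        = (\<Sum>t<n. if t = j then of_int (A i s) * u s * v t else 0)"
      by (intro sum.cong) auto
    thus ?thesis using assms(2) by simp
  qed
  moreover have "a * (u i * v j) = (\<Sum>s<m. of_int (A i s) * u s) * v j"
    using assms(1) by (simp only: mult.assoc[symmetric])
  ultimately show ?thesis by (simp only: sum_distrib_right)
qed

lemma int_stable_Times_left:
  fixes u v :: "nat \<Rightarrow> complex"
  assumes "int_stable {..<m} u a"
  shows "int_stable ({..<m} \<times> {..<n}) (\<lambda>(i, j). u i * v j) a"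
proof -
  obtain A :: "nat \<Rightarrow> nat \<Rightarrow> int"
    where A: "\<And>s. s < m \<Longrightarrow> a * u s = (\<Sum>t<m. of_int (A s t) * u t)"
    using assms unfolding int_stable_def by auto
  have "a * (u i * v j) = (\<Sum>(s, t)\<in>{..<m} \<times> {..<n}.
             of_int (if t = j then A i s else 0) * (u s * v t))" if "i < m" "j < n" for i j
    using int_stable_times_delta[of a u i A m j n v, OF A[OF that(1)] that(2)]
    by (simp only: sum.cartesian_product)
  thus ?thesis
    unfolding int_stable_def
    by (intro exI[of _ "\<lambda>(i, j) (s, t). if t = j then A i s else 0"]) (auto simp: case_prod_beta cong del: if_weak_cong)
qed

lemma int_stable_Times_right:
  fixes u v :: "nat \<Rightarrow> complex"
  assumes "int_stable {..<m} u a"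
  shows "int_stable ({..<n} \<times> {..<m}) (\<lambda>(j, i). v j * u i) a"
proof -
  obtain A :: "nat \<Rightarrow> nat \<Rightarrow> int"
    where A: "\<And>s. s < m \<Longrightarrow> a * u s = (\<Sum>t<m. of_int (A s t) * u t)"
    using assms unfolding int_stable_def by auto
  have "a * (v j * u i) = (\<Sum>(t, s)\<in>{..<n} \<times> {..<m}.
             of_int (if t = j then A i s else 0) * (v t * u s))" if "i < m" "j < n" for i j
  proof -
    have "a * (v j * u i) = (\<Sum>s<m. \<Sum>t<n. of_int (if t = j then A i s else 0) * (v t * u s))"
      using int_stable_times_delta[of a u i A m j n v, OF A[OF that(1)] that(2)]
      by (simp only: mult.commute[of "v _"])
    also have "\<dots> = (\<Sum>t<n. \<Sum>s<m. of_int (if t = j then A i s else 0) * (v t * u s))"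
      by (rule sum.swap)
    finally show ?thesis by (simp only: sum.cartesian_product)
  qed
  thus ?thesis
    unfolding int_stable_def
    by (intro exI[of _ "\<lambda>(j, i) (t, s). if t = j then A i s else 0"]) (auto simp: case_prod_beta cong del: if_weak_cong)
qed

text \<open>Both numbers act by integer matrices on the family of monomials
  \<open>a ^ i * b ^ j\<close>, hence so do their sum and product.\<close>

lemma alg_int_add_mult:
  assumes "alg_int a" "alg_int b"
  shows "alg_int (a + b)" "alg_int (a * b)"
proof -
  obtain m where m: "m > 0" "int_stable {..<m} (\<lambda>i. a ^ i) a"
    using alg_int_powers_stable[OF assms(1)] .
  obtain n where n: "n > 0" "int_stable {..<n} (\<lambda>i. b ^ i) b"
    using alg_int_powers_stable[OF assms(2)] .
  define S where "S = {..<m} \<times> {..<n}"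
  define v where "v = (\<lambda>(i, j). a ^ i * b ^ j)"
  have fin: "finite S" and z: "(0, 0) \<in> S" "v (0, 0) \<noteq> 0"
    using m n by (auto simp: S_def v_def)
  have st: "int_stable S v a" "int_stable S v b"
    unfolding S_def v_def using int_stable_Times_left[OF m(2)] int_stable_Times_right[OF n(2)] by blast+
  show "alg_int (a + b)" by (rule int_stable_imp_alg_int[OF fin int_stable_add[OF st] z])
  show "alg_int (a * b)" by (rule int_stable_imp_alg_int[OF fin int_stable_mult[OF fin st] z])
qed

lemmas alg_int_add = alg_int_add_mult(1)
  and alg_int_mult = alg_int_add_mult(2)

lemma alg_int_iff_algebraic_int: "alg_int z \<longleftrightarrow> algebraic_int z"
  unfolding alg_int_def algebraic_int_altdef_ipoly by (simp only: conj_commute)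

lemma alg_int_of_int [simp]: "alg_int (of_int n)"
  by (simp add: alg_int_iff_algebraic_int int_imp_algebraic_int)

lemma alg_int_of_nat [simp]: "alg_int (of_nat n)"
  using alg_int_of_int[of "int n"] by simp

lemma alg_int_0 [simp]: "alg_int 0" and alg_int_1 [simp]: "alg_int 1"
  using alg_int_of_int[of 0] alg_int_of_int[of 1] by auto

lemma alg_int_ii [simp]: "alg_int \<i>"
  by (simp add: alg_int_iff_algebraic_int)

lemma alg_int_minus: "alg_int z \<Longrightarrow> alg_int (- z)"
  by (simp add: alg_int_iff_algebraic_int)

lemma alg_int_diff: "alg_int a \<Longrightarrow> alg_int b \<Longrightarrow> alg_int (a - b)"
  using alg_int_add[of a "- b"] alg_int_minus[of b] by simp

lemma alg_int_cnj: "alg_int z \<Longrightarrow> alg_int (cnj z)"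
  by (simp add: alg_int_iff_algebraic_int)

text \<open>The substitute for valuations: a quotient is proved integral by proving that its square
  is, and squares are known as soon as an ideal has a principal square.\<close>

lemma alg_int_sqrtD:
  assumes "alg_int (z * z)" shows "alg_int z"
proof -
  have "algebraic_int z"
  proof (rule algebraic_int_root[where p = "Polynomial.monom 1 2"])
    show "algebraic_int (z * z)" using assms by (simp add: alg_int_iff_algebraic_int)
  qed (auto simp: poly_monom degree_monom_eq power2_eq_square)
  thus ?thesis by (simp add: alg_int_iff_algebraic_int)
qed

lemma alg_int_rat_int: "alg_int z \<Longrightarrow> z \<in> \<rat> \<Longrightarrow> z \<in> \<int>"
  by (simp add: alg_int_iff_algebraic_int rational_algebraic_int_is_int)

section \<open>Subfields of the complex numbers\<close>

lemma
  assumes "is_subfield F"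
  shows subfield_0: "0 \<in> F" and subfield_1: "1 \<in> F"
    and subfield_add: "x \<in> F \<Longrightarrow> y \<in> F \<Longrightarrow> x + y \<in> F"
    and subfield_mult: "x \<in> F \<Longrightarrow> y \<in> F \<Longrightarrow> x * y \<in> F"
    and subfield_minus: "x \<in> F \<Longrightarrow> - x \<in> F"
    and subfield_inverse: "x \<in> F \<Longrightarrow> inverse x \<in> F"
  using assms unfolding is_subfield_def by (blast, blast, blast, blast, blast, metis inverse_zero)

lemma subfield_diff: "is_subfield F \<Longrightarrow> x \<in> F \<Longrightarrow> y \<in> F \<Longrightarrow> x - y \<in> F"
  using subfield_add[of F x "- y"] subfield_minus[of F y] by simp

lemma subfield_divide: "is_subfield F \<Longrightarrow> x \<in> F \<Longrightarrow> y \<in> F \<Longrightarrow> x / y \<in> F"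
  using subfield_mult[of F x "inverse y"] subfield_inverse[of F y] by (simp add: divide_inverse)

lemma subfield_of_nat: "is_subfield F \<Longrightarrow> of_nat n \<in> F"
  by (induction n) (auto intro: subfield_0 subfield_1 subfield_add)

lemma subfield_of_int: "is_subfield F \<Longrightarrow> of_int n \<in> F"
  by (cases n) (auto intro: subfield_of_nat subfield_minus subfield_diff subfield_1)

lemma subfield_numeral: "is_subfield F \<Longrightarrow> numeral n \<in> F"
  using subfield_of_nat[of F "numeral n"] by simp

lemma subfield_Rats: "is_subfield F \<Longrightarrow> x \<in> \<rat> \<Longrightarrow> x \<in> F"
  by (auto elim!: Rats_cases' intro: subfield_divide subfield_of_int)

lemmas subfield_intros = subfield_0 subfield_1 subfield_add subfield_mult subfield_minus
  subfield_diff subfield_inverse subfield_divide subfield_of_nat subfield_of_int subfield_numeral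

section \<open>Gaussian rationals and Gaussian integers\<close>

definition gauss_rat :: "complex set" where
  "gauss_rat = {z. Re z \<in> \<rat> \<and> Im z \<in> \<rat>}"

definition gauss_int :: "complex set" where
  "gauss_int = {z. Re z \<in> \<int> \<and> Im z \<in> \<int>}"

lemma gauss_rat_subfield: "is_subfield gauss_rat"
  unfolding is_subfield_def gauss_rat_def by (auto simp: power2_eq_square)

lemma gauss_int_0 [simp]: "0 \<in> gauss_int" and gauss_int_1 [simp]: "1 \<in> gauss_int"
  and gauss_int_ii [simp]: "\<i> \<in> gauss_int"
  and gauss_int_of_int [simp]: "of_int n \<in> gauss_int"
  and gauss_int_of_nat [simp]: "of_nat m \<in> gauss_int"
  and gauss_int_numeral [simp]: "numeral k \<in> gauss_int"
  and gauss_int_add: "x \<in> gauss_int \<Longrightarrow> y \<in> gauss_int \<Longrightarrow> x + y \<in> gauss_int"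
  and gauss_int_diff: "x \<in> gauss_int \<Longrightarrow> y \<in> gauss_int \<Longrightarrow> x - y \<in> gauss_int"
  and gauss_int_minus: "x \<in> gauss_int \<Longrightarrow> - x \<in> gauss_int"
  and gauss_int_mult: "x \<in> gauss_int \<Longrightarrow> y \<in> gauss_int \<Longrightarrow> x * y \<in> gauss_int"
  and gauss_int_cnj: "x \<in> gauss_int \<Longrightarrow> cnj x \<in> gauss_int"
  unfolding gauss_int_def by auto

lemma gauss_int_power: "x \<in> gauss_int \<Longrightarrow> x ^ n \<in> gauss_int"
  by (induction n) (auto intro: gauss_int_mult)

lemmas gauss_int_intros = gauss_int_0 gauss_int_1 gauss_int_ii gauss_int_of_int gauss_int_of_nat
  gauss_int_numeral gauss_int_add gauss_int_diff gauss_int_minus gauss_int_mult gauss_int_cnj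
  gauss_int_power

lemma gauss_intE:
  assumes "z \<in> gauss_int"
  obtains a b :: int where "z = of_int a + \<i> * of_int b"
proof -
  obtain a b :: int where "Re z = of_int a" "Im z = of_int b"
    using assms unfolding gauss_int_def by (auto elim!: Ints_cases)
  hence "z = of_int a + \<i> * of_int b" by (simp add: complex_eq_iff)
  thus ?thesis using that by blast
qed

lemma gauss_int_rat: "x \<in> gauss_int \<Longrightarrow> x \<in> gauss_rat"
  unfolding gauss_int_def gauss_rat_def using Ints_subset_Rats by auto

lemma gauss_rat_cnj: "x \<in> gauss_rat \<Longrightarrow> cnj x \<in> gauss_rat"
  unfolding gauss_rat_def by auto

lemma gauss_rat_ii: "\<i> \<in> gauss_rat"
  unfolding gauss_rat_def by auto

lemma gauss_int_alg_int: "z \<in> gauss_int \<Longrightarrow> alg_int z"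
  by (erule gauss_intE) (auto intro!: alg_int_add alg_int_mult)

lemma alg_int_real_rat:
  assumes "alg_int (of_real x)" "x \<in> \<rat>" shows "x \<in> \<int>"
proof -
  have "complex_of_real x \<in> \<rat>" using assms(2) by (auto elim!: Rats_cases' simp: of_real_divide)
  hence "complex_of_real x \<in> \<int>" by (rule alg_int_rat_int[OF assms(1)])
  thus ?thesis by (metis Ints_cases Ints_of_int of_real_eq_iff of_real_of_int_eq)
qed

text \<open>Traces and norm give the integers \<open>A\<close> = 2 x, \<open>B\<close> = 2 y and x^2
  + y^2; then A^2 + B^2 is divisible by 4, which forces both to be even.\<close>

lemma alg_int_gauss_rat:
  assumes "alg_int z" "z \<in> gauss_rat" shows "z \<in> gauss_int"
proof -
  define x y where "x = Re z" and "y = Im z"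
  have z: "z = of_real x + \<i> * of_real y" by (simp add: x_def y_def complex_eq_iff)
  have xy: "x \<in> \<rat>" "y \<in> \<rat>" using assms(2) by (auto simp: gauss_rat_def x_def y_def)
  have c: "alg_int (cnj z)" by (rule alg_int_cnj[OF assms(1)])
  have "z + cnj z = of_real (2 * x)" by (simp add: z)
  hence "2 * x \<in> \<int>"
    using alg_int_real_rat[of "2 * x"] alg_int_add[OF assms(1) c] xy by simp
  then obtain A :: int where A: "2 * x = of_int A" by (auto elim: Ints_cases)
  have "\<i> * (cnj z - z) = of_real (2 * y)" by (simp add: z algebra_simps)
  hence "2 * y \<in> \<int>"
    using alg_int_real_rat[of "2 * y"] alg_int_mult[OF alg_int_ii alg_int_diff[OF c assms(1)]] xy by simp
  then obtain B :: int where B: "2 * y = of_int B" by (auto elim: Ints_cases)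
  have "z * cnj z = of_real (x * x + y * y)" by (simp add: z algebra_simps)
  hence "x * x + y * y \<in> \<int>"
    using alg_int_real_rat[of "x * x + y * y"] alg_int_mult[OF assms(1) c] xy by simp
  then obtain N :: int where N: "x * x + y * y = of_int N" by (auto elim: Ints_cases)
  have "of_int (A * A + B * B) = (2 * x) * (2 * x) + (2 * y) * (2 * y)" by (simp add: A B)
  also have "\<dots> = of_int (4 * N)" using N by (simp add: algebra_simps)
  finally have eq: "A * A + B * B = 4 * N" by (simp only: of_int_eq_iff)
  have sq: "n * n mod 4 = (if even n then 0 else 1)" for n :: int
  proof (cases "even n")
    case True
    then obtain k where "n = 2 * k" by (elim evenE)
    thus ?thesis by simp
  next
    case False
    then obtain k where "n = 2 * k + 1" by (elim oddE)
    hence "n * n = 4 * (k * k + k) + 1" by (simp add: algebra_simps)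
    thus ?thesis using False by presburger
  qed
  have "even A \<and> even B" using sq[of A] sq[of B] eq by presburger
  then obtain a b where "A = 2 * a" "B = 2 * b" by (elim conjE evenE)
  hence "x = of_int a" "y = of_int b" using A B by auto
  thus ?thesis by (simp add: gauss_int_def flip: x_def y_def)
qed

lemma gauss_int_sqrtD: "z \<in> gauss_rat \<Longrightarrow> z * z \<in> gauss_int \<Longrightarrow> z \<in> gauss_int"
  using alg_int_gauss_rat alg_int_sqrtD gauss_int_alg_int by blast

lemma alg_int_quadratic:
  assumes "t \<in> gauss_int" "m \<in> gauss_int" "x * x - t * x + m = 0"
  shows "alg_int x"
proof -
  obtain a b where t: "t = of_int a + \<i> * of_int b" using assms(1) by (rule gauss_intE)
  obtain c d where m: "m = of_int c + \<i> * of_int d" using assms(2) by (rule gauss_intE)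
  \<comment> \<open>The product of X^2 - t X + m with its coefficientwise complex conjugate, which
    has integer coefficients.\<close>
  define p :: "int poly"
    where "p = [:c * c + d * d, - (2 * a * c + 2 * b * d), a * a + b * b + 2 * c, - (2 * a), 1:]"
  have "(x * x - t * x + m) * (x * x - cnj t * x + cnj m) = 0" using assms(3) by simp
  hence "poly (map_poly of_int p) x = 0"
    by (simp add: p_def t m map_poly_pCons algebra_simps)
  moreover have "lead_coeff p = 1" by (simp add: p_def)
  ultimately show ?thesis unfolding alg_int_def by blast
qed

text \<open>The root is a Gaussian integer a + b \<i> with a b = 0, and b \<noteq> 0 would make its
  square negative.\<close>

lemma nat_square_gauss_rat:
  assumes "of_nat n = z * z" "z \<in> gauss_rat"
  shows "\<exists>m::nat. n = m * m"
proof -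
  have "z \<in> gauss_int" by (rule gauss_int_sqrtD) (use assms in \<open>auto simp flip: assms(1)\<close>)
  then obtain a b where z: "z = of_int a + \<i> * of_int b" by (rule gauss_intE)
  have "Re (z * z) = real n" "Im (z * z) = 0" by (simp_all flip: assms(1))
  hence "of_int (a * a - b * b) = (of_int (int n) :: real)" "of_int (a * b) = (0 :: real)"
    by (simp_all add: z)
  hence eq: "a * a - b * b = int n" and ab: "a * b = 0" by (simp_all only: of_int_eq_iff of_int_eq_0_iff)
  have "int n = a * a"
  proof (cases "b = 0")
    case False
    hence "a = 0" using ab by simp
    hence "int n = - (b * b)" using eq by simp
    moreover have "b * b > 0" using False by (auto simp: zero_less_mult_iff)
    ultimately show ?thesis by linarith
  qed (use eq in simp)
  hence "n = nat \<bar>a\<bar> * nat \<bar>a\<bar>" by (simp add: nat_mult_distrib[symmetric] flip: abs_mult)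
  thus ?thesis by blast
qed

section \<open>Quadratic extensions\<close>

definition adj :: "complex set \<Rightarrow> complex \<Rightarrow> complex set" where
  "adj E w = {x + y * w | x y. x \<in> E \<and> y \<in> E}"

text \<open>The description is meaningful only under \<open>quad_ext\<close>, where 1 and
  \<open>w\<close> are linearly independent over \<open>E\<close>; outside \<open>adj E w\<close>
  the value is unspecified.\<close>

definition qconj :: "complex set \<Rightarrow> complex \<Rightarrow> complex \<Rightarrow> complex" where
  "qconj E w z = (THE z'. \<exists>x\<in>E. \<exists>y\<in>E. z = x + y * w \<and> z' = x - y * w)"

lemma adjI: "x \<in> E \<Longrightarrow> y \<in> E \<Longrightarrow> x + y * w \<in> adj E w"
  unfolding adj_def by blast

locale quad_ext =
  fixes E :: "complex set" and w :: complex
  assumes sub: "is_subfield E" and ww: "w * w \<in> E" and w: "w \<notin> E"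
begin

lemma adj_eq_iff:
  assumes "x \<in> E" "y \<in> E" "x' \<in> E" "y' \<in> E"
  shows "x + y * w = x' + y' * w \<longleftrightarrow> x = x' \<and> y = y'"
proof
  assume eq: "x + y * w = x' + y' * w"
  have "y = y'"
  proof (rule ccontr)
    assume ne: "y \<noteq> y'"
    have "(y - y') * w = x' - x" using eq by (simp add: algebra_simps)
    hence "w = (x' - x) / (y - y')" using ne by (simp add: field_simps)
    moreover have "(x' - x) / (y - y') \<in> E" using assms sub by (intro subfield_intros)
    ultimately show False using w by simp
  qed
  thus "x = x' \<and> y = y'" using eq by simp
qed simp

lemma qconj_eq [simp]:
  assumes "x \<in> E" "y \<in> E" shows "qconj E w (x + y * w) = x - y * w"
  unfolding qconj_def
proof (rule the_equality)
  fix z' assume "\<exists>x'\<in>E. \<exists>y'\<in>E. x + y * w = x' + y' * w \<and> z' = x' - y' * w"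
  thus "z' = x - y * w" using adj_eq_iff[OF assms] by auto
qed (use assms in blast)

lemma qconj_base [simp]: "x \<in> E \<Longrightarrow> qconj E w x = x"
  using qconj_eq[of x 0] subfield_0[OF sub] by simp

lemma base_subset: "x \<in> E \<Longrightarrow> x \<in> adj E w"
  using adjI[of x E 0 w] subfield_0[OF sub] by simp

lemma gen_in_adj: "w \<in> adj E w"
  using adjI[of 0 E 1 w] subfield_0[OF sub] subfield_1[OF sub] by simp

lemma adjE:
  assumes "z \<in> adj E w"
  obtains x y where "x \<in> E" "y \<in> E" "z = x + y * w" "qconj E w z = x - y * w"
  using assms unfolding adj_def by auto

lemma qconj_in: "z \<in> adj E w \<Longrightarrow> qconj E w z \<in> adj E w"
proof (erule adjE)
  fix x y assume "x \<in> E" "y \<in> E" "qconj E w z = x - y * w"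
  thus ?thesis using adjI[of x E "- y" w] subfield_minus[OF sub] by simp
qed

lemma qconj_qconj [simp]: "z \<in> adj E w \<Longrightarrow> qconj E w (qconj E w z) = z"
proof (erule adjE)
  fix x y assume "x \<in> E" "y \<in> E" "qconj E w z = x - y * w" "z = x + y * w"
  thus ?thesis using qconj_eq[of x "- y"] subfield_minus[OF sub] by simp
qed

lemma adj_add: "a \<in> adj E w \<Longrightarrow> b \<in> adj E w \<Longrightarrow> a + b \<in> adj E w"
  and qconj_add: "a \<in> adj E w \<Longrightarrow> b \<in> adj E w \<Longrightarrow> qconj E w (a + b) = qconj E w a + qconj E w b"
proof -
  assume "a \<in> adj E w" "b \<in> adj E w"
  then obtain x y x' y' where *: "x \<in> E" "y \<in> E" "a = x + y * w" "x' \<in> E" "y' \<in> E" "b = x' + y' * w"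
    by (auto elim!: adjE)
  have q: "qconj E w a = x - y * w" "qconj E w b = x' - y' * w" using * by simp_all
  have e: "a + b = (x + x') + (y + y') * w" using * by (simp add: algebra_simps)
  have c: "x + x' \<in> E" "y + y' \<in> E" using * sub by (auto intro: subfield_intros)
  show "a + b \<in> adj E w" unfolding e by (rule adjI[OF c])
  show "qconj E w (a + b) = qconj E w a + qconj E w b"
    unfolding e qconj_eq[OF c] q by (simp add: algebra_simps)
qed

lemma adj_mult: "a \<in> adj E w \<Longrightarrow> b \<in> adj E w \<Longrightarrow> a * b \<in> adj E w"
  and qconj_mult: "a \<in> adj E w \<Longrightarrow> b \<in> adj E w \<Longrightarrow> qconj E w (a * b) = qconj E w a * qconj E w b"
proof -
  assume "a \<in> adj E w" "b \<in> adj E w"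
  then obtain x y x' y' where *: "x \<in> E" "y \<in> E" "a = x + y * w" "x' \<in> E" "y' \<in> E" "b = x' + y' * w"
    by (auto elim!: adjE)
  have q: "qconj E w a = x - y * w" "qconj E w b = x' - y' * w" using * by simp_all
  have e: "a * b = (x * x' + y * y' * (w * w)) + (x * y' + y * x') * w" using * by (simp add: algebra_simps)
  have c: "x * x' + y * y' * (w * w) \<in> E" "x * y' + y * x' \<in> E"
    using * sub ww by (auto intro!: subfield_add subfield_mult)
  show "a * b \<in> adj E w" unfolding e by (rule adjI[OF c])
  show "qconj E w (a * b) = qconj E w a * qconj E w b"
    unfolding e qconj_eq[OF c] q by (simp add: algebra_simps)
qed

lemma adj_minus: "a \<in> adj E w \<Longrightarrow> - a \<in> adj E w"
proof -
  assume a: "a \<in> adj E w"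
  have m: "- 1 \<in> E" using sub by (intro subfield_minus subfield_1)
  show "- a \<in> adj E w" using adj_mult[OF base_subset[OF m] a] by simp
qed

lemma norm_in_base: "z \<in> adj E w \<Longrightarrow> z * qconj E w z \<in> E"
proof (erule adjE)
  fix x y assume *: "x \<in> E" "y \<in> E" "qconj E w z = x - y * w" "z = x + y * w"
  have "z * qconj E w z = x * x - y * y * (w * w)" unfolding *(3) unfolding *(4) by (simp add: algebra_simps)
  thus ?thesis using * sub ww by (auto intro!: subfield_diff subfield_mult)
qed

lemma trace_in_base: "z \<in> adj E w \<Longrightarrow> z + qconj E w z \<in> E"
proof (erule adjE)
  fix x y assume *: "x \<in> E" "y \<in> E" "qconj E w z = x - y * w" "z = x + y * w"
  have "z + qconj E w z = x + x" unfolding *(3) unfolding *(4) by simp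
  thus ?thesis using * sub by (simp only: subfield_add)
qed

lemma qconj_0_iff [simp]: "z \<in> adj E w \<Longrightarrow> qconj E w z = 0 \<longleftrightarrow> z = 0"
  by (metis qconj_base qconj_qconj sub subfield_0)

lemma adj_subfield: "is_subfield (adj E w)"
proof -
  have "inverse z \<in> adj E w" if z: "z \<in> adj E w" "z \<noteq> 0" for z
  proof -
    have "inverse z = qconj E w z * inverse (z * qconj E w z)"
      using z qconj_0_iff[OF z(1)] by (simp add: field_simps del: qconj_0_iff)
    moreover have "inverse (z * qconj E w z) \<in> adj E w"
      by (intro base_subset subfield_inverse[OF sub] norm_in_base z)
    ultimately show ?thesis using adj_mult[OF qconj_in[OF z(1)]] by metis
  qed
  thus ?thesis unfolding is_subfield_def
    using adj_add adj_mult adj_minus base_subset subfield_0[OF sub] subfield_1[OF sub] by auto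
qed

lemma qconj_inverse: "z \<in> adj E w \<Longrightarrow> qconj E w (inverse z) = inverse (qconj E w z)"
proof (cases "z = 0")
  case False
  assume z: "z \<in> adj E w"
  hence i: "inverse z \<in> adj E w" using subfield_inverse[OF adj_subfield] by simp
  have "qconj E w (inverse z) * qconj E w z = qconj E w (inverse z * z)"
    by (rule qconj_mult[OF i z, symmetric])
  hence "qconj E w (inverse z) * qconj E w z = 1"
    using False subfield_1[OF sub] by simp
  thus ?thesis by (metis inverse_unique mult.commute)
qed (simp add: subfield_0[OF sub])

lemma qconj_divide: "a \<in> adj E w \<Longrightarrow> b \<in> adj E w \<Longrightarrow> qconj E w (a / b) = qconj E w a / qconj E w b"
  using qconj_mult[of a "inverse b"] subfield_inverse[OF adj_subfield, of b]
  by (simp add: qconj_inverse divide_inverse)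

lemma qconj_fixed:
  assumes "z \<in> adj E w" "qconj E w z = z" shows "z \<in> E"
proof -
  obtain x y where *: "x \<in> E" "y \<in> E" "z = x + y * w" "qconj E w z = x - y * w"
    using assms(1) by (rule adjE)
  have "y * w = 0" using * assms(2) by auto
  hence "z = x" using *(3) by (simp only: add_0_right)
  thus ?thesis using *(1) by (simp only:)
qed

lemma qconj_poly:
  assumes z: "z \<in> adj E w"
  shows "poly (map_poly of_int p) z \<in> adj E w \<and>
         qconj E w (poly (map_poly of_int p) z) = poly (map_poly of_int p) (qconj E w z)"
proof (induction p)
  case 0
  thus ?case using base_subset[OF subfield_0[OF sub]] subfield_0[OF sub] by simp
next
  case (pCons a p)
  have a: "of_int a \<in> E" by (rule subfield_of_int[OF sub])
  show ?case
    using pCons z base_subset[OF a] a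
    by (simp add: map_poly_pCons adj_add adj_mult qconj_add qconj_mult)
qed

lemma alg_int_qconj:
  assumes "z \<in> adj E w" "alg_int z" shows "alg_int (qconj E w z)"
proof -
  obtain p :: "int poly" where "lead_coeff p = 1" "poly (map_poly of_int p) z = 0"
    using assms(2) unfolding alg_int_def by auto
  moreover have "qconj E w 0 = 0" using subfield_0[OF sub] by simp
  ultimately show ?thesis unfolding alg_int_def using qconj_poly[OF assms(1), of p] by metis
qed

text \<open>Kummer theory in degree 2: the mixed term 2 x y of z^2 must vanish, so z lies in
  \<open>E\<close> or in \<open>E\<close> times \<open>w\<close>. Iterating this lists the natural
  numbers that become squares in \<open>k\<close> and in \<open>K\<close>.\<close>

lemma square_in_adjD:
  assumes "c \<in> E" "z \<in> adj E w" "c = z * z"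
  shows "\<exists>y\<in>E. c = y * y \<or> c * (w * w) = y * y"
proof -
  obtain x y where *: "x \<in> E" "y \<in> E" "z = x + y * w" using assms(2) by (rule adjE)
  have c: "x * x + y * y * (w * w) \<in> E" "2 * x * y \<in> E"
    using * sub ww by (auto intro!: subfield_add subfield_mult subfield_numeral)
  have "c + 0 * w = (x * x + y * y * (w * w)) + (2 * x * y) * w"
    using * assms(3) by (simp add: algebra_simps)
  hence eq: "c = x * x + y * y * (w * w)" "2 * x * y = 0"
    using adj_eq_iff[OF assms(1) subfield_0[OF sub] c] by auto
  show ?thesis
  proof (cases "y = 0")
    case True
    thus ?thesis using eq * by auto
  next
    case False
    hence "c * (w * w) = (y * (w * w)) * (y * (w * w))" using eq by simp
    thus ?thesis using * ww sub by (meson subfield_mult)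
  qed
qed

lemma cnj_adj:
  assumes "\<And>x. x \<in> E \<Longrightarrow> cnj x \<in> E" "cnj w = w" "z \<in> adj E w"
  shows "cnj z \<in> adj E w" "qconj E w (cnj z) = cnj (qconj E w z)"
proof -
  obtain x y where *: "x \<in> E" "y \<in> E" "z = x + y * w" using assms(3) by (rule adjE)
  hence "cnj z = cnj x + cnj y * w" using assms(2) by simp
  thus "cnj z \<in> adj E w" "qconj E w (cnj z) = cnj (qconj E w z)"
    using * assms(1,2) by (simp_all add: adjI)
qed

end

section \<open>Arithmetic of the Gaussian integers\<close>

text \<open>A natural number, so that elements of least norm exist and norms can serve for
  induction; the floors change nothing on \<open>gauss_int\<close>.\<close>

definition gauss_norm :: "complex \<Rightarrow> nat" where
  "gauss_norm z = nat (\<lfloor>Re z\<rfloor> ^ 2 + \<lfloor>Im z\<rfloor> ^ 2)"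

lemma of_nat_gauss_norm:
  assumes "z \<in> gauss_int" shows "complex_of_nat (gauss_norm z) = z * cnj z"
proof -
  obtain a b where z: "z = of_int a + \<i> * of_int b" using assms by (rule gauss_intE)
  have "gauss_norm z = nat (a ^ 2 + b ^ 2)" by (simp add: gauss_norm_def z)
  hence "int (gauss_norm z) = a ^ 2 + b ^ 2" by simp
  hence "complex_of_int (int (gauss_norm z)) = complex_of_int (a ^ 2 + b ^ 2)" by simp
  thus ?thesis by (simp add: z power2_eq_square algebra_simps)
qed

lemma real_gauss_norm:
  assumes "z \<in> gauss_int" shows "real (gauss_norm z) = cmod z ^ 2"
proof -
  have "complex_of_real (real (gauss_norm z)) = complex_of_real (cmod z ^ 2)"
    using of_nat_gauss_norm[OF assms] by (simp add: complex_norm_square del: of_real_power)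
  thus ?thesis by (simp only: of_real_eq_iff)
qed

lemma gauss_norm_mult:
  assumes "x \<in> gauss_int" "y \<in> gauss_int"
  shows "gauss_norm (x * y) = gauss_norm x * gauss_norm y"
proof -
  have "real (gauss_norm (x * y)) = real (gauss_norm x * gauss_norm y)"
    using assms by (simp add: real_gauss_norm gauss_int_mult norm_mult power_mult_distrib)
  thus ?thesis by (simp only: of_nat_eq_iff)
qed

lemma gauss_norm_eq_0_iff: "x \<in> gauss_int \<Longrightarrow> gauss_norm x = 0 \<longleftrightarrow> x = 0"
  using real_gauss_norm[of x] by (metis norm_eq_zero of_nat_eq_0_iff power_eq_0_iff zero_neq_numeral
      power_zero_numeral)

lemma gauss_unit_cases:
  assumes "x \<in> gauss_int" "y \<in> gauss_int" "x * y = 1"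
  shows "x \<in> {1, -1, \<i>, -\<i>}"
proof -
  have "gauss_norm x * gauss_norm y = 1"
    using gauss_norm_mult[OF assms(1,2)] assms(3) by (simp add: gauss_norm_def)
  hence n: "gauss_norm x = 1" by simp
  obtain a b where x: "x = of_int a + \<i> * of_int b" using assms(1) by (rule gauss_intE)
  have "a ^ 2 + b ^ 2 = 1" using n by (simp add: gauss_norm_def x nat_eq_iff)
  moreover have "a ^ 2 \<ge> 0" "b ^ 2 \<ge> 0" by simp_all
  ultimately have "a ^ 2 = 0 \<and> b ^ 2 = 1 \<or> a ^ 2 = 1 \<and> b ^ 2 = 0" by linarith
  hence "a = 0 \<and> (b = 1 \<or> b = -1) \<or> (a = 1 \<or> a = -1) \<and> b = 0"
    by (simp add: power2_eq_1_iff)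
  thus ?thesis by (auto simp: x)
qed

text \<open>Rounding both coordinates of a / b leaves an error of squared length at most 1/4 + 1/4 <
  1.\<close>

lemma gauss_division:
  assumes "a \<in> gauss_int" "b \<in> gauss_int" "b \<noteq> 0"
  obtains q where "q \<in> gauss_int" "gauss_norm (a - q * b) < gauss_norm b"
proof -
  define z where "z = a / b"
  define q where "q = Complex (of_int (round (Re z))) (of_int (round (Im z)))"
  have q: "q \<in> gauss_int" by (simp add: q_def gauss_int_def)
  have half: "(x - of_int (round x)) ^ 2 \<le> 1 / 4" for x :: real
  proof -
    have "\<bar>x - of_int (round x)\<bar> \<le> 1 / 2" using of_int_round_abs_le[of x] by (simp add: abs_minus_commute)
    hence "\<bar>x - of_int (round x)\<bar> ^ 2 \<le> (1 / 2) ^ 2" by (intro power_mono) auto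
    thus ?thesis by (simp add: power2_eq_square)
  qed
  have "cmod (z - q) ^ 2 = (Re z - of_int (round (Re z))) ^ 2 + (Im z - of_int (round (Im z))) ^ 2"
    by (simp add: cmod_power2 q_def)
  also have "\<dots> \<le> 1 / 2" using half[of "Re z"] half[of "Im z"] by linarith
  finally have zq: "cmod (z - q) ^ 2 \<le> 1 / 2" .
  have "a - q * b = (z - q) * b" using assms(3) by (simp add: z_def field_simps)
  hence "cmod (a - q * b) ^ 2 = cmod (z - q) ^ 2 * cmod b ^ 2"
    by (simp add: norm_mult power_mult_distrib)
  also have "\<dots> \<le> 1 / 2 * cmod b ^ 2" using zq by (rule mult_right_mono) simp
  also have "\<dots> < cmod b ^ 2" using assms(3) by simp
  finally have "real (gauss_norm (a - q * b)) < real (gauss_norm b)"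
    using assms q by (simp add: real_gauss_norm gauss_int_diff gauss_int_mult)
  thus ?thesis using that q by simp
qed

section \<open>Divisibility, principal ideals and square-free elements\<close>

definition gauss_dvd :: "complex \<Rightarrow> complex \<Rightarrow> bool" where
  "gauss_dvd a b \<longleftrightarrow> (\<exists>c\<in>gauss_int. b = a * c)"

lemma gauss_dvdI: "c \<in> gauss_int \<Longrightarrow> b = a * c \<Longrightarrow> gauss_dvd a b"
  unfolding gauss_dvd_def by blast

lemma gauss_dvd_refl: "gauss_dvd a a"
  by (rule gauss_dvdI[of 1]) auto

lemma gauss_dvd_add: "gauss_dvd a b \<Longrightarrow> gauss_dvd a c \<Longrightarrow> gauss_dvd a (b + c)"
  unfolding gauss_dvd_def by (metis distrib_left gauss_int_add)

lemma gauss_dvd_mult: "gauss_dvd a b \<Longrightarrow> c \<in> gauss_int \<Longrightarrow> gauss_dvd a (b * c)"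
  unfolding gauss_dvd_def by (metis mult.assoc gauss_int_mult)

lemma gauss_dvd_mult2: "gauss_dvd a b \<Longrightarrow> c \<in> gauss_int \<Longrightarrow> gauss_dvd a (c * b)"
  using gauss_dvd_mult[of a b c] by (simp add: mult.commute)

lemma gauss_dvd_diff: "gauss_dvd a b \<Longrightarrow> gauss_dvd a c \<Longrightarrow> gauss_dvd a (b - c)"
  unfolding gauss_dvd_def by (metis right_diff_distrib gauss_int_diff)

lemma gauss_dvd_trans: "gauss_dvd a b \<Longrightarrow> gauss_dvd b c \<Longrightarrow> gauss_dvd a c"
  unfolding gauss_dvd_def by (metis mult.assoc gauss_int_mult)

text \<open>An element of least nonzero norm generates. The set is a bare subset closed under the
  ideal operations, because it will be the set of Gaussian integers divisible by a square root
  \<open>W\<close> in \<open>square_gen_norm\<close>.\<close>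

lemma gauss_int_principal:
  assumes "I \<subseteq> gauss_int" "0 \<in> I" "\<And>x y. x \<in> I \<Longrightarrow> y \<in> I \<Longrightarrow> x + y \<in> I"
    "\<And>x c. x \<in> I \<Longrightarrow> c \<in> gauss_int \<Longrightarrow> c * x \<in> I"
  obtains n where "n \<in> I" "\<And>x. x \<in> I \<Longrightarrow> gauss_dvd n x"
proof (cases "I = {0}")
  case True
  thus ?thesis using that[of 0] gauss_dvd_refl by auto
next
  case False
  hence ex: "\<exists>x. x \<in> I \<and> x \<noteq> 0" using assms(2) by blast
  define n where "n = arg_min gauss_norm (\<lambda>x. x \<in> I \<and> x \<noteq> 0)"
  have n: "n \<in> I" "n \<noteq> 0" and min: "\<And>x. x \<in> I \<Longrightarrow> x \<noteq> 0 \<Longrightarrow> gauss_norm n \<le> gauss_norm x"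
    using arg_min_nat_lemma[of "\<lambda>x. x \<in> I \<and> x \<noteq> 0" _ gauss_norm] ex unfolding n_def by blast+
  have "gauss_dvd n x" if x: "x \<in> I" for x
  proof -
    obtain q where q: "q \<in> gauss_int" "gauss_norm (x - q * n) < gauss_norm n"
      using gauss_division[of x n] x n assms(1) by blast
    have "x - q * n = x + (- q) * n" by simp
    hence "x - q * n \<in> I" using assms(3)[OF x assms(4)[OF n(1), of "- q"]] q by (simp add: gauss_int_minus)
    hence "x - q * n = 0" using min q(2) by fastforce
    thus ?thesis using q by (intro gauss_dvdI[of q]) auto
  qed
  thus ?thesis using that n by blast
qed

lemma gauss_bezout:
  assumes "a \<in> gauss_int" "b \<in> gauss_int"
  obtains g x y where "g \<in> gauss_int" "x \<in> gauss_int" "y \<in> gauss_int"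
    "g = a * x + b * y" "gauss_dvd g a" "gauss_dvd g b"
proof -
  define I where "I = {a * x + b * y | x y. x \<in> gauss_int \<and> y \<in> gauss_int}"
  have IE: "\<And>z. z \<in> I \<longleftrightarrow> (\<exists>x y. x \<in> gauss_int \<and> y \<in> gauss_int \<and> z = a * x + b * y)"
    unfolding I_def by blast
  obtain n where n: "n \<in> I" "\<And>x. x \<in> I \<Longrightarrow> gauss_dvd n x"
  proof (rule gauss_int_principal[of I])
    show "I \<subseteq> gauss_int" using assms by (auto simp: IE intro!: gauss_int_add gauss_int_mult)
    show "0 \<in> I" unfolding IE by (intro exI[of _ 0]) simp
  next
    fix u v assume "u \<in> I" "v \<in> I"
    then obtain x y x' y' where "x \<in> gauss_int" "y \<in> gauss_int" "u = a * x + b * y"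
      "x' \<in> gauss_int" "y' \<in> gauss_int" "v = a * x' + b * y'" unfolding IE by blast
    thus "u + v \<in> I" unfolding IE
      by (intro exI[of _ "x + x'"] exI[of _ "y + y'"]) (auto simp: algebra_simps gauss_int_add)
  next
    fix u c assume "u \<in> I" and c: "c \<in> gauss_int"
    then obtain x y where "x \<in> gauss_int" "y \<in> gauss_int" "u = a * x + b * y" unfolding IE by blast
    thus "c * u \<in> I" unfolding IE using c
      by (intro exI[of _ "c * x"] exI[of _ "c * y"]) (auto simp: algebra_simps gauss_int_mult)
  qed blast
  have "a \<in> I" unfolding IE by (intro exI[of _ 1] exI[of _ 0]) simp
  moreover have "b \<in> I" unfolding IE by (intro exI[of _ 0] exI[of _ 1]) simp
  moreover obtain x y where "x \<in> gauss_int" "y \<in> gauss_int" "n = a * x + b * y" using n(1) unfolding IE by blast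
  moreover have "n \<in> gauss_int" using calculation assms by (simp add: gauss_int_add gauss_int_mult)
  ultimately show ?thesis using that n(2) by blast
qed

text \<open>Square-freeness phrased without factorizations: the ideal of \<open>r\<close> is
  radical. In this form it turns divisibility of a square by \<open>r\<close> into divisibility of
  its root.\<close>

definition gauss_radical :: "complex \<Rightarrow> bool" where
  "gauss_radical r \<longleftrightarrow> r \<in> gauss_int \<and> r \<noteq> 0 \<and> (\<forall>x\<in>gauss_int. gauss_dvd r (x * x) \<longrightarrow> gauss_dvd r x)"

lemma gauss_rat_denom:
  assumes "z \<in> gauss_rat"
  obtains n :: nat where "n > 0" "of_nat n * z \<in> gauss_int"
proof -
  obtain a b where ab: "Re z = of_int a / of_int b" "b > 0" using assms unfolding gauss_rat_def by (auto elim: Rats_cases')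
  obtain c d where cd: "Im z = of_int c / of_int d" "d > 0" using assms unfolding gauss_rat_def by (auto elim: Rats_cases')
  have "of_nat (nat (b * d)) * z = Complex (of_int (a * d)) (of_int (c * b))"
    using ab cd by (simp add: complex_eq_iff)
  thus ?thesis using ab cd that[of "nat (b * d)"] by (simp add: gauss_int_def)
qed

text \<open>Take a Gaussian integer \<open>s\<close> of least norm in the square class. If
  \<open>s\<close> divides x^2 and g is the gcd of s and x, then a = s / g divides g, so s = a^2 k
  with \<open>k\<close> in the same class; minimality makes \<open>a\<close> a unit, and s divides
  x.\<close>

lemma gauss_radical_kernel:
  assumes "r \<in> gauss_rat" "r \<noteq> 0"
  obtains r0 c where "gauss_radical r0" "c \<in> gauss_rat" "c \<noteq> 0" "r = r0 * (c * c)"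
proof -
  define P where "P = (\<lambda>s. s \<in> gauss_int \<and> s \<noteq> 0 \<and> (\<exists>c\<in>gauss_rat. c \<noteq> 0 \<and> r = s * (c * c)))"
  obtain n :: nat where n: "n > 0" "of_nat n * r \<in> gauss_int" using gauss_rat_denom[OF assms(1)] .
  have "P (of_nat n * (of_nat n * r))"
    unfolding P_def
  proof (intro conjI)
    show "of_nat n * (of_nat n * r) \<in> gauss_int" by (rule gauss_int_mult[OF gauss_int_of_nat n(2)])
    show "of_nat n * (of_nat n * r) \<noteq> 0" using n(1) assms(2) by simp
    have "1 / of_nat n \<in> gauss_rat" using n(1)
      by (intro subfield_divide subfield_1 subfield_of_nat gauss_rat_subfield)
    moreover have "1 / complex_of_nat n \<noteq> 0" using n(1) by simp
    moreover have "r = of_nat n * (of_nat n * r) * (1 / of_nat n * (1 / of_nat n))" using n(1) by simp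
    ultimately show "\<exists>c\<in>gauss_rat. c \<noteq> 0 \<and> r = of_nat n * (of_nat n * r) * (c * c)" by metis
  qed
  hence ex: "\<exists>s. P s" by blast
  define s where "s = arg_min gauss_norm P"
  have s: "P s" and min: "\<And>x. P x \<Longrightarrow> gauss_norm s \<le> gauss_norm x"
    using arg_min_nat_lemma[of P _ gauss_norm] ex unfolding s_def by blast+
  obtain c where c: "c \<in> gauss_rat" "c \<noteq> 0" "r = s * (c * c)" using s unfolding P_def by blast
  have sI: "s \<in> gauss_int" "s \<noteq> 0" using s unfolding P_def by auto
  have "gauss_dvd s x" if x: "x \<in> gauss_int" and dv: "gauss_dvd s (x * x)" for x
  proof -
    obtain g u v where g: "g \<in> gauss_int" "u \<in> gauss_int" "v \<in> gauss_int" "g = s * u + x * v"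
      "gauss_dvd g s" "gauss_dvd g x" using gauss_bezout[OF sI(1) x] .
    obtain a where a: "a \<in> gauss_int" "s = g * a" using g(5) unfolding gauss_dvd_def by blast
    obtain b where b: "b \<in> gauss_int" "x = g * b" using g(6) unfolding gauss_dvd_def by blast
    obtain t where t: "t \<in> gauss_int" "x * x = s * t" using dv unfolding gauss_dvd_def by blast
    have g0: "g \<noteq> 0" and a0: "a \<noteq> 0" using sI a by auto
    have "g * 1 = g * (a * u + b * v)" using g(4) a b by (simp add: algebra_simps)
    hence one: "a * u + b * v = 1" using g0 by simp
    have "g * (g * (b * b)) = g * (a * t)" using t a b by (simp add: algebra_simps)
    hence gbb: "g * (b * b) = a * t" using g0 by simp
    \<comment> \<open>\<open>a\<close> is coprime to \<open>b\<close> and divides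
      \<open>g * (b * b)\<close>, so it divides g; expanding the square of 1 = a u + b v exhibits
      the quotient.\<close>
    have "g = g * (a * u + b * v) * (a * u + b * v)" using one by simp
    also have "\<dots> = a * (g * u * (a * u + b * v) + g * b * v * u) + g * (b * b) * (v * v)"
      by (simp add: algebra_simps)
    also have "\<dots> = a * (g * u * (a * u + b * v) + g * b * v * u + t * (v * v))"
      unfolding gbb by (simp add: algebra_simps)
    finally have ga: "g = a * (g * u * (a * u + b * v) + g * b * v * u + t * (v * v))" .
    define k where "k = g * u * (a * u + b * v) + g * b * v * u + t * (v * v)"
    have k: "k \<in> gauss_int" "g = a * k"
      using g(1-3) a(1) b(1) t(1) ga unfolding k_def by (auto intro!: gauss_int_add gauss_int_mult)
    have "P k"
      unfolding P_def
    proof (intro conjI)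
      have "r = k * (a * c * (a * c))" unfolding c(3) a(2) k(2) by (simp only: mult_ac)
      moreover have "a * c \<in> gauss_rat" by (rule subfield_mult[OF gauss_rat_subfield gauss_int_rat[OF a(1)] c(1)])
      moreover have "a * c \<noteq> 0" using a0 c(2) by simp
      ultimately show "\<exists>c\<in>gauss_rat. c \<noteq> 0 \<and> r = k * (c * c)" by metis
      show "k \<in> gauss_int" by (rule k(1))
      show "k \<noteq> 0" using g0 k(2) by auto
    qed
    hence "gauss_norm s \<le> gauss_norm k" by (rule min)
    moreover have "gauss_norm s = gauss_norm a * gauss_norm a * gauss_norm k"
      using a k g by (simp add: gauss_norm_mult gauss_int_mult)
    moreover have "gauss_norm k > 0" using k g0 gauss_norm_eq_0_iff[of k] by auto
    ultimately have "gauss_norm a * gauss_norm a \<le> 1" by simp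
    moreover have "gauss_norm a > 0" using a0 a gauss_norm_eq_0_iff[of a] by auto
    ultimately have "gauss_norm a = 1" by (metis Suc_leI le_antisym le_trans mult_le_mono1 nat_mult_1 One_nat_def)
    hence "a * cnj a = 1" using of_nat_gauss_norm[OF a(1)] by simp
    hence "x = g * ((a * cnj a) * b)" using b(2) by simp
    hence "x = s * (cnj a * b)" unfolding a(2) by (simp only: mult.assoc)
    thus ?thesis using a b by (intro gauss_dvdI[of "cnj a * b"]) (auto intro: gauss_int_intros)
  qed
  thus ?thesis using that[of s c] c sI unfolding gauss_radical_def by blast
qed

text \<open>A Gaussian prime whose residue field is a prime field.\<close>
definition gauss_prime :: "complex \<Rightarrow> nat \<Rightarrow> bool" where
  "gauss_prime \<rho> l \<longleftrightarrow> \<rho> \<in> gauss_int \<and> prime l \<and> \<rho> * cnj \<rho> = of_nat l"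

section \<open>Gaussian primes of prime norm and residues modulo them\<close>

lemma gauss_prime_norm: "gauss_prime \<rho> l \<Longrightarrow> gauss_norm \<rho> = l"
  using of_nat_gauss_norm[of \<rho>] unfolding gauss_prime_def by (metis of_nat_eq_iff)

lemma gauss_prime_nonzero: "gauss_prime \<rho> l \<Longrightarrow> \<rho> \<noteq> 0"
  unfolding gauss_prime_def by auto

lemma gauss_prime_cnj: "gauss_prime \<rho> l \<Longrightarrow> gauss_prime (cnj \<rho>) l"
  unfolding gauss_prime_def by (auto simp: gauss_int_cnj mult.commute)

text \<open>The norm of the gcd of \<rho> and \<open>x\<close> divides the prime \<open>l\<close>,
  so the gcd is a unit or an associate of \<rho>.\<close>

lemma gauss_prime_dvd_cases:
  assumes "gauss_prime \<rho> l" "x \<in> gauss_int"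
  shows "gauss_dvd \<rho> x \<or> (\<exists>m\<in>gauss_int. gauss_dvd \<rho> (x * m - 1))"
proof -
  have \<rho>: "\<rho> \<in> gauss_int" "prime l" using assms unfolding gauss_prime_def by auto
  obtain g u v where g: "g \<in> gauss_int" "u \<in> gauss_int" "v \<in> gauss_int" "g = \<rho> * u + x * v"
    "gauss_dvd g \<rho>" "gauss_dvd g x" using gauss_bezout[OF \<rho>(1) assms(2)] .
  obtain a where a: "a \<in> gauss_int" "\<rho> = g * a" using g(5) unfolding gauss_dvd_def by blast
  have "gauss_norm g * gauss_norm a = l"
    using gauss_prime_norm[OF assms(1)] gauss_norm_mult[OF g(1) a(1)] by (simp only: a(2))
  moreover from this have "gauss_norm g = 1 \<or> gauss_norm g = l"
    using \<rho>(2) unfolding prime_nat_iff by (metis dvd_triv_left)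
  moreover have "l > 0" using \<rho>(2) by (rule prime_gt_0_nat)
  ultimately have "gauss_norm g = 1 \<or> gauss_norm a = 1" by auto
  thus ?thesis
  proof
    assume "gauss_norm g = 1"
    hence "g * cnj g = 1" using of_nat_gauss_norm[OF g(1)] by simp
    hence one: "(\<rho> * u + x * v) * cnj g = 1" by (simp only: g(4))
    have "x * (v * cnj g) - 1 = \<rho> * (- u * cnj g)"
      unfolding one[symmetric] by (simp add: algebra_simps)
    hence "gauss_dvd \<rho> (x * (v * cnj g) - 1)"
      by (rule gauss_dvdI[rotated]) (intro gauss_int_mult gauss_int_minus gauss_int_cnj g)
    thus ?thesis using gauss_int_mult[OF g(3) gauss_int_cnj[OF g(1)]] by blast
  next
    assume "gauss_norm a = 1"
    hence "a * cnj a = 1" using of_nat_gauss_norm[OF a(1)] by simp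
    hence "g = \<rho> * cnj a" unfolding a(2) by (simp add: mult.assoc)
    hence "gauss_dvd \<rho> g" using a by (intro gauss_dvdI[of "cnj a"] gauss_int_cnj)
    thus ?thesis using g(6) gauss_dvd_trans by blast
  qed
qed

lemma gauss_prime_dvd_mult:
  assumes "gauss_prime \<rho> l" "x \<in> gauss_int" "y \<in> gauss_int" "gauss_dvd \<rho> (x * y)"
  shows "gauss_dvd \<rho> x \<or> gauss_dvd \<rho> y"
proof (rule disjCI)
  assume "\<not> gauss_dvd \<rho> y"
  then obtain m where m: "m \<in> gauss_int" "gauss_dvd \<rho> (y * m - 1)"
    using gauss_prime_dvd_cases[OF assms(1,3)] by blast
  have "gauss_dvd \<rho> (x * y * m - (y * m - 1) * x)"
    by (rule gauss_dvd_diff[OF gauss_dvd_mult[OF assms(4) m(1)] gauss_dvd_mult[OF m(2) assms(2)]])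
  thus "gauss_dvd \<rho> x" by (simp add: algebra_simps)
qed

lemma gauss_prime_dvd_of_int:
  assumes "gauss_prime \<rho> l" "gauss_dvd \<rho> (of_int t)" shows "int l dvd t"
proof -
  have \<rho>: "\<rho> \<in> gauss_int" "prime l" "\<rho> * cnj \<rho> = of_nat l" using assms unfolding gauss_prime_def by auto
  obtain c where c: "c \<in> gauss_int" "of_int t = \<rho> * c" using assms(2) unfolding gauss_dvd_def by blast
  have "complex_of_int (t * t) = (\<rho> * c) * cnj (\<rho> * c)" by (simp flip: c(2))
  also have "\<dots> = (\<rho> * cnj \<rho>) * (c * cnj c)" by (simp add: mult_ac)
  also have "\<dots> = of_int (int l * int (gauss_norm c))" using \<rho>(3) of_nat_gauss_norm[OF c(1)] by simp
  finally have "t * t = int l * int (gauss_norm c)" by (simp only: of_int_eq_iff)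
  hence "int l dvd t * t" by simp
  thus ?thesis using \<rho>(2) by (simp add: prime_dvd_mult_iff)
qed

text \<open>The residue field is the prime field: a + b \<i> = 0 modulo \<rho> gives \<i> = - a / b.
  The prime l does not divide b, as otherwise it would divide a, and l^2 would divide l.\<close>

lemma gauss_prime_residue_ii:
  assumes "gauss_prime \<rho> l"
  obtains j :: int where "gauss_dvd \<rho> (\<i> - of_int j)"
proof -
  have \<rho>: "\<rho> \<in> gauss_int" "prime l" "\<rho> * cnj \<rho> = of_nat l" using assms unfolding gauss_prime_def by auto
  obtain a b where ab: "\<rho> = of_int a + \<i> * of_int b" using \<rho>(1) by (rule gauss_intE)
  have "complex_of_int (a * a + b * b) = \<rho> * cnj \<rho>" by (simp add: ab algebra_simps)
  hence "complex_of_int (a * a + b * b) = of_int (int l)" using \<rho>(3) by simp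
  hence l: "a * a + b * b = int l" by (simp only: of_int_eq_iff)
  have "\<not> int l dvd b"
  proof
    assume b: "int l dvd b"
    hence "int l dvd a * a" using l by (metis dvd_add_left_iff dvd_mult dvd_refl)
    hence "int l dvd a" using \<rho>(2) by (simp add: prime_dvd_mult_iff)
    hence "int l * int l dvd a * a" "int l * int l dvd b * b" using b by (simp_all only: mult_dvd_mono)
    hence "int l * int l dvd int l" using l by (metis dvd_add)
    hence "l * l dvd l" by (metis of_nat_dvd_iff of_nat_mult)
    thus False using \<rho>(2) prime_gt_1_nat by (metis dvd_mult_cancel1 less_irrefl nat_dvd_1_iff_1 prime_gt_0_nat)
  qed
  hence "coprime b (int l)" using \<rho>(2) by (metis coprime_commute prime_imp_coprime_int prime_nat_int_transfer)
  moreover obtain s m where "s * b + m * int l = gcd b (int l)" using bezout_int[of b "int l"] by blast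
  ultimately have sm: "b * s + int l * m = 1" by (simp add: coprime_iff_gcd_eq_1 mult.commute)
  have one: "complex_of_int b * of_int s = 1 - of_nat l * of_int m"
  proof -
    have "complex_of_int (b * s + int l * m) = 1" by (simp only: sm of_int_1)
    thus ?thesis by (simp add: algebra_simps)
  qed
  have "\<i> - of_int (- (a * s)) = of_int a * of_int s + \<i> * (of_int b * of_int s + of_nat l * of_int m)"
    unfolding one by simp
  also have "\<dots> = \<rho> * (of_int s + \<i> * cnj \<rho> * of_int m)"
    unfolding \<rho>(3)[symmetric] by (simp add: ab algebra_simps)
  finally have eq: "\<i> - of_int (- (a * s)) = \<rho> * (of_int s + \<i> * cnj \<rho> * of_int m)" .
  have "of_int s + \<i> * cnj \<rho> * of_int m \<in> gauss_int" by (intro gauss_int_intros \<rho>(1))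
  thus ?thesis using that[OF gauss_dvdI[OF _ eq]] by simp
qed

lemma gauss_prime_residue:
  assumes "gauss_dvd \<rho> (\<i> - of_int j)" "z \<in> gauss_int"
  obtains t :: int where "gauss_dvd \<rho> (z - of_int t)"
proof -
  obtain a b where z: "z = of_int a + \<i> * of_int b" using assms(2) by (rule gauss_intE)
  have "gauss_dvd \<rho> ((\<i> - of_int j) * of_int b)" by (intro gauss_dvd_mult assms) simp
  moreover have "(\<i> - of_int j) * of_int b = z - of_int (a + j * b)" by (simp add: z algebra_simps)
  ultimately show ?thesis using that by metis
qed

lemma gauss_dvd_prime_times:
  assumes "gauss_prime \<rho> l" "r \<in> gauss_int" "m \<in> gauss_int" "gauss_dvd r (\<rho> * m)"
  shows "(\<exists>r'\<in>gauss_int. r = \<rho> * r' \<and> gauss_dvd r' m) \<or> gauss_dvd r m"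
proof -
  have \<rho>0: "\<rho> \<noteq> 0" using assms(1) by (rule gauss_prime_nonzero)
  obtain c where c: "c \<in> gauss_int" "\<rho> * m = r * c" using assms(4) unfolding gauss_dvd_def by blast
  have "gauss_dvd \<rho> (r * c)" using assms(3) by (intro gauss_dvdI[of m]) (simp_all add: c(2))
  hence "gauss_dvd \<rho> r \<or> gauss_dvd \<rho> c" using gauss_prime_dvd_mult[OF assms(1,2) c(1)] by simp
  thus ?thesis
  proof
    assume "gauss_dvd \<rho> r"
    then obtain r' where r': "r' \<in> gauss_int" "r = \<rho> * r'" unfolding gauss_dvd_def by blast
    hence "m = r' * c" using c \<rho>0 by (simp add: mult.assoc)
    thus ?thesis using r' c(1) gauss_dvdI[of c m r'] by blast
  next
    assume "gauss_dvd \<rho> c"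
    then obtain c' where c': "c' \<in> gauss_int" "c = \<rho> * c'" unfolding gauss_dvd_def by blast
    hence "m = r * c'" using c \<rho>0 by (simp add: mult.left_commute)
    thus ?thesis using c' gauss_dvdI[of c' m r] by blast
  qed
qed

text \<open>Modulo \<rho> the right side vanishes, so M is the square of X / n when \<rho> does not
  divide n. Otherwise \<rho> divides n, hence X, hence Y because it does not divide
  \<open>D'\<close>; cancelling \<rho>^2 leaves an equation of the same shape with n of smaller
  norm.\<close>

lemma norm_form_residue:
  assumes \<rho>: "gauss_prime \<rho> l" and D': "D' \<in> gauss_int" "\<not> gauss_dvd \<rho> D'" and M: "M \<in> gauss_int"
    and "X \<in> gauss_int" "Y \<in> gauss_int" "n \<in> gauss_int" "n \<noteq> 0"
    and "X * X - M * (n * n) = \<rho> * D' * (Y * Y)"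
  shows "\<exists>z\<in>gauss_int. gauss_dvd \<rho> (z * z - M)"
  using assms(5-9)
proof (induction "gauss_norm n" arbitrary: X Y n rule: less_induct)
  case less
  have \<rho>0: "\<rho> \<noteq> 0" and \<rho>I: "\<rho> \<in> gauss_int" and l: "prime l"
    using \<rho> gauss_prime_nonzero by (auto simp: gauss_prime_def)
  note sq = gauss_prime_dvd_mult[OF \<rho>]
  have dv: "gauss_dvd \<rho> (X * X - M * (n * n))"
  proof (rule gauss_dvdI)
    show "D' * (Y * Y) \<in> gauss_int" by (intro gauss_int_mult D' less.prems)
    show "X * X - M * (n * n) = \<rho> * (D' * (Y * Y))" using less.prems(5) by (simp only: mult.assoc)
  qed
  show ?case
  proof (cases "gauss_dvd \<rho> n")
    case False
    then obtain m where m: "m \<in> gauss_int" "gauss_dvd \<rho> (n * m - 1)"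
      using gauss_prime_dvd_cases[OF \<rho> less.prems(3)] by blast
    have "gauss_dvd \<rho> ((X * X - M * (n * n)) * (m * m) + (n * m - 1) * (M * (n * m + 1)))"
      using m(1) M less.prems(1-3)
      by (intro gauss_dvd_add[OF gauss_dvd_mult[OF dv] gauss_dvd_mult[OF m(2)]] gauss_int_intros)
    also have "(X * X - M * (n * n)) * (m * m) + (n * m - 1) * (M * (n * m + 1))
        = (X * m) * (X * m) - M" by (simp add: algebra_simps)
    finally show ?thesis using m less.prems by (intro bexI[of _ "X * m"]) (auto simp: gauss_int_mult)
  next
    case True
    then obtain n' where n': "n' \<in> gauss_int" "n = \<rho> * n'" unfolding gauss_dvd_def by blast
    have "gauss_dvd \<rho> (M * (n * n))"
      by (rule gauss_dvd_mult2[OF gauss_dvd_mult[OF True less.prems(3)] M])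
    hence "gauss_dvd \<rho> (X * X)" using gauss_dvd_add[OF dv, of "M * (n * n)"] by simp
    hence "gauss_dvd \<rho> X" using sq[of X X] less.prems(1) by simp
    then obtain X' where X': "X' \<in> gauss_int" "X = \<rho> * X'" unfolding gauss_dvd_def by blast
    have "\<rho> * (\<rho> * (X' * X' - M * (n' * n'))) = \<rho> * (D' * (Y * Y))"
      using less.prems(5) unfolding X' n' by (simp add: algebra_simps)
    hence "\<rho> * (X' * X' - M * (n' * n')) = D' * (Y * Y)" using \<rho>0 by simp
    hence "gauss_dvd \<rho> (D' * (Y * Y))"
      using X' n' M by (intro gauss_dvdI[of "X' * X' - M * (n' * n')"]) (auto intro!: gauss_int_intros)
    hence "gauss_dvd \<rho> (Y * Y)" using sq[of D' "Y * Y"] D' less.prems(2) by (simp add: gauss_int_mult)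
    hence "gauss_dvd \<rho> Y" using sq[of Y Y] less.prems(2) by simp
    then obtain Y' where Y': "Y' \<in> gauss_int" "Y = \<rho> * Y'" unfolding gauss_dvd_def by blast
    have "\<rho> * (X' * X' - M * (n' * n')) = \<rho> * (\<rho> * D' * (Y' * Y'))"
      using \<open>\<rho> * (X' * X' - M * (n' * n')) = D' * (Y * Y)\<close> unfolding Y' by (simp add: algebra_simps)
    hence eq: "X' * X' - M * (n' * n') = \<rho> * D' * (Y' * Y')" using \<rho>0 by simp
    have n0: "n' \<noteq> 0" using n' less.prems by auto
    have "gauss_norm n = l * gauss_norm n'"
      using n' \<rho>I gauss_prime_norm[OF \<rho>] by (simp add: gauss_norm_mult)
    moreover have "gauss_norm n' > 0" using n0 n' gauss_norm_eq_0_iff[of n'] by auto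
    ultimately have "gauss_norm n' < gauss_norm n" using prime_gt_1_nat[OF l] by simp
    thus ?thesis by (rule less.hyps[OF _ X'(1) Y'(1) n'(1) n0 eq])
  qed
qed

lemma norm_form_residue_rat:
  assumes \<rho>: "gauss_prime \<rho> l" and D': "D' \<in> gauss_int" "\<not> gauss_dvd \<rho> D'" and M: "M \<in> gauss_int"
    and XY: "X \<in> gauss_rat" "Y \<in> gauss_rat" "n \<in> gauss_rat" "n \<noteq> 0"
    and eq: "X * X - M * (n * n) = \<rho> * D' * (Y * Y)"
  shows "\<exists>z\<in>gauss_int. gauss_dvd \<rho> (z * z - M)"
proof -
  obtain a :: nat where a: "a > 0" "of_nat a * X \<in> gauss_int" using gauss_rat_denom[OF XY(1)] .
  obtain b :: nat where b: "b > 0" "of_nat b * Y \<in> gauss_int" using gauss_rat_denom[OF XY(2)] .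
  obtain c :: nat where c: "c > 0" "of_nat c * n \<in> gauss_int" using gauss_rat_denom[OF XY(3)] .
  define N :: complex where "N = of_nat a * of_nat b * of_nat c"
  have "N * X = of_nat (b * c) * (of_nat a * X)" by (simp add: N_def)
  hence 1: "N * X \<in> gauss_int" using a(2) by (metis gauss_int_mult gauss_int_of_nat)
  have "N * Y = of_nat (a * c) * (of_nat b * Y)" by (simp add: N_def)
  hence 2: "N * Y \<in> gauss_int" using b(2) by (metis gauss_int_mult gauss_int_of_nat)
  have "N * n = of_nat (a * b) * (of_nat c * n)" by (simp add: N_def)
  hence 3: "N * n \<in> gauss_int" using c(2) by (metis gauss_int_mult gauss_int_of_nat)
  have 4: "N * n \<noteq> 0" using a b c XY by (simp add: N_def)
  have "(N * X) * (N * X) - M * ((N * n) * (N * n)) = N * N * (X * X - M * (n * n))"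
    by (simp add: algebra_simps)
  also have "\<dots> = \<rho> * D' * ((N * Y) * (N * Y))" unfolding eq by (simp add: mult_ac)
  finally show ?thesis by (rule norm_form_residue[OF \<rho> D' M 1 2 3 4])
qed

section \<open>The negative Pell equation\<close>

lemma nonsquare_norm_nonzero:
  fixes D :: nat and x y :: int
  assumes "\<And>m. D \<noteq> m * m" "x * x = int D * (y * y)"
  shows "y = 0"
proof (rule ccontr)
  assume y: "y \<noteq> 0"
  have "complex_of_int (x * x) = of_int (int D * (y * y))" using assms(2) by (simp only:)
  hence "of_nat D = (of_int x / of_int y) * (of_int x / complex_of_int y)"
    using y by (simp add: field_simps)
  moreover have "of_int x / complex_of_int y \<in> gauss_rat"
    by (intro subfield_divide subfield_of_int gauss_rat_subfield)
  ultimately show False using nat_square_gauss_rat assms(1) by blast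
qed

text \<open>If the set were finite, its approximation errors would have a positive minimum
  \<open>d\<close>, and Dirichlet's theorem with a bound N > 1 / d gives a better pair.\<close>

lemma small_norms_infinite:
  fixes D :: nat
  assumes nsq: "\<And>m. D \<noteq> m * m"
  defines "S \<equiv> {(x :: int, y :: int). 0 < y \<and> \<bar>of_int x - of_int y * sqrt D\<bar> * of_int y < 1}"
  shows "infinite S"
proof
  assume fin: "finite S"
  define s where "s = sqrt (real D)"
  have pos: "\<bar>of_int x - of_int y * s\<bar> > 0" if "(x, y) \<in> S" for x y
  proof (rule ccontr)
    assume "\<not> ?thesis"
    hence "of_int x = of_int y * s" by simp
    hence "(of_int x * of_int x :: real) = of_int y * of_int y * (s * s)" by simp
    hence "of_int (x * x) = (of_int (int D * (y * y)) :: real)" by (simp add: s_def)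
    hence "x * x = int D * (y * y)" by (simp only: of_int_eq_iff)
    hence "y = 0" using nonsquare_norm_nonzero[OF nsq] by simp
    thus False using that by (simp add: S_def)
  qed
  define f where "f = (\<lambda>(x :: int, y :: int). \<bar>of_int x - of_int y * s\<bar>)"
  \<comment> \<open>Inserting 1 keeps the minimum defined when \<open>S\<close> is empty.\<close>
  define d where "d = Min (insert 1 (f ` S))"
  have d0: "d > 0" unfolding d_def using fin pos by (subst Min_gr_iff) (auto simp: f_def)
  obtain N :: nat where N: "N > 0" "1 / real N < d"
    using d0 reals_Archimedean2[of "1 / d"]
    by (metis divide_less_eq gr0I mult.commute of_nat_0_less_iff of_nat_0 order_less_trans zero_less_divide_1_iff not_less_zero of_nat_less_0_iff)
  obtain x y where xy: "0 < y" "y \<le> int N" "\<bar>of_int y * s - of_int x\<bar> < 1 / real N"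
    using Dirichlet_approx[OF N(1), of s] by metis
  have ab: "\<bar>of_int x - of_int y * s\<bar> < 1 / real N" using xy(3) by (simp add: abs_minus_commute)
  have "\<bar>of_int x - of_int y * s\<bar> * of_int y < 1 / real N * of_int y"
    using ab xy(1) by (intro mult_strict_right_mono) auto
  also have "\<dots> \<le> 1 / real N * real N" using xy(2) N(1) by (intro mult_left_mono) (auto simp: of_int_le_iff[of y "int N", where ?'a = real, symmetric] simp del: of_int_le_iff)
  also have "\<dots> = 1" using N by simp
  finally have "(x, y) \<in> S" using xy by (simp add: S_def s_def)
  hence "d \<le> f (x, y)" unfolding d_def using fin by (intro Min_le) auto
  thus False using ab N by (simp add: f_def)
qed

text \<open>Infinitely many pairs have norm of size at most \<open>C\<close>, so two of them agree
  in their norm \<open>N\<close> and modulo \<open>N\<close>; their quotient is integral of norm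
  1.\<close>

lemma pell_solution:
  fixes D :: nat
  assumes nsq: "\<And>m. D \<noteq> m * m"
  shows "\<exists>x y :: int. y \<noteq> 0 \<and> x * x = int D * (y * y) + 1"
proof -
  define S where "S = {(x :: int, y :: int). 0 < y \<and> \<bar>of_int x - of_int y * sqrt D\<bar> * of_int y < 1}"
  have inf: "infinite S" unfolding S_def by (rule small_norms_infinite[OF nsq])
  define n where "n = (\<lambda>(x :: int, y :: int). x * x - int D * (y * y))"
  \<comment> \<open>The norm equals t (t + 2 y sqrt D), where both the size of t and that of t y are
    below 1.\<close>
  define C where "C = \<lceil>2 * sqrt (real D) + 1\<rceil>"
  have nC: "\<bar>n (x, y)\<bar> \<le> C" if "(x, y) \<in> S" for x y
  proof -
    define t where "t = of_int x - of_int y * sqrt D"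
    have y: "y \<ge> 1" and t: "\<bar>t\<bar> * of_int y < 1" using that by (auto simp: S_def t_def)
    have "\<bar>t\<bar> * 1 \<le> \<bar>t\<bar> * of_int y" using y by (intro mult_left_mono) auto
    hence t1: "\<bar>t\<bar> < 1" using t by simp
    have "of_int (n (x, y)) = t * (t + 2 * (of_int y * sqrt D))"
      by (simp add: n_def t_def algebra_simps)
    hence "of_int (n (x, y)) = t * t + 2 * sqrt D * (t * of_int y)" by (simp add: algebra_simps)
    hence "\<bar>of_int (n (x, y))\<bar> \<le> \<bar>t * t\<bar> + \<bar>2 * sqrt D * (t * of_int y)\<bar>"
      using abs_triangle_ineq by metis
    also have "\<bar>t * t\<bar> \<le> 1 * 1" unfolding abs_mult using t1 by (intro mult_mono) auto
    also have "\<bar>2 * sqrt D * (t * of_int y)\<bar> = 2 * sqrt D * (\<bar>t\<bar> * of_int y)"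
      using y by (simp add: abs_mult)
    also have "\<dots> \<le> 2 * sqrt D * 1" using t by (intro mult_left_mono) auto
    finally have "of_int \<bar>n (x, y)\<bar> \<le> 2 * sqrt D + 1" by simp
    thus ?thesis unfolding C_def by linarith
  qed
  have n0: "n (x, y) \<noteq> 0" if "(x, y) \<in> S" for x y
    using nonsquare_norm_nonzero[OF nsq, of x y] that by (auto simp: n_def S_def)
  define f where "f = (\<lambda>(x, y). (n (x, y), x mod n (x, y), y mod n (x, y)))"
  have "f ` S \<subseteq> {-C..C} \<times> {-C..C} \<times> {-C..C}"
  proof
    fix u assume "u \<in> f ` S"
    then obtain x y where xy: "(x, y) \<in> S" "u = f (x, y)" by auto
    have "\<bar>z mod n (x, y)\<bar> \<le> C" for z
      using nC[OF xy(1)] n0[OF xy(1)] abs_mod_less[of "n (x, y)" z] by linarith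
    hence "- C \<le> z mod n (x, y) \<and> z mod n (x, y) \<le> C" for z by (simp add: abs_le_iff minus_le_iff)
    moreover have "- C \<le> n (x, y) \<and> n (x, y) \<le> C" using nC[OF xy(1)] by linarith
    ultimately show "u \<in> {-C..C} \<times> {-C..C} \<times> {-C..C}" by (simp add: xy(2) f_def)
  qed
  hence "finite (f ` S)" by (rule finite_subset) auto
  then obtain a where a: "a \<in> S" "infinite {b \<in> S. f b = f a}"
    using pigeonhole_infinite[OF inf] by blast
  hence "infinite ({b \<in> S. f b = f a} - {a})" by simp
  then obtain b where b: "b \<in> S" "f b = f a" "b \<noteq> a" by (metis (mono_tags, lifting) DiffE finite.emptyI infinite_imp_nonempty ex_in_conv mem_Collect_eq singletonI)
  obtain x y x' y' where eqs: "a = (x, y)" "b = (x', y')" by (metis surj_pair)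
  define N where "N = n (x, y)"
  have N: "N \<noteq> 0" "x * x - int D * (y * y) = N" "x' * x' - int D * (y' * y') = N"
    "x mod N = x' mod N" "y mod N = y' mod N"
    using a b n0 unfolding eqs f_def N_def by (auto simp: n_def)
  have ypos: "y > 0" "y' > 0" using a b eqs by (auto simp: S_def)
  have "N dvd x' - x" "N dvd y' - y" using N(4)[symmetric] N(5)[symmetric] by (simp_all only: mod_eq_dvd_iff)
  then obtain i j where "x' - x = N * i" "y' - y = N * j" by (elim dvdE)
  hence ij: "x' = x + N * i" "y' = y + N * j" by linarith+
  \<comment> \<open>X + Y sqrt D is the quotient of x' + y' sqrt D by x + y sqrt D; the congruences
    modulo \<open>N\<close> make it integral.\<close>
  define X where "X = 1 + x * i - int D * (y * j)"
  define Y where "Y = x * j - y * i"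
  have X: "N * X = x * x' - int D * (y * y')"
    unfolding X_def ij unfolding N(2)[symmetric] by (simp add: algebra_simps)
  have Y: "N * Y = x * y' - y * x'" unfolding Y_def ij by (simp add: algebra_simps)
  have "N * N * (X * X - int D * (Y * Y)) = (N * X) * (N * X) - int D * ((N * Y) * (N * Y))"
    by (simp add: algebra_simps)
  also have "\<dots> = (x * x - int D * (y * y)) * (x' * x' - int D * (y' * y'))"
    unfolding X Y by (simp add: algebra_simps)
  also have "\<dots> = N * N * 1" using N by simp
  finally have "X * X - int D * (Y * Y) = 1" using N(1) by simp
  \<comment> \<open>Y = 0 would make the two pairs proportional, and equal norms with positive
    second coordinates would make them equal.\<close>
  moreover have "Y \<noteq> 0"
  proof
    assume "Y = 0"
    hence xy: "x * y' = y * x'" using Y by simp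
    have "N * (y' * y') = (x * y') * (x * y') - int D * (y * y) * (y' * y')"
      unfolding N(2)[symmetric] by (simp add: algebra_simps)
    also have "\<dots> = N * (y * y)" unfolding xy N(3)[symmetric] by (simp add: algebra_simps)
    finally have "y' * y' = y * y" using N(1) by simp
    hence "y' = y" using ypos by (simp add: square_eq_iff)
    hence "x' = x" using xy ypos by simp
    thus False using b eqs \<open>y' = y\<close> by simp
  qed
  ultimately show ?thesis by (intro exI[of _ X] exI[of _ Y]) auto
qed

lemma square_mod_4: "(t * t :: nat) mod 4 = (if even t then 0 else 1)"
proof (cases "even t")
  case True
  then obtain k where "t = 2 * k" by (elim evenE)
  thus ?thesis by simp
next
  case False
  then obtain k where "t = 2 * k + 1" by (elim oddE)
  hence "t * t = 4 * (k * k + k) + 1" by (simp add: algebra_simps)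
  moreover have "(4 * (k * k + k) + 1) mod 4 = 1" by presburger
  ultimately show ?thesis using False by simp
qed

lemma nat_coprime_square:
  fixes a b :: nat
  assumes "coprime a b" "a * b = c * c" "a > 0" "b > 0"
  obtains x y where "a = x * x" "b = y * y"
proof -
  have "is_nth_power 2 (a * b)" using assms(2) by (auto simp: is_nth_power_def power2_eq_square)
  hence "is_nth_power 2 a" "is_nth_power 2 b"
    using is_nth_power_mult_coprime_natD[OF assms(1) _ assms(3,4)] by blast+
  thus ?thesis using that by (auto elim!: is_nth_powerE simp: power2_eq_square)
qed

text \<open>Descent from the least solution of \<open>t\<^sup>2 = D u\<^sup>2 + 1\<close>: factor \<open>t\<^sup>2 - 1\<close>.\<close>
lemma negative_pell:
  fixes D :: nat
  assumes nsq: "\<And>m. D \<noteq> m * m" and D4: "D mod 4 = 1 \<or> D mod 4 = 2"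
    and excl: "\<And>a b z w :: nat. a * b = D \<Longrightarrow> b * (w * w) = a * (z * z) + 1 \<Longrightarrow> a = 1 \<or> b = 1"
  obtains x y :: nat where "x * x + 1 = D * (y * y)"
proof -
  have D0: "D > 0" using nsq[of 0] by simp
  obtain X Y :: int where XY: "Y \<noteq> 0" "X * X = int D * (Y * Y) + 1" using pell_solution[OF nsq] by blast
  define P where "P = (\<lambda>u :: nat. u > 0 \<and> (\<exists>t. t * t = D * (u * u) + 1))"
  have "int (nat \<bar>X\<bar> * nat \<bar>X\<bar>) = int (D * (nat \<bar>Y\<bar> * nat \<bar>Y\<bar>) + 1)"
    using XY(2) by simp
  hence "P (nat \<bar>Y\<bar>)" using XY(1) unfolding P_def by (metis of_nat_eq_iff zero_less_abs_iff zero_less_nat_eq)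
  define u where "u = (LEAST u. P u)"
  have u: "P u" and least: "\<And>v. P v \<Longrightarrow> u \<le> v"
    unfolding u_def using \<open>P (nat \<bar>Y\<bar>)\<close> by (auto intro: LeastI Least_le)
  obtain t where t: "t * t = D * (u * u) + 1" and u0: "u > 0" using u unfolding P_def by blast
  have modu: "(D * (u * u) + 1) mod 4 = ((D mod 4) * ((u * u) mod 4) + 1) mod 4"
    by (metis mod_add_left_eq mod_mult_eq)
  \<comment> \<open>For odd u the square t^2 would be D + 1, that is 2 or 3, modulo 4.\<close>
  have par: "even u \<and> odd t"
  proof (cases "even u")
    case True
    hence "(u * u) mod 4 = 0" using square_mod_4[of u] by (simp only: if_True)
    hence "(t * t) mod 4 = 1" unfolding t modu by simp
    thus ?thesis using square_mod_4[of t] True by (cases "even t") (simp_all only: if_True if_False, simp_all)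
  next
    case False
    hence "(u * u) mod 4 = 1" using square_mod_4[of u] by (simp only: if_False)
    hence "(t * t) mod 4 = (D mod 4 + 1) mod 4" unfolding t modu by (simp only: mult_1_right)
    hence "(t * t) mod 4 = 2 \<or> (t * t) mod 4 = 3" using D4 by (elim disjE) (simp_all only:, simp_all)
    thus ?thesis using square_mod_4[of t] by (cases "even t") (simp_all only: if_True if_False, simp_all)
  qed
  obtain v where v: "u = 2 * v" using par by (elim conjE evenE)
  obtain A where A: "t = 2 * A + 1" using par by (elim conjE oddE)
  note vA = v A
  \<comment> \<open>With t = 2 A + 1 and u = 2 v the equation becomes A (A + 1) = D v^2. The factors
    on the left are coprime, so D splits along them as \<open>a * b\<close>.\<close>
  have "4 * (A * (A + 1)) = 4 * (D * (v * v))" using t unfolding vA by (simp add: algebra_simps)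
  hence AA: "A * (A + 1) = D * (v * v)" by simp
  have v0: "v > 0" using u0 vA by simp
  have A0: "A > 0" using AA D0 v0 by (metis mult_eq_0_iff not_gr_zero)
  have cop: "coprime A (A + 1)" by (simp add: coprime_Suc_right_nat)
  define a b where "a = gcd A D" and "b = gcd (A + 1) D"
  have ab: "a * b = D"
  proof -
    have "D dvd A * (A + 1)" unfolding AA by simp
    hence "D dvd (A + 1) * A" by (simp only: mult.commute)
    hence "D dvd gcd ((A + 1) * A) ((A + 1) * D)" by (rule gcd_greatest) (rule dvd_triv_right)
    hence "D dvd (A + 1) * a" unfolding a_def by (simp only: gcd_mult_distrib_nat)
    hence "D dvd a * (A + 1)" by (simp only: mult.commute)
    hence "D dvd gcd (a * (A + 1)) (a * D)" by (rule gcd_greatest) (rule dvd_triv_right)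
    hence "D dvd a * b" unfolding b_def by (simp only: gcd_mult_distrib_nat)
    moreover have "coprime a b"
      using cop unfolding a_def b_def by (meson coprime_divisors gcd_dvd1)
    hence "a * b dvd D" unfolding a_def b_def by (intro divides_mult gcd_dvd2)
    ultimately show ?thesis by (intro dvd_antisym)
  qed
  have "a dvd A" "b dvd A + 1" by (simp_all only: a_def b_def gcd_dvd1)
  then obtain A' B' where A': "A = a * A'" and B': "A + 1 = b * B'" by (elim dvdE)
  have "D * (A' * B') = (a * A') * (b * B')" by (simp add: ab[symmetric] mult_ac)
  also have "\<dots> = D * (v * v)" using AA by (simp only: A'[symmetric] B'[symmetric])
  finally have "A' * B' = v * v" using D0 by simp
  moreover have "A' dvd A" by (subst A') (rule dvd_triv_right)
  moreover have "B' dvd A + 1" by (subst B') (rule dvd_triv_right)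
  moreover have "coprime A' B'" by (rule coprime_divisors[OF calculation(2,3) cop])
  moreover have "A' \<noteq> 0" using A' A0 by (intro notI) simp
  moreover have "B' \<noteq> 0" using B' by (intro notI) simp
  ultimately obtain z w where zw: "A' = z * z" "B' = w * w" using nat_coprime_square[of A' B' v] by blast
  have main: "b * (w * w) = a * (z * z) + 1" using A' B' zw by simp
  \<comment> \<open>\<open>a = 1\<close> is the negative Pell equation; \<open>b = 1\<close> is
    again a solution of the positive one, with z \<le> v < u against the choice of u.\<close>
  have "a = 1 \<or> b = 1" by (rule excl[OF ab main])
  thus ?thesis
  proof
    assume "a = 1"
    thus ?thesis using that[of z w] main ab by simp
  next
    assume b1: "b = 1"
    have z0: "z > 0" using \<open>A' \<noteq> 0\<close> zw by simp
    have "P z" unfolding P_def using z0 main ab b1 by auto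
    hence uz: "u \<le> z" by (rule least)
    have "z * z * (w * w) = v * v" using \<open>A' * B' = v * v\<close> zw by simp
    moreover have "1 \<le> w * w" using \<open>B' \<noteq> 0\<close> zw by simp
    hence "z * z * 1 \<le> z * z * (w * w)" by (rule mult_le_mono2)
    ultimately have "z * z \<le> v * v" by simp
    hence "z ^ 2 \<le> v ^ 2" by (simp only: power2_eq_square)
    hence zv: "z \<le> v" by (rule power2_le_imp_le) simp
    show ?thesis using uz zv vA v0 by simp
  qed
qed

lemma nat_odd_exponent_nonsquare:
  fixes p n :: nat
  assumes "prime p" "\<not> p dvd n" shows "p * n \<noteq> m * m"
proof
  assume eq: "p * n = m * m"
  hence "p dvd m * m" by (metis dvd_triv_left)
  hence "p dvd m" using assms(1) by (simp add: prime_dvd_mult_iff)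
  then obtain k where "m = p * k" by (elim dvdE)
  hence "n = p * (k * k)" using eq assms(1) by (auto simp: prime_gt_0_nat)
  thus False using assms(2) by simp
qed

section \<open>Ideals with principal square\<close>

definition subring_set :: "complex set \<Rightarrow> bool" where
  "subring_set R \<longleftrightarrow> 0 \<in> R \<and> 1 \<in> R \<and> (\<forall>x\<in>R. \<forall>y\<in>R. x + y \<in> R \<and> x * y \<in> R)"

definition module_set :: "complex set \<Rightarrow> complex set \<Rightarrow> bool" where
  "module_set R A \<longleftrightarrow> 0 \<in> A \<and> (\<forall>x\<in>A. \<forall>y\<in>A. x + y \<in> A) \<and> (\<forall>r\<in>R. \<forall>x\<in>A. r * x \<in> A)"

lemma ring_of_integers_subring: "is_subfield F \<Longrightarrow> subring_set (ring_of_integers F)"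
  unfolding subring_set_def ring_of_integers_def
  by (auto intro: subfield_intros alg_int_add alg_int_mult)

lemma ring_of_integersI: "x \<in> F \<Longrightarrow> alg_int x \<Longrightarrow> x \<in> ring_of_integers F"
  and ring_of_integersD: "x \<in> ring_of_integers F \<Longrightarrow> x \<in> F" "x \<in> ring_of_integers F \<Longrightarrow> alg_int x"
  unfolding ring_of_integers_def by auto

lemma ideal_iff_module: "is_ideal R I \<longleftrightarrow> I \<subseteq> R \<and> module_set R I"
  unfolding is_ideal_def module_set_def by auto

lemma module_scale:
  assumes "module_set R A" shows "module_set R ((\<lambda>x. c * x) ` A)"
  unfolding module_set_def
proof (intro conjI ballI)
  show "0 \<in> (\<lambda>x. c * x) ` A" using assms unfolding module_set_def by (intro image_eqI[of _ _ 0]) auto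
next
  fix x y assume "x \<in> (\<lambda>x. c * x) ` A" "y \<in> (\<lambda>x. c * x) ` A"
  then obtain a b where "a \<in> A" "b \<in> A" "x = c * a" "y = c * b" by auto
  thus "x + y \<in> (\<lambda>x. c * x) ` A" using assms unfolding module_set_def
    by (intro image_eqI[of _ _ "a + b"]) (auto simp: distrib_left)
next
  fix r x assume "r \<in> R" "x \<in> (\<lambda>x. c * x) ` A"
  then obtain a where "a \<in> A" "x = c * a" by auto
  thus "r * x \<in> (\<lambda>x. c * x) ` A" using assms \<open>r \<in> R\<close> unfolding module_set_def
    by (intro image_eqI[of _ _ "r * a"]) auto
qed

lemma scale_memI: "z = c * t \<Longrightarrow> t \<in> A \<Longrightarrow> z \<in> (\<lambda>x. c * x) ` A"
  by blast

lemma module_smult: "module_set R A \<Longrightarrow> r \<in> R \<Longrightarrow> x \<in> A \<Longrightarrow> r * x \<in> A"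
  unfolding module_set_def by blast

lemma module_mono: "R \<subseteq> R' \<Longrightarrow> module_set R' A \<Longrightarrow> module_set R A"
  unfolding module_set_def by blast

lemma principal_ideal_eq_image: "principal_ideal R a = (\<lambda>x. a * x) ` R"
  unfolding principal_ideal_def by auto

lemma subring_module: "subring_set R \<Longrightarrow> module_set R R"
  unfolding subring_set_def module_set_def by auto

lemma principal_ideal_is_ideal:
  assumes "subring_set R" "a \<in> R" shows "is_ideal R (principal_ideal R a)"
  unfolding ideal_iff_module principal_ideal_eq_image
  using module_scale[OF subring_module[OF assms(1)], of a] assms unfolding subring_set_def by auto

lemma gen_ideal_least: "is_ideal R I \<Longrightarrow> S \<subseteq> I \<Longrightarrow> gen_ideal R S \<subseteq> I"
  unfolding gen_ideal_def by blast

lemma gen_ideal_superset: "S \<subseteq> gen_ideal R S"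
  unfolding gen_ideal_def by blast

lemma gen_ideal_is_ideal:
  assumes "subring_set R" "S \<subseteq> R" shows "is_ideal R (gen_ideal R S)"
proof -
  have R: "is_ideal R R" using subring_module[OF assms(1)] by (simp add: ideal_iff_module)
  hence "gen_ideal R S \<subseteq> R" using assms(2) by (rule gen_ideal_least)
  thus ?thesis unfolding is_ideal_def by (auto simp: gen_ideal_def is_ideal_def)
qed

lemma ideal_mult_is_ideal:
  assumes "subring_set R" "is_ideal R I" "is_ideal R J"
  shows "is_ideal R (ideal_mult R I J)"
  unfolding ideal_mult_def
proof (rule gen_ideal_is_ideal[OF assms(1)])
  show "{x * y |x y. x \<in> I \<and> y \<in> J} \<subseteq> R"
    using assms unfolding is_ideal_def subring_set_def by blast
qed

lemma ideal_mult_memI: "x \<in> I \<Longrightarrow> y \<in> J \<Longrightarrow> x * y \<in> ideal_mult R I J"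
  unfolding ideal_mult_def by (rule subsetD[OF gen_ideal_superset]) blast

text \<open>The induction principle for ideal products that replaces explicit finite sums.\<close>
lemma ideal_mult_induct:
  assumes R: "subring_set R" and I: "is_ideal R I" and J: "is_ideal R J" and A: "module_set R A"
    and *: "\<And>x y. x \<in> I \<Longrightarrow> y \<in> J \<Longrightarrow> c * (x * y) \<in> A"
    and z: "z \<in> ideal_mult R I J"
  shows "c * z \<in> A"
proof -
  have "is_ideal R {z \<in> R. c * z \<in> A}"
    using R A unfolding is_ideal_def subring_set_def module_set_def
    by (auto simp: distrib_left mult.left_commute[of c])
  moreover have "{x * y |x y. x \<in> I \<and> y \<in> J} \<subseteq> {z \<in> R. c * z \<in> A}"
    using * I J R unfolding is_ideal_def subring_set_def by blast
  ultimately have "ideal_mult R I J \<subseteq> {z \<in> R. c * z \<in> A}"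
    unfolding ideal_mult_def by (rule gen_ideal_least)
  thus ?thesis using z by blast
qed

definition square_gen :: "complex set \<Rightarrow> complex set \<Rightarrow> complex \<Rightarrow> bool" where
  "square_gen R I a \<longleftrightarrow> is_ideal R I \<and> a \<in> R \<and> a \<noteq> 0 \<and> ideal_mult R I I = principal_ideal R a"

lemma square_genD:
  assumes "square_gen R I a"
  shows "is_ideal R I" "a \<in> R" "a \<noteq> 0"
    and "\<And>x y. x \<in> I \<Longrightarrow> y \<in> I \<Longrightarrow> \<exists>r\<in>R. x * y = a * r"
    and "subring_set R \<Longrightarrow> a \<in> ideal_mult R I I"
proof -
  show "\<And>x y. x \<in> I \<Longrightarrow> y \<in> I \<Longrightarrow> \<exists>r\<in>R. x * y = a * r"
    using assms ideal_mult_memI[of _ I _ I R] unfolding square_gen_def principal_ideal_def by auto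
  show "subring_set R \<Longrightarrow> a \<in> ideal_mult R I I"
    using assms unfolding square_gen_def principal_ideal_def subring_set_def by (auto intro!: exI[of _ 1])
qed (use assms in \<open>auto simp: square_gen_def\<close>)

lemma square_genI:
  assumes "subring_set R" "is_ideal R I" "a \<in> R" "a \<noteq> 0"
    and "\<And>x y. x \<in> I \<Longrightarrow> y \<in> I \<Longrightarrow> \<exists>r\<in>R. x * y = a * r" and "a \<in> ideal_mult R I I"
  shows "square_gen R I a"
proof -
  have "ideal_mult R I I \<subseteq> principal_ideal R a"
    unfolding ideal_mult_def
    using assms(5) by (intro gen_ideal_least principal_ideal_is_ideal assms) (auto simp: principal_ideal_def)
  moreover have "principal_ideal R a \<subseteq> ideal_mult R I I"
    using ideal_mult_is_ideal[OF assms(1,2,2)] assms(6)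
    unfolding principal_ideal_def is_ideal_def by (auto simp: mult.commute)
  ultimately show ?thesis using assms unfolding square_gen_def by auto
qed

lemma square_gen_nonzero:
  assumes "subring_set R" "square_gen R I a" shows "nonzero_ideal R I"
proof -
  have "I \<noteq> {0}"
  proof
    assume "I = {0}"
    have "1 * a \<in> {0}"
    proof (rule ideal_mult_induct[OF assms(1) square_genD(1)[OF assms(2)] square_genD(1)[OF assms(2)]])
      show "module_set R {0}" by (simp add: module_set_def)
      show "a \<in> ideal_mult R I I" by (rule square_genD(5)[OF assms(2,1)])
    qed (simp add: \<open>I = {0}\<close>)
    thus False using square_genD(3)[OF assms(2)] by simp
  qed
  thus ?thesis using square_genD(1)[OF assms(2)] by (simp add: nonzero_ideal_def)
qed

lemma square_gen_ring: "subring_set R \<Longrightarrow> square_gen R R 1"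
proof (rule square_genI)
  assume R: "subring_set R"
  show "1 \<in> ideal_mult R R R" using ideal_mult_memI[of 1 R 1 R R] R by (simp add: subring_set_def)
qed (auto simp: subring_set_def is_ideal_def)

text \<open>Everything is bilinear, so \<open>ideal_mult_induct\<close> is applied once per
  argument: claims 1 to 3 show that products of elements of I J are multiples of a b, and claim 4
  leads to a b lying in the square of I J.\<close>

lemma square_gen_mult:
  assumes R: "subring_set R" and I: "square_gen R I a" and J: "square_gen R J b"
  shows "square_gen R (ideal_mult R I J) (a * b)"
proof (rule square_genI[OF R])
  note iI = square_genD(1)[OF I] and iJ = square_genD(1)[OF J]
  let ?M = "ideal_mult R I J"
  show iM: "is_ideal R ?M" by (rule ideal_mult_is_ideal[OF R iI iJ])
  show "a * b \<in> R" "a * b \<noteq> 0"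
    using square_genD(2,3)[OF I] square_genD(2,3)[OF J] R by (auto simp: subring_set_def)
  have mod: "module_set R ((\<lambda>x. a * b * x) ` R)" by (rule module_scale[OF subring_module[OF R]])
  have 1: "x * y * (x' * y') \<in> (\<lambda>x. a * b * x) ` R"
    if h: "x \<in> I" "y \<in> J" "x' \<in> I" "y' \<in> J" for x y x' y'
  proof -
    obtain r where r: "r \<in> R" "x * x' = a * r" using square_genD(4)[OF I h(1,3)] by blast
    obtain s where s: "s \<in> R" "y * y' = b * s" using square_genD(4)[OF J h(2,4)] by blast
    have "x * y * (x' * y') = (x * x') * (y * y')" by (simp only: mult_ac)
    also have "\<dots> = a * b * (r * s)" unfolding r(2) s(2) by (simp only: mult_ac)
    finally show ?thesis by (rule scale_memI) (use R r(1) s(1) in \<open>simp add: subring_set_def\<close>)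
  qed
  have 2: "x * y * z \<in> (\<lambda>x. a * b * x) ` R" if "x \<in> I" "y \<in> J" "z \<in> ?M" for x y z
    by (rule ideal_mult_induct[OF R iI iJ mod 1[OF that(1,2)] that(3)])
  have 3: "z' * z \<in> (\<lambda>x. a * b * x) ` R" if "z' \<in> ?M" "z \<in> ?M" for z z'
    by (rule ideal_mult_induct[OF R iI iJ mod _ that(2)])
       (use 2[OF _ _ that(1)] in \<open>simp add: mult.commute[of z']\<close>)
  show "\<exists>r\<in>R. x * y = a * b * r" if "x \<in> ?M" "y \<in> ?M" for x y
    using 3[OF that] by auto
  have iMM: "module_set R (ideal_mult R ?M ?M)"
    using ideal_mult_is_ideal[OF R iM iM] by (simp add: ideal_iff_module)
  have 4: "x * x' * b \<in> ideal_mult R ?M ?M" if "x \<in> I" "x' \<in> I" for x x'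
  proof (rule ideal_mult_induct[OF R iJ iJ iMM])
    fix y y' assume "y \<in> J" "y' \<in> J"
    have "(x * y) * (x' * y') \<in> ideal_mult R ?M ?M"
      by (intro ideal_mult_memI that \<open>y \<in> J\<close> \<open>y' \<in> J\<close>)
    thus "x * x' * (y * y') \<in> ideal_mult R ?M ?M" by (simp only: mult_ac)
  qed (rule square_genD(5)[OF J R])
  have "b * a \<in> ideal_mult R ?M ?M"
    by (rule ideal_mult_induct[OF R iI iI iMM _ square_genD(5)[OF I R]])
       (use 4 in \<open>simp add: mult.commute[of b]\<close>)
  thus "a * b \<in> ideal_mult R ?M ?M" by (simp only: mult.commute)
qed

lemma square_gen_pow:
  assumes "subring_set R" "square_gen R I a"
  shows "square_gen R (ideal_pow R I n) (a ^ n)"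
  by (induction n) (simp_all add: square_gen_ring square_gen_mult assms)

section \<open>Units and square classes\<close>

definition unit_of :: "complex set \<Rightarrow> complex \<Rightarrow> bool" where
  "unit_of F u \<longleftrightarrow> u \<in> F \<and> u \<noteq> 0 \<and> alg_int u \<and> alg_int (inverse u)"

definition sq_equiv :: "complex set \<Rightarrow> complex \<Rightarrow> complex \<Rightarrow> bool" where
  "sq_equiv F a b \<longleftrightarrow> (\<exists>u c. unit_of F u \<and> c \<in> F \<and> c \<noteq> 0 \<and> a * u = b * (c * c))"

lemma unit_of_1: "is_subfield F \<Longrightarrow> unit_of F 1"
  unfolding unit_of_def by (auto intro: subfield_1)

lemma unit_of_mult: "is_subfield F \<Longrightarrow> unit_of F u \<Longrightarrow> unit_of F v \<Longrightarrow> unit_of F (u * v)"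
  unfolding unit_of_def by (auto intro: subfield_mult alg_int_mult)

lemma unit_of_inverse: "is_subfield F \<Longrightarrow> unit_of F u \<Longrightarrow> unit_of F (inverse u)"
  unfolding unit_of_def by (auto intro: subfield_inverse)

lemma sq_equivI: "unit_of F u \<Longrightarrow> c \<in> F \<Longrightarrow> c \<noteq> 0 \<Longrightarrow> a * u = b * (c * c) \<Longrightarrow> sq_equiv F a b"
  unfolding sq_equiv_def by blast

lemma sq_equiv_square: "is_subfield F \<Longrightarrow> c \<in> F \<Longrightarrow> c \<noteq> 0 \<Longrightarrow> sq_equiv F (b * (c * c)) b"
  by (rule sq_equivI[OF unit_of_1, of F c]) auto

lemma sq_equiv_unit: "is_subfield F \<Longrightarrow> unit_of F u \<Longrightarrow> sq_equiv F (b * u) b"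
  by (rule sq_equivI[OF unit_of_inverse, of F u 1]) (auto simp: unit_of_def intro: subfield_1)

lemma sq_equiv_refl: "is_subfield F \<Longrightarrow> sq_equiv F a a"
  using sq_equiv_square[of F 1 a] subfield_1[of F] by simp

lemma sq_equiv_sym:
  assumes "is_subfield F" "sq_equiv F a b" shows "sq_equiv F b a"
proof -
  obtain u c where *: "unit_of F u" "c \<in> F" "c \<noteq> 0" "a * u = b * (c * c)"
    using assms(2) unfolding sq_equiv_def by blast
  show ?thesis
  proof (rule sq_equivI)
    show "unit_of F (inverse u)" by (rule unit_of_inverse[OF assms(1) *(1)])
    show "inverse c \<in> F" "inverse c \<noteq> 0" using * subfield_inverse[OF assms(1)] by auto
    have "u \<noteq> 0" using *(1) by (simp add: unit_of_def)
    thus "b * inverse u = a * (inverse c * inverse c)" using *(3,4) by (simp add: field_simps)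
  qed
qed

lemma sq_equiv_mult:
  assumes "is_subfield F" "sq_equiv F a b" "sq_equiv F a' b'"
  shows "sq_equiv F (a * a') (b * b')"
proof -
  obtain u c where *: "unit_of F u" "c \<in> F" "c \<noteq> 0" "a * u = b * (c * c)"
    using assms(2) unfolding sq_equiv_def by blast
  obtain v d where **: "unit_of F v" "d \<in> F" "d \<noteq> 0" "a' * v = b' * (d * d)"
    using assms(3) unfolding sq_equiv_def by blast
  show ?thesis
  proof (rule sq_equivI[OF unit_of_mult[OF assms(1) *(1) **(1)]])
    have "a * a' * (u * v) = (a * u) * (a' * v)" by (simp only: mult_ac)
    also have "\<dots> = b * b' * ((c * d) * (c * d))" by (simp only: * ** mult_ac)
    finally show "a * a' * (u * v) = b * b' * ((c * d) * (c * d))" .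
  qed (use * ** subfield_mult[OF assms(1)] in auto)
qed

lemma sq_equiv_trans:
  assumes "is_subfield F" "sq_equiv F a b" "sq_equiv F b c"
  shows "sq_equiv F a c"
proof -
  obtain u x where *: "unit_of F u" "x \<in> F" "x \<noteq> 0" "a * u = b * (x * x)"
    using assms(2) unfolding sq_equiv_def by blast
  obtain v y where **: "unit_of F v" "y \<in> F" "y \<noteq> 0" "b * v = c * (y * y)"
    using assms(3) unfolding sq_equiv_def by blast
  show ?thesis
  proof (rule sq_equivI[OF unit_of_mult[OF assms(1) *(1) **(1)]])
    have "a * (u * v) = (b * v) * (x * x)" by (simp only: mult.assoc[symmetric] *(4)) (simp only: mult_ac)
    also have "\<dots> = c * ((y * x) * (y * x))" by (simp only: **(4) mult_ac)
    finally show "a * (u * v) = c * ((y * x) * (y * x))" .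
  qed (use * ** subfield_mult[OF assms(1)] in auto)
qed

lemma sq_equiv_mono: "F \<subseteq> F' \<Longrightarrow> sq_equiv F a b \<Longrightarrow> sq_equiv F' a b"
  unfolding sq_equiv_def unit_of_def by blast

section \<open>Ideal classes compared with square classes\<close>

lemma ideal_equiv_sym: "ideal_equiv R I J \<Longrightarrow> ideal_equiv R J I"
  unfolding ideal_equiv_def by metis

lemma ideal_equiv_trans:
  assumes "subring_set R" "ideal_equiv R I J" "ideal_equiv R J K"
  shows "ideal_equiv R I K"
proof -
  obtain a b where ab: "a \<in> R - {0}" "b \<in> R - {0}" "(\<lambda>x. a * x) ` I = (\<lambda>x. b * x) ` J"
    using assms(2) unfolding ideal_equiv_def by blast
  obtain c d where cd: "c \<in> R - {0}" "d \<in> R - {0}" "(\<lambda>x. c * x) ` J = (\<lambda>x. d * x) ` K"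
    using assms(3) unfolding ideal_equiv_def by blast
  have comp: "(\<lambda>x. (s * t) * x) ` A = (\<lambda>x. s * x) ` ((\<lambda>x. t * x) ` A)" for s t and A :: "complex set"
    by (simp add: image_image mult.assoc)
  have "(\<lambda>x. (c * a) * x) ` I = (\<lambda>x. (c * b) * x) ` J" by (simp only: comp ab(3))
  also have "\<dots> = (\<lambda>x. (b * d) * x) ` K" by (simp only: mult.commute[of c b]) (simp only: comp cd(3))
  finally show ?thesis unfolding ideal_equiv_def
    using ab cd assms(1) by (intro bexI[of _ "c * a"] bexI[of _ "b * d"]) (auto simp: subring_set_def)
qed

lemma ideal_equiv_refl: "subring_set R \<Longrightarrow> ideal_equiv R I I"
  unfolding ideal_equiv_def subring_set_def by (intro bexI[of _ 1]) auto

lemma ideal_class_eq_iff: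
  assumes "subring_set R" "nonzero_ideal R I" "nonzero_ideal R J"
  shows "ideal_class R I = ideal_class R J \<longleftrightarrow> ideal_equiv R I J"
proof
  assume "ideal_class R I = ideal_class R J"
  moreover have "J \<in> ideal_class R J" using assms ideal_equiv_refl by (simp add: ideal_class_def)
  ultimately have "J \<in> ideal_class R I" by simp
  thus "ideal_equiv R I J" by (simp add: ideal_class_def)
next
  assume IJ: "ideal_equiv R I J"
  have "ideal_equiv R I K \<longleftrightarrow> ideal_equiv R J K" for K
    using ideal_equiv_trans[OF assms(1) IJ] ideal_equiv_trans[OF assms(1) ideal_equiv_sym[OF IJ]] by blast
  thus "ideal_class R I = ideal_class R J" by (simp add: ideal_class_def)
qed

context
  fixes F R :: "complex set"
  assumes F: "is_subfield F" and R_def: "R = ring_of_integers F"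
begin

private lemma R: "subring_set R" unfolding R_def by (rule ring_of_integers_subring[OF F])

private lemma RI: "x \<in> F \<Longrightarrow> alg_int x \<Longrightarrow> x \<in> R"
  and RF: "x \<in> R \<Longrightarrow> x \<in> F" and RA: "x \<in> R \<Longrightarrow> alg_int x"
  unfolding R_def by (auto intro: ring_of_integersI dest: ring_of_integersD)

text \<open>With \<theta> = b c one has \<theta>^2 = u a b, so \<theta>^2 generates I^2 J^2 and
  \<theta> should generate I J. Multiplying by J and using J^2 = (b) then gives b I = \<theta>
  J.\<close>

lemma sq_equiv_imp_ideal_equiv:
  assumes I: "square_gen R I a" and J: "square_gen R J b" and ab: "sq_equiv F a b"
  shows "ideal_equiv R I J"
proof -
  obtain u c where u: "unit_of F u" "c \<in> F" "c \<noteq> 0" "a * u = b * (c * c)"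
    using ab unfolding sq_equiv_def by blast
  note iI = square_genD(1)[OF I] and iJ = square_genD(1)[OF J]
  have IR: "I \<subseteq> R" and JR: "J \<subseteq> R" using iI iJ by (auto simp: is_ideal_def)
  have uR: "u \<in> R" "inverse u \<in> R" "u \<noteq> 0"
    using u(1) subfield_inverse[OF F] by (auto simp: unit_of_def intro: RI)
  have a0: "a \<noteq> 0" "b \<noteq> 0" "a \<in> R" "b \<in> R" using square_genD(2,3)[OF I] square_genD(2,3)[OF J] by auto
  define \<theta> where "\<theta> = b * c"
  have \<theta>0: "\<theta> \<noteq> 0" using a0 u by (simp add: \<theta>_def)
  have \<theta>F: "\<theta> \<in> F" using a0 u by (auto simp: \<theta>_def intro: subfield_mult[OF F] RF)
  have \<theta>2: "\<theta> * \<theta> = u * (a * b)"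
  proof -
    have "\<theta> * \<theta> = b * (b * (c * c))" by (simp add: \<theta>_def mult_ac)
    also have "\<dots> = u * (a * b)" unfolding u(4)[symmetric] by (simp only: mult_ac)
    finally show ?thesis .
  qed
  have "alg_int (\<theta> * \<theta>)" unfolding \<theta>2 using a0 uR by (intro alg_int_mult RA)
  hence \<theta>R: "\<theta> \<in> R" by (rule RI[OF \<theta>F alg_int_sqrtD])
  \<comment> \<open>x y / \<theta> is integral because its square is
    \<open>inverse u * (r * s)\<close>.\<close>
  have xy: "\<exists>\<rho>\<in>R. x * y = \<theta> * \<rho>" if h: "x \<in> I" "y \<in> J" for x y
  proof -
    obtain r where r: "r \<in> R" "x * x = a * r" using square_genD(4)[OF I h(1,1)] by blast
    obtain s where s: "s \<in> R" "y * y = b * s" using square_genD(4)[OF J h(2,2)] by blast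
    define \<rho> where "\<rho> = x * y / \<theta>"
    have "(x * y) * (x * y) = (x * x) * (y * y)" by (simp only: mult_ac)
    also have "\<dots> = (a * b) * (r * s)" unfolding r(2) s(2) by (simp only: mult_ac)
    finally have "\<rho> * \<rho> = (a * b) * (r * s) / (\<theta> * \<theta>)" by (simp add: \<rho>_def)
    also have "\<dots> = inverse u * (r * s)" unfolding \<theta>2 using a0 uR by (simp add: field_simps)
    finally have eq: "\<rho> * \<rho> = inverse u * (r * s)" .
    have "alg_int (\<rho> * \<rho>)" unfolding eq using uR r(1) s(1) by (intro alg_int_mult RA)
    hence "alg_int \<rho>" by (rule alg_int_sqrtD)
    moreover have "\<rho> \<in> F" unfolding \<rho>_def using h IR JR \<theta>F
      by (intro subfield_divide[OF F] subfield_mult[OF F]) (auto intro: RF)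
    ultimately have "\<rho> \<in> R" by (rule RI[rotated])
    thus ?thesis using \<theta>0 by (intro bexI[of _ \<rho>]) (simp_all add: \<rho>_def)
  qed
  have mIJ: "module_set R (ideal_mult R I J)"
    using ideal_mult_is_ideal[OF R iI iJ] by (simp add: ideal_iff_module)
  have mJ: "module_set R J" and mI: "module_set R I" using iI iJ by (simp_all add: ideal_iff_module)
  let ?A = "(\<lambda>x. \<theta> * x) ` ideal_mult R I J"
  have mA: "module_set R ?A" by (rule module_scale[OF mIJ])
  \<comment> \<open>I^2 J^2 lies in \<theta> I J, since the factor x y of x x' y y' is a multiple of
    \<theta>. As a b lies in I^2 J^2 and \<theta>^2 = u a b, this puts \<theta> itself into I
    J.\<close>
  have "y * y' * a \<in> ?A" if h: "y \<in> J" "y' \<in> J" for y y'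
  proof (rule ideal_mult_induct[OF R iI iI mA])
    fix x x' assume x: "x \<in> I" "x' \<in> I"
    obtain \<rho> where \<rho>: "\<rho> \<in> R" "x * y = \<theta> * \<rho>" using xy[OF x(1) h(1)] by blast
    have "y * y' * (x * x') = (x * y) * (x' * y')" by (simp only: mult_ac)
    also have "\<dots> = \<theta> * (\<rho> * (x' * y'))" unfolding \<rho>(2) by (simp only: mult_ac)
    finally show "y * y' * (x * x') \<in> ?A"
      by (rule scale_memI[OF _ module_smult[OF mIJ \<rho>(1) ideal_mult_memI[OF x(2) h(2)]]])
  qed (rule square_genD(5)[OF I R])
  hence "a * b \<in> ?A"
    by (intro ideal_mult_induct[OF R iJ iJ mA _ square_genD(5)[OF J R]]) (simp add: mult.commute[of a])
  hence "u * (a * b) \<in> ?A" by (rule module_smult[OF mA uR(1)])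
  then obtain t where t: "t \<in> ideal_mult R I J" "u * (a * b) = \<theta> * t" by (elim imageE)
  have "\<theta> = t" using \<theta>2 \<theta>0 unfolding t(2) by simp
  hence \<theta>M: "\<theta> \<in> ideal_mult R I J" using t(1) by simp
  have "(\<lambda>x. b * x) ` I = (\<lambda>x. \<theta> * x) ` J"
  proof (intro equalityI image_subsetI)
    fix x assume x: "x \<in> I"
    have "x * b \<in> (\<lambda>x. \<theta> * x) ` J"
    proof (rule ideal_mult_induct[OF R iJ iJ module_scale[OF mJ]])
      fix y y' assume y: "y \<in> J" "y' \<in> J"
      obtain \<rho> where \<rho>: "\<rho> \<in> R" "x * y = \<theta> * \<rho>" using xy[OF x y(1)] by blast
      have "x * (y * y') = \<theta> * (\<rho> * y')" by (simp only: \<rho>(2) mult.assoc[symmetric])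
      thus "x * (y * y') \<in> (\<lambda>x. \<theta> * x) ` J" by (rule scale_memI[OF _ module_smult[OF mJ \<rho>(1) y(2)]])
    qed (rule square_genD(5)[OF J R])
    thus "b * x \<in> (\<lambda>x. \<theta> * x) ` J" by (subst mult.commute)
  next
    fix y assume y: "y \<in> J"
    have "y * \<theta> \<in> (\<lambda>x. b * x) ` I"
    proof (rule ideal_mult_induct[OF R iI iJ module_scale[OF mI] _ \<theta>M])
      fix x y' assume *: "x \<in> I" "y' \<in> J"
      obtain s where s: "s \<in> R" "y * y' = b * s" using square_genD(4)[OF J y *(2)] by blast
      have "y * (x * y') = (y * y') * x" by (simp only: mult_ac)
      also have "\<dots> = b * (s * x)" unfolding s(2) by (simp only: mult.assoc)
      finally show "y * (x * y') \<in> (\<lambda>x. b * x) ` I" by (rule scale_memI[OF _ module_smult[OF mI s(1) *(1)]])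
    qed
    thus "\<theta> * y \<in> (\<lambda>x. b * x) ` I" by (subst mult.commute)
  qed
  thus ?thesis unfolding ideal_equiv_def using a0 \<theta>0 \<theta>R by blast
qed

text \<open>Squaring s I = t J compares the generators: s^2 a and t^2 b divide each other, so their
  quotient is a unit.\<close>

lemma ideal_equiv_imp_sq_equiv:
  assumes I: "square_gen R I a" and J: "square_gen R J b" and IJ: "ideal_equiv R I J"
  shows "sq_equiv F a b"
proof -
  have key: "\<exists>r\<in>R. s * s * a = t * t * b * r"
    if st: "(\<lambda>x. s * x) ` I = (\<lambda>x. t * x) ` J" and I: "square_gen R I a" and J: "square_gen R J b"
    for s t I J a b
  proof -
    note iI = square_genD(1)[OF I]
    have "s * s * a \<in> (\<lambda>x. t * t * b * x) ` R"
    proof (rule ideal_mult_induct[OF R iI iI module_scale[OF subring_module[OF R]]])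
      fix x y assume x: "x \<in> I" and y: "y \<in> I"
      have "s * x \<in> (\<lambda>x. t * x) ` J" unfolding st[symmetric] using x by (rule imageI)
      then obtain x' where x': "x' \<in> J" "s * x = t * x'" by (elim imageE)
      have "s * y \<in> (\<lambda>x. t * x) ` J" unfolding st[symmetric] using y by (rule imageI)
      then obtain y' where y': "y' \<in> J" "s * y = t * y'" by (elim imageE)
      note * = x'(1) y'(1) x'(2) y'(2)
      obtain r where r: "r \<in> R" "x' * y' = b * r" using square_genD(4)[OF J *(1,2)] by blast
      have "s * s * (x * y) = (s * x) * (s * y)" by (simp only: mult_ac)
      also have "\<dots> = t * t * (x' * y')" unfolding *(3,4) by (simp only: mult_ac)
      also have "\<dots> = t * t * b * r" unfolding r(2) by (simp only: mult_ac)
      finally show "s * s * (x * y) \<in> (\<lambda>x. t * t * b * x) ` R" by (rule scale_memI[OF _ r(1)])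
    qed (rule square_genD(5)[OF I R])
    thus ?thesis by auto
  qed
  obtain s t where st: "s \<in> R - {0}" "t \<in> R - {0}" "(\<lambda>x. s * x) ` I = (\<lambda>x. t * x) ` J"
    using IJ unfolding ideal_equiv_def by blast
  obtain r where r: "r \<in> R" "s * s * a = t * t * b * r" using key[OF st(3) I J] by blast
  obtain r' where r': "r' \<in> R" "t * t * b = s * s * a * r'" using key[OF st(3)[symmetric] J I] by blast
  have nz: "a \<noteq> 0" "b \<noteq> 0" using square_genD(3)[OF I] square_genD(3)[OF J] by auto
  have "s * s * a * (r' * r) = (s * s * a * r') * r" by (simp only: mult.assoc)
  also have "\<dots> = t * t * b * r" by (simp only: r'(2)[symmetric])
  also have "\<dots> = s * s * a" by (rule r(2)[symmetric])
  finally have "s * s * a = 0 \<or> r' * r = 1" by (simp only: mult_cancel_left2)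
  hence rr: "r' * r = 1" using st(1) nz by auto
  hence inv: "inverse r' = r" by (rule inverse_unique)
  have r'0: "r' \<noteq> 0" using rr by auto
  show ?thesis
  proof (rule sq_equivI)
    show "unit_of F r'" unfolding unit_of_def inv using r r' r'0 by (auto intro: RF RA)
    show "t / s \<in> F" "t / s \<noteq> 0" using st by (auto intro: subfield_divide[OF F] RF)
    have "s * s * (a * r') = t * t * b" using r'(2) by (simp only: mult_ac)
    thus "a * r' = b * (t / s * (t / s))" using st by (simp add: field_simps)
  qed
qed

text \<open>If a u = \<theta>^2, then \<theta> divides every x in I because (x / \<theta>)^2 is
  integral, so the extended ideal lies in (\<theta>). Hence a, which lies in I^2, lies in \<theta>
  times the extended ideal, and cancelling \<theta> in \<theta>^2 = a u puts \<theta> into that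
  ideal.\<close>

lemma sq_equiv_1_imp_principal:
  assumes F': "is_subfield F'" "F \<subseteq> F'" and I: "square_gen R I a" and a: "sq_equiv F' a 1"
  shows "is_principal (ring_of_integers F') (gen_ideal (ring_of_integers F') I)"
proof -
  define R' where "R' = ring_of_integers F'"
  have R': "subring_set R'" unfolding R'_def by (rule ring_of_integers_subring[OF F'(1)])
  have RR': "R \<subseteq> R'" using F'(2) unfolding R_def R'_def ring_of_integers_def by blast
  note iI = square_genD(1)[OF I]
  have IR: "I \<subseteq> R" using iI by (simp add: is_ideal_def)
  obtain u \<theta> where u: "unit_of F' u" "\<theta> \<in> F'" "\<theta> \<noteq> 0" "a * u = \<theta> * \<theta>"
    using a unfolding sq_equiv_def by auto
  have uR: "u \<in> R'" "inverse u \<in> R'" "u \<noteq> 0"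
    using u(1) subfield_inverse[OF F'(1)] by (auto simp: unit_of_def R'_def intro: ring_of_integersI)
  have aR: "a \<in> R" "a \<noteq> 0" using square_genD(2,3)[OF I] by auto
  have "alg_int (\<theta> * \<theta>)" unfolding u(4)[symmetric] using u(1) by (intro alg_int_mult[OF RA[OF aR(1)]]) (simp add: unit_of_def)
  hence \<theta>R: "\<theta> \<in> R'" unfolding R'_def by (rule ring_of_integersI[OF u(2) alg_int_sqrtD])
  have x\<theta>: "\<exists>\<rho>\<in>R'. x = \<theta> * \<rho>" if x: "x \<in> I" for x
  proof -
    obtain r where r: "r \<in> R" "x * x = a * r" using square_genD(4)[OF I x x] by blast
    define \<rho> where "\<rho> = x / \<theta>"
    have "\<rho> * \<rho> = a * r / (a * u)" unfolding \<rho>_def u(4) r(2)[symmetric] by simp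
    also have "\<dots> = inverse u * r" using aR uR by (simp add: field_simps)
    finally have eq: "\<rho> * \<rho> = inverse u * r" .
    have "alg_int (\<rho> * \<rho>)" unfolding eq using u(1) by (intro alg_int_mult[OF _ RA[OF r(1)]]) (simp add: unit_of_def)
    hence "alg_int \<rho>" by (rule alg_int_sqrtD)
    moreover have "\<rho> \<in> F'" unfolding \<rho>_def using x IR F' u by (intro subfield_divide) (auto intro: RF)
    ultimately have "\<rho> \<in> R'" unfolding R'_def by (rule ring_of_integersI[rotated])
    thus ?thesis using u by (intro bexI[of _ \<rho>]) (simp_all add: \<rho>_def)
  qed
  let ?G = "gen_ideal R' I"
  have iG: "is_ideal R' ?G" by (rule gen_ideal_is_ideal[OF R']) (use IR RR' in blast)
  hence "module_set R' ?G" by (simp only: ideal_iff_module)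
  hence mG: "module_set R ?G" by (rule module_mono[OF RR'])
  have IG: "I \<subseteq> ?G" by (rule gen_ideal_superset)
  have "1 * a \<in> (\<lambda>x. \<theta> * x) ` ?G"
  proof (rule ideal_mult_induct[OF R iI iI module_scale[OF mG]])
    fix x y assume x: "x \<in> I" and "y \<in> I"
    obtain \<rho> where \<rho>: "\<rho> \<in> R'" "x = \<theta> * \<rho>" using x\<theta>[OF x] by (elim bexE)
    have "1 * (x * y) = \<theta> * (\<rho> * y)" unfolding \<rho>(2) by simp
    moreover have "\<rho> * y \<in> ?G"
      by (rule module_smult[OF \<open>module_set R' ?G\<close> \<rho>(1) subsetD[OF IG \<open>y \<in> I\<close>]])
    ultimately show "1 * (x * y) \<in> (\<lambda>x. \<theta> * x) ` ?G" by (rule scale_memI)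
  qed (rule square_genD(5)[OF I R])
  then obtain t where t: "t \<in> ?G" "1 * a = \<theta> * t" by (elim imageE)
  hence t: "t \<in> ?G" "a = \<theta> * t" by simp_all
  have "\<theta> * \<theta> = \<theta> * (u * t)" unfolding u(4)[symmetric] unfolding t(2) by (simp only: mult_ac)
  hence "\<theta> = u * t" using u(3) by simp
  hence \<theta>G: "\<theta> \<in> ?G" using module_smult[OF \<open>module_set R' ?G\<close> uR(1) t(1)] by simp
  have "?G = principal_ideal R' \<theta>"
  proof
    show "?G \<subseteq> principal_ideal R' \<theta>"
      by (rule gen_ideal_least[OF principal_ideal_is_ideal[OF R' \<theta>R]]) (use x\<theta> in \<open>auto simp: principal_ideal_def\<close>)
    show "principal_ideal R' \<theta> \<subseteq> ?G"
      using module_smult[OF \<open>module_set R' ?G\<close> _ \<theta>G] by (auto simp: principal_ideal_def mult.commute)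
  qed
  hence "\<exists>\<theta>\<in>R'. ?G = principal_ideal R' \<theta>" using \<theta>R by (rule bexI)
  thus ?thesis by (simp only: is_principal_def R'_def)
qed

end

text \<open>In a quadratic extension with an integer of trace 1, an ideal that becomes principal,
  generated by \<open>\<alpha>\<close>, has its square generated by the relative norm of \<open>\<alpha>\<close>.\<close>
lemma (in quad_ext) capitulation_square:
  assumes I: "nonzero_ideal (ring_of_integers E) I"
    and prin: "is_principal (ring_of_integers (adj E w)) (gen_ideal (ring_of_integers (adj E w)) I)"
    and \<omega>: "\<omega> \<in> ring_of_integers (adj E w)" "\<omega> + qconj E w \<omega> = 1"
  shows "\<exists>a. square_gen (ring_of_integers E) I a \<and> sq_equiv (adj E w) a 1"
proof -
  define R where "R = ring_of_integers E"
  define R' where "R' = ring_of_integers (adj E w)"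
  let ?\<sigma> = "qconj E w"
  have R: "subring_set R" unfolding R_def by (rule ring_of_integers_subring[OF sub])
  have R': "subring_set R'" unfolding R'_def by (rule ring_of_integers_subring[OF adj_subfield])
  have R'K: "\<And>x. x \<in> R' \<Longrightarrow> x \<in> adj E w" and R'A: "\<And>x. x \<in> R' \<Longrightarrow> alg_int x"
    by (auto simp: R'_def ring_of_integers_def)
  have RR': "R \<subseteq> R'" unfolding R_def R'_def ring_of_integers_def using base_subset by auto
  have RE: "\<And>x. x \<in> R \<Longrightarrow> x \<in> E" by (auto simp: R_def ring_of_integers_def)
  have \<sigma>R: "?\<sigma> x \<in> R'" if "x \<in> R'" for x
    using that qconj_in alg_int_qconj unfolding R'_def ring_of_integers_def by auto
  have mult': "\<And>x y. x \<in> R' \<Longrightarrow> y \<in> R' \<Longrightarrow> x * y \<in> R'" and add': "\<And>x y. x \<in> R' \<Longrightarrow> y \<in> R' \<Longrightarrow> x + y \<in> R'"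
    and zero': "0 \<in> R'" and one': "1 \<in> R'"
    using R' by (auto simp: subring_set_def)
  have \<sigma>m: "?\<sigma> (x * y) = ?\<sigma> x * ?\<sigma> y" and \<sigma>a: "?\<sigma> (x + y) = ?\<sigma> x + ?\<sigma> y" if "x \<in> R'" "y \<in> R'" for x y
    using that R'K by (auto simp: qconj_mult qconj_add)
  have \<sigma>\<sigma>: "?\<sigma> (?\<sigma> x) = x" if "x \<in> R'" for x using that R'K by simp
  have \<sigma>0: "?\<sigma> 0 = 0" by (rule qconj_base[OF subfield_0[OF sub]])
  have TrR: "x + ?\<sigma> x \<in> R" if "x \<in> R'" for x
    unfolding R_def using that R'K R'A \<sigma>R trace_in_base by (intro ring_of_integersI alg_int_add) auto
  have iI: "is_ideal R I" and I0: "I \<noteq> {0}" using I by (auto simp: nonzero_ideal_def R_def)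
  have IR: "I \<subseteq> R" using iI by (simp add: is_ideal_def)
  have \<sigma>I: "?\<sigma> x = x" if "x \<in> I" for x using that IR RE by auto
  let ?Q = "ideal_mult R I I"
  have iQ: "is_ideal R ?Q" by (rule ideal_mult_is_ideal[OF R iI iI])
  have Q0: "0 \<in> ?Q" and Qa: "\<And>x y. x \<in> ?Q \<Longrightarrow> y \<in> ?Q \<Longrightarrow> x + y \<in> ?Q"
    and Qm: "\<And>r x. r \<in> R \<Longrightarrow> x \<in> ?Q \<Longrightarrow> r * x \<in> ?Q"
    using iQ by (auto simp: is_ideal_def)
  obtain \<alpha> where \<alpha>: "\<alpha> \<in> R'" "gen_ideal R' I = principal_ideal R' \<alpha>"
    using prin unfolding is_principal_def R'_def by blast
  have \<alpha>G: "\<alpha> \<in> gen_ideal R' I" unfolding \<alpha>(2) principal_ideal_def using one' by (auto intro!: exI[of _ 1])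
  have I\<alpha>: "\<exists>\<rho>\<in>R'. x = \<alpha> * \<rho>" if "x \<in> I" for x
    using that gen_ideal_superset[of I R'] unfolding \<alpha>(2) principal_ideal_def by auto
  have \<alpha>0: "\<alpha> \<noteq> 0"
  proof
    assume "\<alpha> = 0"
    hence "I \<subseteq> {0}" using I\<alpha> by auto
    thus False using I0 iI by (auto simp: is_ideal_def)
  qed
  txt \<open>Linearity in each argument carries the relation \<open>x \<rho> y + \<sigma> (x \<rho> y) \<in> I\<^sup>2\<close>
    from \<open>x, y \<in> I\<close> over to \<open>x = \<alpha>, y = \<sigma> \<alpha>\<close>.\<close>
  define T where "T = {z \<in> R'. \<forall>x\<in>I. \<forall>\<rho>\<in>R'. x * (z * \<rho> + ?\<sigma> (z * \<rho>)) \<in> ?Q}"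
  have iT: "is_ideal R' T"
    unfolding is_ideal_def
  proof (intro conjI ballI)
    show "0 \<in> T" using zero' Q0 by (simp add: T_def \<sigma>0)
  next
    fix x y assume xy: "x \<in> T" "y \<in> T"
    show "x + y \<in> T"
      unfolding T_def
    proof (intro CollectI conjI ballI)
      fix v \<rho> assume *: "v \<in> I" "\<rho> \<in> R'"
      have "v * ((x + y) * \<rho> + ?\<sigma> ((x + y) * \<rho>)) = v * (x * \<rho> + ?\<sigma> (x * \<rho>)) + v * (y * \<rho> + ?\<sigma> (y * \<rho>))"
        using xy * \<sigma>a[of "x * \<rho>" "y * \<rho>"] mult' by (simp add: T_def distrib_left distrib_right)
      thus "v * ((x + y) * \<rho> + ?\<sigma> ((x + y) * \<rho>)) \<in> ?Q" using xy * Qa by (simp add: T_def)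
    qed (use xy add' in \<open>simp add: T_def\<close>)
  next
    fix r z assume rz: "r \<in> R'" "z \<in> T"
    show "r * z \<in> T"
      unfolding T_def
    proof (intro CollectI conjI ballI)
      fix v \<rho> assume *: "v \<in> I" "\<rho> \<in> R'"
      have "v * (z * (r * \<rho>) + ?\<sigma> (z * (r * \<rho>))) \<in> ?Q" using rz * mult' by (simp add: T_def)
      moreover have "z * (r * \<rho>) = r * z * \<rho>" by (simp only: mult_ac)
      ultimately show "v * (r * z * \<rho> + ?\<sigma> (r * z * \<rho>)) \<in> ?Q" by (simp only:)
    qed (use rz mult' in \<open>simp add: T_def\<close>)
  qed (auto simp: T_def)
  have IT: "I \<subseteq> T"
  proof
    fix y assume y: "y \<in> I"
    have "x * (y * \<rho> + ?\<sigma> (y * \<rho>)) \<in> ?Q" if "x \<in> I" "\<rho> \<in> R'" for x \<rho>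
    proof -
      have "?\<sigma> (y * \<rho>) = y * ?\<sigma> \<rho>" using \<sigma>m[of y \<rho>] y IR RR' that \<sigma>I by auto
      hence eq: "x * (y * \<rho> + ?\<sigma> (y * \<rho>)) = (\<rho> + ?\<sigma> \<rho>) * (x * y)" by (simp add: algebra_simps)
      show ?thesis unfolding eq by (rule Qm[OF TrR[OF that(2)] ideal_mult_memI[OF that(1) y]])
    qed
    thus "y \<in> T" using y IR RR' by (auto simp: T_def)
  qed
  have "\<alpha> \<in> T" by (rule subsetD[OF gen_ideal_least[OF iT IT] \<alpha>G])
  hence \<alpha>T: "\<And>x \<rho>. x \<in> I \<Longrightarrow> \<rho> \<in> R' \<Longrightarrow> x * (\<alpha> * \<rho> + ?\<sigma> (\<alpha> * \<rho>)) \<in> ?Q" by (simp add: T_def)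
  \<comment> \<open>\<open>z\<close> enters conjugated, so that the norm of \<alpha> appears at z =
    \<alpha>; scaling z by r is absorbed by replacing \<rho> with \<rho> times the conjugate of
    r.\<close>
  define S where "S = {z \<in> R'. \<forall>\<rho>\<in>R'. \<alpha> * \<rho> * ?\<sigma> z + ?\<sigma> (\<alpha> * \<rho> * ?\<sigma> z) \<in> ?Q}"
  have iS: "is_ideal R' S"
    unfolding is_ideal_def
  proof (intro conjI ballI)
    show "0 \<in> S" using zero' Q0 by (simp add: S_def \<sigma>0)
  next
    fix x y assume xy: "x \<in> S" "y \<in> S"
    show "x + y \<in> S"
      unfolding S_def
    proof (intro CollectI conjI ballI)
      fix \<rho> assume *: "\<rho> \<in> R'"
      have "\<alpha> * \<rho> * ?\<sigma> (x + y) + ?\<sigma> (\<alpha> * \<rho> * ?\<sigma> (x + y))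
          = (\<alpha> * \<rho> * ?\<sigma> x + ?\<sigma> (\<alpha> * \<rho> * ?\<sigma> x)) + (\<alpha> * \<rho> * ?\<sigma> y + ?\<sigma> (\<alpha> * \<rho> * ?\<sigma> y))"
        using xy * \<sigma>a[of x y] \<sigma>a[of "\<alpha> * \<rho> * ?\<sigma> x" "\<alpha> * \<rho> * ?\<sigma> y"] mult' \<alpha>(1) \<sigma>R
        by (simp add: S_def distrib_left)
      thus "\<alpha> * \<rho> * ?\<sigma> (x + y) + ?\<sigma> (\<alpha> * \<rho> * ?\<sigma> (x + y)) \<in> ?Q"
        using xy * Qa by (simp add: S_def)
    qed (use xy add' in \<open>simp add: S_def\<close>)
  next
    fix r z assume rz: "r \<in> R'" "z \<in> S"
    show "r * z \<in> S"
      unfolding S_def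
    proof (intro CollectI conjI ballI)
      fix \<rho> assume *: "\<rho> \<in> R'"
      have "\<alpha> * (\<rho> * ?\<sigma> r) * ?\<sigma> z + ?\<sigma> (\<alpha> * (\<rho> * ?\<sigma> r) * ?\<sigma> z) \<in> ?Q"
        using rz * mult' \<sigma>R by (simp add: S_def)
      moreover have "\<alpha> * (\<rho> * ?\<sigma> r) * ?\<sigma> z = \<alpha> * \<rho> * ?\<sigma> (r * z)"
        using rz \<sigma>m[of r z] by (simp add: S_def mult_ac)
      ultimately show "\<alpha> * \<rho> * ?\<sigma> (r * z) + ?\<sigma> (\<alpha> * \<rho> * ?\<sigma> (r * z)) \<in> ?Q" by (simp only:)
    qed (use rz mult' in \<open>simp add: S_def\<close>)
  qed (auto simp: S_def)
  have IS: "I \<subseteq> S"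
  proof
    fix y assume y: "y \<in> I"
    have "\<alpha> * \<rho> * ?\<sigma> y + ?\<sigma> (\<alpha> * \<rho> * ?\<sigma> y) \<in> ?Q" if "\<rho> \<in> R'" for \<rho>
    proof -
      have "?\<sigma> (\<alpha> * \<rho> * y) = ?\<sigma> (\<alpha> * \<rho>) * y"
        using \<sigma>m[of "\<alpha> * \<rho>" y] y IR RR' that \<sigma>I mult' \<alpha>(1) by auto
      hence eq: "\<alpha> * \<rho> * ?\<sigma> y + ?\<sigma> (\<alpha> * \<rho> * ?\<sigma> y) = y * (\<alpha> * \<rho> + ?\<sigma> (\<alpha> * \<rho>))"
        using \<sigma>I[OF y] by (simp add: algebra_simps)
      show ?thesis unfolding eq by (rule \<alpha>T[OF y that])
    qed
    thus "y \<in> S" using y IR RR' by (auto simp: S_def)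
  qed
  have "\<alpha> \<in> S" by (rule subsetD[OF gen_ideal_least[OF iS IS] \<alpha>G])
  \<comment> \<open>At \<rho> = \<omega> the expression is the norm of \<alpha> times the trace of
    \<omega>, which is 1; another trace would yield only a multiple of the norm.\<close>
  hence "\<alpha> * \<omega> * ?\<sigma> \<alpha> + ?\<sigma> (\<alpha> * \<omega> * ?\<sigma> \<alpha>) \<in> ?Q" using \<omega>(1) by (simp add: S_def R'_def)
  moreover have "?\<sigma> (\<alpha> * \<omega> * ?\<sigma> \<alpha>) = ?\<sigma> \<alpha> * ?\<sigma> \<omega> * \<alpha>"
    using \<sigma>m mult' \<sigma>R \<sigma>\<sigma> \<alpha>(1) \<omega>(1) by (simp add: R'_def)
  moreover have "\<alpha> * \<omega> * ?\<sigma> \<alpha> + ?\<sigma> \<alpha> * ?\<sigma> \<omega> * \<alpha> = (\<alpha> * ?\<sigma> \<alpha>) * (\<omega> + ?\<sigma> \<omega>)"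
    by (simp add: algebra_simps)
  ultimately have aQ: "\<alpha> * ?\<sigma> \<alpha> \<in> ?Q" by (simp add: \<omega>(2))
  define a where "a = \<alpha> * ?\<sigma> \<alpha>"
  have \<sigma>\<alpha>0: "?\<sigma> \<alpha> \<noteq> 0" using \<alpha>0 \<alpha>(1) R'K by simp
  have a0: "a \<noteq> 0" using \<alpha>0 \<sigma>\<alpha>0 by (simp add: a_def)
  have aE: "a \<in> E" unfolding a_def by (rule norm_in_base[OF R'K[OF \<alpha>(1)]])
  have "alg_int a" unfolding a_def by (rule alg_int_mult[OF R'A[OF \<alpha>(1)] R'A[OF \<sigma>R[OF \<alpha>(1)]]])
  hence aR: "a \<in> R" unfolding R_def by (rule ring_of_integersI[OF aE])
  have sg: "square_gen R I a"
  proof (rule square_genI[OF R iI aR a0])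
    show "a \<in> ?Q" using aQ by (simp add: a_def)
    fix x y assume x: "x \<in> I" and y: "y \<in> I"
    obtain \<rho> where \<rho>: "\<rho> \<in> R'" "x = \<alpha> * \<rho>" using I\<alpha>[OF x] by blast
    obtain \<rho>' where \<rho>': "\<rho>' \<in> R'" "y = \<alpha> * \<rho>'" using I\<alpha>[OF y] by blast
    \<comment> \<open>Since y lies in \<open>E\<close>, its expression may be conjugated; multiplied
      by x = \<alpha> \<rho> it then shows the relative norm \<open>a\<close>.\<close>
    have y': "y = ?\<sigma> \<alpha> * ?\<sigma> \<rho>'"
      unfolding \<sigma>m[OF \<alpha>(1) \<rho>'(1), symmetric] \<rho>'(2)[symmetric] by (rule \<sigma>I[OF y, symmetric])
    have xy: "x * y = a * (\<rho> * ?\<sigma> \<rho>')" unfolding a_def y' unfolding \<rho>(2) by (simp only: mult_ac)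
    hence "\<rho> * ?\<sigma> \<rho>' = x * y / a" using a0 by simp
    moreover have "x * y / a \<in> E" using x y IR aE by (intro subfield_divide[OF sub] subfield_mult[OF sub]) (auto intro: RE)
    ultimately have "\<rho> * ?\<sigma> \<rho>' \<in> E" by simp
    moreover have "alg_int (\<rho> * ?\<sigma> \<rho>')" by (rule alg_int_mult[OF R'A[OF \<rho>(1)] R'A[OF \<sigma>R[OF \<rho>'(1)]]])
    ultimately have "\<rho> * ?\<sigma> \<rho>' \<in> R" unfolding R_def by (rule ring_of_integersI)
    with xy show "\<exists>r\<in>R. x * y = a * r" by (rule bexI)
  qed
  \<comment> \<open>The elements whose conjugate lies in (\<alpha>) form an ideal containing I,
    hence \<alpha>. So \<alpha> divides its conjugate, and the quotient \<eta> is a unit.\<close>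
  have iU: "is_ideal R' {z \<in> R'. ?\<sigma> z \<in> principal_ideal R' \<alpha>}"
    using principal_ideal_is_ideal[OF R' \<alpha>(1)] add' mult' zero' \<sigma>a \<sigma>m \<sigma>R \<sigma>0 unfolding is_ideal_def by auto
  have IU: "I \<subseteq> {z \<in> R'. ?\<sigma> z \<in> principal_ideal R' \<alpha>}"
  proof
    fix x assume x: "x \<in> I"
    obtain \<rho> where \<rho>: "\<rho> \<in> R'" "x = \<alpha> * \<rho>" using I\<alpha>[OF x] by (elim bexE)
    have "x \<in> principal_ideal R' \<alpha>" unfolding principal_ideal_def using \<rho> by blast
    moreover have "x \<in> R'" using x IR RR' by blast
    ultimately show "x \<in> {z \<in> R'. ?\<sigma> z \<in> principal_ideal R' \<alpha>}" using \<sigma>I[OF x] by simp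
  qed
  have "?\<sigma> \<alpha> \<in> principal_ideal R' \<alpha>" using subsetD[OF gen_ideal_least[OF iU IU] \<alpha>G] by simp
  then obtain \<eta> where \<eta>: "\<eta> \<in> R'" "?\<sigma> \<alpha> = \<alpha> * \<eta>" unfolding principal_ideal_def by blast
  have "\<alpha> = ?\<sigma> (?\<sigma> \<alpha>)" by (rule \<sigma>\<sigma>[OF \<alpha>(1), symmetric])
  also have "\<dots> = ?\<sigma> (\<alpha> * \<eta>)" unfolding \<eta>(2)[symmetric] ..
  also have "\<dots> = \<alpha> * (\<eta> * ?\<sigma> \<eta>)" unfolding \<sigma>m[OF \<alpha>(1) \<eta>(1)] unfolding \<eta>(2) by (simp only: mult.assoc)
  finally have "\<alpha> = 0 \<or> \<eta> * ?\<sigma> \<eta> = 1" by (simp only: mult_cancel_left1)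
  hence one: "\<eta> * ?\<sigma> \<eta> = 1" using \<alpha>0 by simp
  have "sq_equiv (adj E w) a 1"
  proof (rule sq_equivI)
    have "?\<sigma> \<eta> * \<eta> = 1" using one by (subst mult.commute)
    hence inv: "inverse (?\<sigma> \<eta>) = \<eta>" by (rule inverse_unique)
    have "?\<sigma> \<eta> \<noteq> 0" using one by auto
    thus "unit_of (adj E w) (?\<sigma> \<eta>)" unfolding unit_of_def inv
      using R'K[OF \<sigma>R[OF \<eta>(1)]] R'A[OF \<sigma>R[OF \<eta>(1)]] R'A[OF \<eta>(1)] by simp
    show "\<alpha> \<in> adj E w" by (rule R'K[OF \<alpha>(1)])
    show "\<alpha> \<noteq> 0" by (rule \<alpha>0)
    have "a * ?\<sigma> \<eta> = \<alpha> * \<alpha> * (\<eta> * ?\<sigma> \<eta>)" unfolding a_def unfolding \<eta>(2) by (simp only: mult_ac)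
    thus "a * ?\<sigma> \<eta> = 1 * (\<alpha> * \<alpha>)" by (simp add: one)
  qed
  thus ?thesis using sg unfolding R_def by (intro exI[of _ a] conjI)
qed

lemma gauss_unit_alg_int:
  assumes "x \<in> gauss_rat" "alg_int x" "alg_int (inverse x)" "x \<noteq> 0"
  shows "x \<in> {1, -1, \<i>, -\<i>}"
proof (rule gauss_unit_cases)
  show "x \<in> gauss_int" by (rule alg_int_gauss_rat[OF assms(2,1)])
  show "inverse x \<in> gauss_int"
    by (rule alg_int_gauss_rat[OF assms(3) subfield_inverse[OF gauss_rat_subfield assms(1)]])
qed (use assms(4) in simp)

section \<open>Quadratic extensions of the Gaussian field\<close>

text \<open>\<open>s\<close> is the real root, so that complex conjugation maps the field to itself
  and commutes with the nontrivial automorphism over \<open>gauss_rat\<close>.\<close>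

locale gauss_ext =
  fixes d :: nat and s :: complex
  assumes s_def: "s = complex_of_real (sqrt (real d))" and nonsquare: "\<And>m. d \<noteq> m * m"
begin

lemma s_square: "s * s = of_nat d"
proof -
  have "s * s = complex_of_real (sqrt (real d) * sqrt (real d))" by (simp only: s_def of_real_mult)
  also have "sqrt (real d) * sqrt (real d) = real d" by simp
  finally show ?thesis by simp
qed

lemma d_pos: "d > 0" using nonsquare[of 0] by simp

lemma s_nonzero: "s \<noteq> 0" using s_square d_pos by auto

sublocale quad_ext gauss_rat s
proof
  show "is_subfield gauss_rat" by (rule gauss_rat_subfield)
  show "s * s \<in> gauss_rat" unfolding s_square by (rule subfield_of_nat[OF gauss_rat_subfield])
  show "s \<notin> gauss_rat" using nat_square_gauss_rat[OF s_square[symmetric]] nonsquare by blast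
qed

abbreviation "M \<equiv> adj gauss_rat s"
abbreviation "\<tau> \<equiv> qconj gauss_rat s"

lemma norm_int: "z \<in> M \<Longrightarrow> alg_int z \<Longrightarrow> z * \<tau> z \<in> gauss_int"
  by (rule alg_int_gauss_rat[OF alg_int_mult[OF _ alg_int_qconj] norm_in_base])

lemma trace_int: "z \<in> M \<Longrightarrow> alg_int z \<Longrightarrow> z + \<tau> z \<in> gauss_int"
  by (rule alg_int_gauss_rat[OF alg_int_add[OF _ alg_int_qconj] trace_in_base])

lemma alg_int_by_trace_norm:
  assumes "z + \<tau> z \<in> gauss_int" "z * \<tau> z \<in> gauss_int" shows "alg_int z"
  by (rule alg_int_quadratic[OF assms]) (simp add: algebra_simps)

lemma cnj_M: "z \<in> M \<Longrightarrow> cnj z \<in> M" and cnj_\<tau>: "z \<in> M \<Longrightarrow> \<tau> (cnj z) = cnj (\<tau> z)"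
  using cnj_adj[OF gauss_rat_cnj, of z] by (simp_all add: s_def)

lemma M_int: "z \<in> gauss_int \<Longrightarrow> z \<in> M"
  by (rule base_subset[OF gauss_int_rat])

lemma \<tau>_int [simp]: "z \<in> gauss_int \<Longrightarrow> \<tau> z = z"
  by (rule qconj_base[OF gauss_int_rat])

lemmas M_closed = subfield_intros[OF adj_subfield]

lemma norm_unit:
  assumes "unit_of M u" shows "u * \<tau> u \<in> {1, -1, \<i>, -\<i>}"
proof (rule gauss_unit_alg_int)
  have u: "u \<in> M" "u \<noteq> 0" "alg_int u" "alg_int (inverse u)" using assms by (auto simp: unit_of_def)
  have i: "inverse u \<in> M" by (rule subfield_inverse[OF adj_subfield u(1)])
  show "u * \<tau> u \<in> gauss_rat" by (rule norm_in_base[OF u(1)])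
  show "alg_int (u * \<tau> u)" by (rule alg_int_mult[OF u(3) alg_int_qconj[OF u(1,3)]])
  have e: "inverse (u * \<tau> u) = inverse u * \<tau> (inverse u)"
    unfolding qconj_inverse[OF u(1)] by simp
  show "alg_int (inverse (u * \<tau> u))"
    unfolding e by (rule alg_int_mult[OF u(4) alg_int_qconj[OF i u(4)]])
  show "u * \<tau> u \<noteq> 0" using u qconj_0_iff[OF u(1)] by simp
qed

text \<open>A square-free Gaussian integer may become the square of an ideal in \<open>M\<close>,
  but only at primes dividing 2 d; the factor 2 d accounts for this. The trace \<open>t\<close> of y
  and \<open>B\<close> = 2 b d are Gaussian integers whose squares r divides, so r divides both, and
  2 d y = d t + B s.\<close>

lemma radical_divides:
  assumes r: "gauss_radical r" and y: "y \<in> M" and yr: "alg_int (y * y / r)"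
  shows "alg_int (of_nat (2 * d) * y / r)"
proof -
  have rI: "r \<in> gauss_int" and r0: "r \<noteq> 0"
    and rad: "\<And>x. x \<in> gauss_int \<Longrightarrow> gauss_dvd r (x * x) \<Longrightarrow> gauss_dvd r x"
    using r by (auto simp: gauss_radical_def)
  have rM: "r \<in> M" by (rule M_int[OF rI])
  define m where "m = y * y / r"
  have mM: "m \<in> M" unfolding m_def by (intro M_closed y rM)
  have m: "alg_int m" using yr by (simp add: m_def)
  have yy: "y * y = r * m" using r0 by (simp add: m_def)
  have "alg_int (y * y)" unfolding yy by (rule alg_int_mult[OF gauss_int_alg_int[OF rI] m])
  hence ya: "alg_int y" by (rule alg_int_sqrtD)
  have \<tau>y: "\<tau> y \<in> M" by (rule qconj_in[OF y])
  have \<tau>yy: "\<tau> y * \<tau> y = r * \<tau> m"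
    unfolding qconj_mult[OF y y, symmetric] yy qconj_mult[OF rM mM] using rI by simp
  define N where "N = y * \<tau> y"
  have NI: "N \<in> gauss_int" unfolding N_def by (rule norm_int[OF y ya])
  define n where "n = N / r"
  have "N * N = (y * y) * (\<tau> y * \<tau> y)" by (simp add: N_def mult_ac)
  also have "\<dots> = r * r * (m * \<tau> m)" unfolding yy \<tau>yy by (simp only: mult_ac)
  finally have "n * n = m * \<tau> m" using r0 by (simp add: n_def)
  hence "alg_int (n * n)" using alg_int_mult[OF m alg_int_qconj[OF mM m]] by simp
  hence "alg_int n" by (rule alg_int_sqrtD)
  hence nI: "n \<in> gauss_int" unfolding n_def
    by (rule alg_int_gauss_rat) (intro subfield_divide gauss_rat_subfield gauss_int_rat NI rI)
  have Nn: "N = r * n" using r0 by (simp add: n_def)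
  define t where "t = y + \<tau> y"
  have tI: "t \<in> gauss_int" unfolding t_def by (rule trace_int[OF y ya])
  have "t * t = y * y + \<tau> y * \<tau> y + 2 * N" by (simp add: t_def N_def algebra_simps)
  also have "\<dots> = r * ((m + \<tau> m) + 2 * n)" unfolding yy \<tau>yy Nn by (simp add: algebra_simps)
  finally have tt: "t * t = r * ((m + \<tau> m) + 2 * n)" .
  have "gauss_dvd r (t * t)"
    by (rule gauss_dvdI[OF _ tt]) (intro gauss_int_add gauss_int_mult trace_int[OF mM m] nI gauss_int_numeral)
  hence "gauss_dvd r t" by (rule rad[OF tI])
  then obtain t' where t': "t' \<in> gauss_int" "t = r * t'" unfolding gauss_dvd_def by blast
  obtain a b where ab: "a \<in> gauss_rat" "b \<in> gauss_rat" "y = a + b * s" "\<tau> y = a - b * s" using y by (rule adjE)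
  define B where "B = 2 * b * of_nat d"
  have Brat: "B \<in> gauss_rat" unfolding B_def using ab gauss_rat_subfield by (intro subfield_intros)
  have "t * t - 4 * N = 4 * b * b * (s * s)" unfolding t_def N_def ab(4) unfolding ab(3) by (simp add: algebra_simps)
  hence "B * B = (t * t - 4 * N) * of_nat d" unfolding s_square by (simp add: B_def)
  hence BB: "B * B = r * (((m + \<tau> m) + 2 * n - 4 * n) * of_nat d)"
    unfolding tt Nn by (simp add: algebra_simps)
  have cI: "((m + \<tau> m) + 2 * n - 4 * n) * of_nat d \<in> gauss_int"
    by (intro gauss_int_add gauss_int_mult gauss_int_diff trace_int[OF mM m] nI gauss_int_numeral gauss_int_of_nat)
  have "B * B \<in> gauss_int" unfolding BB by (rule gauss_int_mult[OF rI cI])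
  hence BI: "B \<in> gauss_int" by (rule gauss_int_sqrtD[OF Brat])
  have "gauss_dvd r B" by (rule rad[OF BI gauss_dvdI[OF cI BB]])
  then obtain B' where B': "B' \<in> gauss_int" "B = r * B'" unfolding gauss_dvd_def by blast
  have "of_nat (2 * d) * y = of_nat d * t + B * s"
    unfolding t_def B_def ab(4) unfolding ab(3) by (simp add: algebra_simps)
  also have "\<dots> = r * (of_nat d * t' + B' * s)" unfolding t'(2) B'(2) by (simp add: algebra_simps)
  finally have "of_nat (2 * d) * y / r = of_nat d * t' + B' * s" using r0 by simp
  moreover have "alg_int s" by (rule alg_int_sqrtD) (simp add: s_square)
  ultimately show ?thesis
    using alg_int_add[OF alg_int_mult[OF alg_int_of_nat gauss_int_alg_int[OF t'(1)]]
        alg_int_mult[OF gauss_int_alg_int[OF B'(1)]]] by simp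
qed

section \<open>Ideals with principal square over the Gaussian field\<close>

abbreviation "R \<equiv> ring_of_integers M"

lemma R_subring: "subring_set R" by (rule ring_of_integers_subring[OF adj_subfield])

text \<open>Formally r is, up to a unit, the square of the fractional ideal I / c, so its prime
  factors ramify in \<open>M\<close>. The two factors 2 d come from applying
  \<open>radical_divides\<close> to both factors of a product of elements of I.\<close>

lemma radical_divides_disc:
  assumes r: "gauss_radical r" and I: "square_gen R I a" and ar: "sq_equiv M a r"
  shows "gauss_dvd r (of_nat (4 * d * d))"
proof -
  have rI: "r \<in> gauss_int" and r0: "r \<noteq> 0" using r by (auto simp: gauss_radical_def)
  obtain u c where u: "unit_of M u" "c \<in> M" "c \<noteq> 0" "a * u = r * (c * c)"
    using ar unfolding sq_equiv_def by blast
  have uu: "u \<noteq> 0" "alg_int u" "alg_int (inverse u)" using u(1) by (auto simp: unit_of_def)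
  note iI = square_genD(1)[OF I] and a0 = square_genD(3)[OF I]
  have IM: "x \<in> M" if "x \<in> I" for x using iI that by (auto simp: is_ideal_def ring_of_integers_def)
  have key: "alg_int (of_nat (2 * d) * (x / c) / r)" if x: "x \<in> I" for x
  proof (rule radical_divides[OF r])
    show "x / c \<in> M" by (intro M_closed IM x u(2))
    obtain \<rho> where \<rho>: "\<rho> \<in> R" "x * x = a * \<rho>" using square_genD(4)[OF I x x] by blast
    have "x / c * (x / c) / r = a * \<rho> / (r * (c * c))" unfolding \<rho>(2)[symmetric] by simp
    also have "\<dots> = \<rho> * inverse u" unfolding u(4)[symmetric] using a0 uu(1) by (simp add: field_simps)
    finally show "alg_int (x / c * (x / c) / r)"
      using alg_int_mult[OF ring_of_integersD(2)[OF \<rho>(1)] uu(3)] by simp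
  qed
  \<comment> \<open>Chosen such that \<open>K * a * u\<close> equals
    \<open>of_nat (4 * d * d) / r\<close>.\<close>
  define K where "K = of_nat (4 * d * d) / (r * r * (c * c))"
  have mod: "module_set R {z. alg_int z}"
    unfolding module_set_def by (auto intro: alg_int_add alg_int_mult ring_of_integersD(2))
  have "K * a \<in> {z. alg_int z}"
  proof (rule ideal_mult_induct[OF R_subring iI iI mod _ square_genD(5)[OF I R_subring]])
    fix x y assume "x \<in> I" "y \<in> I"
    hence "alg_int ((of_nat (2 * d) * (x / c) / r) * (of_nat (2 * d) * (y / c) / r))"
      by (intro alg_int_mult key)
    moreover have "(of_nat (2 * d) * (x / c) / r) * (of_nat (2 * d) * (y / c) / r) = K * (x * y)"
      by (simp add: K_def mult_ac)
    ultimately show "K * (x * y) \<in> {z. alg_int z}" by simp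
  qed
  hence "alg_int (K * a * u)" using uu(2) by (auto intro: alg_int_mult)
  moreover have "K * a * u = K * (r * (c * c))" using u(4) by (simp add: mult.assoc)
  moreover have "K * (r * (c * c)) = of_nat (4 * d * d) / r" using r0 u(3) by (simp add: K_def)
  ultimately have "alg_int (of_nat (4 * d * d) / r)" by simp
  moreover have "of_nat (4 * d * d) / r \<in> gauss_rat"
    by (intro subfield_divide gauss_rat_subfield gauss_int_rat rI gauss_int_of_nat)
  ultimately have "of_nat (4 * d * d) / r \<in> gauss_int" by (rule alg_int_gauss_rat)
  thus ?thesis by (rule gauss_dvdI) (use r0 in simp)
qed

text \<open>Since \<open>gauss_int\<close> is principal, the norm of an ideal whose square is generated by \<open>a\<close>
  has a generator \<open>n\<close>, and \<open>n\<^sup>2\<close> is the norm of \<open>a\<close> up to a unit.\<close>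
lemma square_gen_norm:
  assumes I: "square_gen R I a"
  shows "\<exists>\<nu>\<in>{1, -1, \<i>, -\<i>}. \<exists>n\<in>gauss_int. n \<noteq> 0 \<and> a * \<tau> a = \<nu> * (n * n)"
proof -
  note iI = square_genD(1)[OF I] and a0 = square_genD(3)[OF I]
  have IM: "x \<in> M" and IA: "alg_int x" if "x \<in> I" for x
    using iI that by (auto simp: is_ideal_def ring_of_integers_def)
  have aM: "a \<in> M" and aA: "alg_int a" using square_genD(2)[OF I] by (auto simp: ring_of_integers_def)
  have \<tau>a0: "\<tau> a \<noteq> 0" using a0 qconj_0_iff[OF aM] by simp
  have aaI: "a * \<tau> a \<in> gauss_int" by (rule norm_int[OF aM aA])
  \<comment> \<open>A formal generator of I times its conjugate; it need not lie in
    \<open>M\<close>, and only the integrality of quotients by it is used.\<close>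
  define W where "W = csqrt (a * \<tau> a)"
  have WW: "W * W = a * \<tau> a" by (simp add: W_def flip: power2_eq_square)
  have W0: "W \<noteq> 0" using WW a0 \<tau>a0 by auto
  have xyW: "alg_int (x * \<tau> y / W)" if x: "x \<in> I" and y: "y \<in> I" for x y
  proof (rule alg_int_sqrtD)
    obtain \<rho> where \<rho>: "\<rho> \<in> R" "x * x = a * \<rho>" using square_genD(4)[OF I x x] by blast
    obtain \<rho>' where \<rho>': "\<rho>' \<in> R" "y * y = a * \<rho>'" using square_genD(4)[OF I y y] by blast
    have \<rho>'M: "\<rho>' \<in> M" "alg_int \<rho>'" using \<rho>'(1) by (auto simp: ring_of_integers_def)
    have \<tau>yy: "\<tau> y * \<tau> y = \<tau> a * \<tau> \<rho>'"
      unfolding qconj_mult[OF IM[OF y] IM[OF y], symmetric] \<rho>'(2) by (rule qconj_mult[OF aM \<rho>'M(1)])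
    have "x * \<tau> y / W * (x * \<tau> y / W) = (x * x) * (\<tau> y * \<tau> y) / (W * W)" by simp
    also have "\<dots> = \<rho> * \<tau> \<rho>'" unfolding WW \<rho>(2) \<tau>yy using a0 \<tau>a0 by simp
    finally show "alg_int (x * \<tau> y / W * (x * \<tau> y / W))"
      using alg_int_mult[OF ring_of_integersD(2)[OF \<rho>(1)] alg_int_qconj[OF \<rho>'M]] by simp
  qed
  define J where "J = {z \<in> gauss_int. alg_int (z / W)}"
  obtain n where n: "n \<in> J" "\<And>x. x \<in> J \<Longrightarrow> gauss_dvd n x"
  proof (rule gauss_int_principal[of J])
    show "J \<subseteq> gauss_int" by (auto simp: J_def)
    show "0 \<in> J" by (simp add: J_def)
    show "x + y \<in> J" if "x \<in> J" "y \<in> J" for x y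
      using that alg_int_add[of "x / W" "y / W"] by (simp add: J_def gauss_int_add add_divide_distrib)
    show "c * x \<in> J" if "x \<in> J" "c \<in> gauss_int" for x c
      using that alg_int_mult[OF gauss_int_alg_int[of c], of "x / W"] by (simp add: J_def gauss_int_mult)
  qed blast
  have nI: "n \<in> gauss_int" and nW: "alg_int (n / W)" using n(1) by (auto simp: J_def)
  have "a * \<tau> a / W = W" using W0 by (simp add: WW[symmetric])
  moreover have "alg_int W" by (rule alg_int_sqrtD) (unfold WW, rule gauss_int_alg_int[OF aaI])
  ultimately have "a * \<tau> a \<in> J" using aaI by (simp add: J_def)
  hence "gauss_dvd n (a * \<tau> a)" by (rule n(2))
  hence n0: "n \<noteq> 0" using a0 \<tau>a0 by (auto simp: gauss_dvd_def)
  \<comment> \<open>The trace of x \<tau>(y) and the norms of x and of y lie in \<open>J\<close>, so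
    n divides them; this makes the trace and the norm of the quotient Gaussian integers.\<close>
  have xyn: "alg_int (x * \<tau> y / n)" if x: "x \<in> I" and y: "y \<in> I" for x y
  proof (rule alg_int_by_trace_norm)
    have xM: "x \<in> M" and yM: "y \<in> M" using IM x y by auto
    have xyM: "x * \<tau> y \<in> M" by (rule adj_mult[OF xM qconj_in[OF yM]])
    have \<tau>xy: "\<tau> (x * \<tau> y) = \<tau> x * y" using qconj_mult[OF xM qconj_in[OF yM]] yM by simp
    have \<tau>q: "\<tau> (x * \<tau> y / n) = y * \<tau> x / n"
      unfolding qconj_divide[OF xyM M_int[OF nI]] \<tau>xy using nI by (simp add: mult.commute)
    have div: "z / n \<in> gauss_int" if "gauss_dvd n z" for z
      using that n0 by (auto simp: gauss_dvd_def)
    have "x * \<tau> y + y * \<tau> x \<in> gauss_rat" using trace_in_base[OF xyM] by (simp add: \<tau>xy mult.commute)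
    moreover have "alg_int ((x * \<tau> y + y * \<tau> x) / W)"
      using alg_int_add[OF xyW[OF x y] xyW[OF y x]] by (simp add: add_divide_distrib)
    moreover have "alg_int (x * \<tau> y + y * \<tau> x)"
      by (intro alg_int_add alg_int_mult IA alg_int_qconj x y xM yM)
    ultimately have "x * \<tau> y + y * \<tau> x \<in> J" by (simp add: J_def alg_int_gauss_rat)
    hence "(x * \<tau> y + y * \<tau> x) / n \<in> gauss_int" by (intro div n(2))
    thus "x * \<tau> y / n + \<tau> (x * \<tau> y / n) \<in> gauss_int" unfolding \<tau>q by (simp add: add_divide_distrib)
    have NJ: "z * \<tau> z \<in> J" if "z \<in> I" for z
      using norm_int[OF IM[OF that] IA[OF that]] xyW[OF that that] by (simp add: J_def)
    have "x * \<tau> x / n \<in> gauss_int" "y * \<tau> y / n \<in> gauss_int" by (intro div n(2) NJ x y)+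
    hence "(x * \<tau> x / n) * (y * \<tau> y / n) \<in> gauss_int" by (rule gauss_int_mult)
    moreover have "(x * \<tau> x / n) * (y * \<tau> y / n) = x * \<tau> y / n * (y * \<tau> x / n)" by (simp add: mult_ac)
    ultimately show "x * \<tau> y / n * \<tau> (x * \<tau> y / n) \<in> gauss_int" unfolding \<tau>q by (simp only:)
  qed
  define k where "k = 1 / (n * n)"
  \<comment> \<open>The products y y' are first replaced by a, which enters conjugated; the products
    x x' follow after that.\<close>
  have xx: "alg_int (k * (x * x' * \<tau> a))" if h: "x \<in> I" "x' \<in> I" for x x'
  proof -
    have "module_set R {z \<in> M. alg_int (k * (x * x' * \<tau> z))}"
      unfolding module_set_def
    proof (intro conjI ballI)
      show "0 \<in> {z \<in> M. alg_int (k * (x * x' * \<tau> z))}"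
        using subfield_0[OF adj_subfield] qconj_base[OF subfield_0[OF sub]] by simp
    next
      fix z z' assume "z \<in> {z \<in> M. alg_int (k * (x * x' * \<tau> z))}" "z' \<in> {z \<in> M. alg_int (k * (x * x' * \<tau> z))}"
      hence z: "z \<in> M" "z' \<in> M" "alg_int (k * (x * x' * \<tau> z))" "alg_int (k * (x * x' * \<tau> z'))" by auto
      show "z + z' \<in> {z \<in> M. alg_int (k * (x * x' * \<tau> z))}"
        using alg_int_add[OF z(3,4)] adj_add[OF z(1,2)] by (simp add: qconj_add[OF z(1,2)] distrib_left)
    next
      fix \<rho> z assume \<rho>: "\<rho> \<in> R" and "z \<in> {z \<in> M. alg_int (k * (x * x' * \<tau> z))}"
      hence z: "z \<in> M" "alg_int (k * (x * x' * \<tau> z))" by auto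
      have \<rho>M: "\<rho> \<in> M" "alg_int \<rho>" using \<rho> by (auto simp: ring_of_integers_def)
      have eq: "k * (x * x' * \<tau> (\<rho> * z)) = \<tau> \<rho> * (k * (x * x' * \<tau> z))"
        unfolding qconj_mult[OF \<rho>M(1) z(1)] by (simp only: mult_ac)
      have "alg_int (k * (x * x' * \<tau> (\<rho> * z)))"
        unfolding eq by (rule alg_int_mult[OF alg_int_qconj[OF \<rho>M] z(2)])
      thus "\<rho> * z \<in> {z \<in> M. alg_int (k * (x * x' * \<tau> z))}"
        by (intro CollectI conjI adj_mult[OF \<rho>M(1) z(1)])
    qed
    hence "1 * a \<in> {z \<in> M. alg_int (k * (x * x' * \<tau> z))}"
    proof (rule ideal_mult_induct[OF R_subring iI iI _ _ square_genD(5)[OF I R_subring]])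
      fix y y' assume y: "y \<in> I" "y' \<in> I"
      have eq: "k * (x * x' * \<tau> (y * y')) = (x * \<tau> y / n) * (x' * \<tau> y' / n)"
        unfolding qconj_mult[OF IM[OF y(1)] IM[OF y(2)]] by (simp add: k_def mult_ac)
      have "alg_int (k * (x * x' * \<tau> (y * y')))"
        unfolding eq by (rule alg_int_mult[OF xyn[OF h(1) y(1)] xyn[OF h(2) y(2)]])
      thus "1 * (y * y') \<in> {z \<in> M. alg_int (k * (x * x' * \<tau> z))}"
        unfolding mult_1_left by (intro CollectI conjI adj_mult[OF IM[OF y(1)] IM[OF y(2)]])
    qed
    thus ?thesis by simp
  qed
  have mod: "module_set R {z. alg_int z}"
    unfolding module_set_def by (auto intro: alg_int_add alg_int_mult ring_of_integersD(2))
  have "(k * \<tau> a) * a \<in> {z. alg_int z}"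
  proof (rule ideal_mult_induct[OF R_subring iI iI mod _ square_genD(5)[OF I R_subring]])
    fix x y assume "x \<in> I" "y \<in> I"
    thus "(k * \<tau> a) * (x * y) \<in> {z. alg_int z}" using xx[of x y] by (simp add: mult_ac)
  qed
  moreover have "(k * \<tau> a) * a = a * \<tau> a / (n * n)" by (simp add: k_def)
  ultimately have aan: "alg_int (a * \<tau> a / (n * n))" by simp
  define \<nu> where "\<nu> = a * \<tau> a / (n * n)"
  have "\<nu> \<in> {1, -1, \<i>, -\<i>}"
  proof (rule gauss_unit_alg_int)
    show "\<nu> \<in> gauss_rat" unfolding \<nu>_def
      by (intro subfield_divide gauss_rat_subfield gauss_int_rat aaI gauss_int_mult nI)
    show "alg_int \<nu>" using aan by (simp add: \<nu>_def)
    \<comment> \<open>Integrality of the inverse expresses that n lies in \<open>J\<close>, while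
      integrality of \<nu> itself came from the two inductions.\<close>
    have "inverse \<nu> = (n / W) * (n / W)" using W0 by (simp add: \<nu>_def WW[symmetric])
    thus "alg_int (inverse \<nu>)" using alg_int_mult[OF nW nW] by simp
    show "\<nu> \<noteq> 0" using a0 \<tau>a0 n0 by (simp add: \<nu>_def)
  qed
  moreover have "a * \<tau> a = \<nu> * (n * n)" using n0 by (simp add: \<nu>_def)
  ultimately show ?thesis using nI n0 by blast
qed

text \<open>Hilbert 90: \<open>z / n\<close> has norm 1, so \<open>(z + n)\<^sup>2 / z\<close> is fixed by \<open>\<tau>\<close>.\<close>
lemma sq_equiv_of_norm_square:
  assumes z: "z \<in> M" "z \<noteq> 0" and n: "n \<in> gauss_rat" "n \<noteq> 0" "z * \<tau> z = n * n"
  shows "\<exists>r\<in>gauss_rat. r \<noteq> 0 \<and> sq_equiv M z r"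
proof (cases "z + n = 0")
  \<comment> \<open>The element \<open>b\<close> of the other case would vanish here, but z already
    lies in \<open>gauss_rat\<close>.\<close>
  case True
  hence "z = - n" by (simp add: eq_neg_iff_add_eq_0)
  hence "z \<in> gauss_rat" using n(1) by (simp add: subfield_minus[OF gauss_rat_subfield])
  thus ?thesis using z(2) sq_equiv_refl[OF adj_subfield, of z] by (intro bexI[of _ z] conjI)
next
  case False
  define b where "b = z + n"
  have b0: "b \<noteq> 0" using False by (simp add: b_def)
  have nM: "n \<in> M" by (rule base_subset[OF n(1)])
  have bM: "b \<in> M" unfolding b_def by (rule adj_add[OF z(1) nM])
  have \<tau>b: "\<tau> b = \<tau> z + n" unfolding b_def by (simp add: qconj_add[OF z(1) nM] n(1))
  have eq: "z * \<tau> b = n * b" unfolding \<tau>b unfolding b_def by (simp add: distrib_left n(3) mult.commute)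
  define N where "N = b * \<tau> b"
  have NQ: "N \<in> gauss_rat" unfolding N_def by (rule norm_in_base[OF bM])
  have N0: "N \<noteq> 0" using b0 qconj_0_iff[OF bM] by (simp add: N_def)
  have "z * N = b * (z * \<tau> b)" unfolding N_def by (simp only: mult_ac)
  hence zN: "z * N = n * (b * b)" unfolding eq by (simp only: mult_ac)
  have "z = (n / N) * (b * b)" using N0 zN by (simp add: field_simps)
  hence "sq_equiv M z (n / N)" using sq_equiv_square[OF adj_subfield bM b0, of "n / N"] by simp
  moreover have "n / N \<in> gauss_rat" by (rule subfield_divide[OF gauss_rat_subfield n(1) NQ])
  ultimately show ?thesis using n(2) N0 by (intro bexI[of _ "n / N"]) auto
qed

lemma sq_equiv_radical:
  assumes "r \<in> gauss_rat" "r \<noteq> 0"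
  shows "\<exists>r0. gauss_radical r0 \<and> sq_equiv M r r0"
proof -
  obtain r0 c where *: "gauss_radical r0" "c \<in> gauss_rat" "c \<noteq> 0" "r = r0 * (c * c)"
    using gauss_radical_kernel[OF assms] .
  have "sq_equiv M r r0" unfolding *(4) by (rule sq_equiv_square[OF adj_subfield base_subset[OF *(2)] *(3)])
  thus ?thesis using *(1) by blast
qed

text \<open>A form of Kronecker's theorem. \<zeta> = v / cnj v is integral, and both \<zeta> and its
  conjugate \<tau>(\<zeta>) have absolute value 1, so S = (\<zeta> - \<tau>(\<zeta>))^2 is a
  Gaussian integer of size at most 4. As p divides d exactly once, it divides S, and p \<ge> 5
  forces S = 0; then \<zeta> lies in \<open>gauss_rat\<close> and is a fourth root of unity.\<close>

lemma unit_div_cnj: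
  assumes v: "unit_of M v" and p: "prime p" "p \<ge> 5" "d = p * d'" "\<not> p dvd d'"
  shows "v / cnj v \<in> {1, -1, \<i>, -\<i>}"
proof -
  have vv: "v \<in> M" "v \<noteq> 0" "alg_int v" "alg_int (inverse v)" using v by (auto simp: unit_of_def)
  define \<zeta> where "\<zeta> = v / cnj v"
  have \<zeta>M: "\<zeta> \<in> M" unfolding \<zeta>_def by (rule subfield_divide[OF adj_subfield vv(1) cnj_M[OF vv(1)]])
  have "\<zeta> = v * cnj (inverse v)" by (simp add: \<zeta>_def divide_inverse)
  hence \<zeta>A: "alg_int \<zeta>" using alg_int_mult[OF vv(3) alg_int_cnj[OF vv(4)]] by simp
  have \<zeta>1: "cmod \<zeta> = 1" using vv(2) by (simp add: \<zeta>_def norm_divide)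
  have "\<tau> \<zeta> = \<tau> v / cnj (\<tau> v)"
    unfolding \<zeta>_def by (simp add: qconj_divide[OF vv(1) cnj_M[OF vv(1)]] cnj_\<tau>[OF vv(1)])
  hence \<tau>\<zeta>1: "cmod (\<tau> \<zeta>) = 1" using vv(2) qconj_0_iff[OF vv(1)] by (simp add: norm_divide)
  obtain a b where ab: "a \<in> gauss_rat" "b \<in> gauss_rat" "\<zeta> = a + b * s" "\<tau> \<zeta> = a - b * s"
    using \<zeta>M by (rule adjE)
  define S where "S = (\<zeta> - \<tau> \<zeta>) * (\<zeta> - \<tau> \<zeta>)"
  have "S = (\<zeta> + \<tau> \<zeta>) * (\<zeta> + \<tau> \<zeta>) - 4 * (\<zeta> * \<tau> \<zeta>)" by (simp add: S_def algebra_simps)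
  also have "\<dots> \<in> gauss_int"
    by (intro gauss_int_diff gauss_int_mult gauss_int_numeral trace_int norm_int \<zeta>M \<zeta>A)
  finally have SI: "S \<in> gauss_int" .
  have "cmod (\<zeta> - \<tau> \<zeta>) \<le> 2" using norm_triangle_ineq4[of \<zeta> "\<tau> \<zeta>"] \<zeta>1 \<tau>\<zeta>1 by simp
  hence "cmod (\<zeta> - \<tau> \<zeta>) * cmod (\<zeta> - \<tau> \<zeta>) \<le> 2 * 2" by (intro mult_mono) auto
  hence S4: "cmod S \<le> 4" by (simp add: S_def norm_mult)
  \<comment> \<open>T is (\<zeta> - \<tau>(\<zeta>)) s, so T^2 = d S. Once p divides T, the left
    side contains p^2, while d contributes a single factor p.\<close>
  define T where "T = 2 * b * of_nat d"
  have "S = 4 * b * b * (s * s)" unfolding S_def ab(4) unfolding ab(3) by (simp add: algebra_simps)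
  hence TT: "T * T = of_nat d * S" unfolding s_square by (simp add: T_def)
  have "T \<in> gauss_rat" unfolding T_def using ab gauss_rat_subfield by (intro subfield_intros)
  moreover have "T * T \<in> gauss_int" unfolding TT by (rule gauss_int_mult[OF gauss_int_of_nat SI])
  ultimately have "T \<in> gauss_int" by (rule gauss_int_sqrtD)
  then obtain x y where xy: "T = of_int x + \<i> * of_int y" by (rule gauss_intE)
  obtain i j where ij: "S = of_int i + \<i> * of_int j" using SI by (rule gauss_intE)
  have "Re (T * T) = real_of_int (x * x - y * y)" "Im (T * T) = real_of_int (2 * x * y)"
    by (simp_all add: xy)
  moreover have "Re (of_nat d * S) = real_of_int (int d * i)" "Im (of_nat d * S) = real_of_int (int d * j)"
    by (simp_all add: ij)
  ultimately have e1: "x * x - y * y = int d * i" and e2: "2 * x * y = int d * j"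
    unfolding TT by (simp_all only: of_int_eq_iff)
  have pp: "prime (int p)" using p(1) by simp
  have dp: "int d = int p * int d'" using p(3) by simp
  have "int p dvd 2 * x * y" unfolding e2 dp by simp
  moreover have "\<not> int p dvd 2" using p(2) by (intro zdvd_not_zless) auto
  ultimately have pxy: "int p dvd x \<or> int p dvd y" using pp by (simp add: prime_dvd_mult_iff)
  have pd: "int p dvd x * x - y * y" unfolding e1 dp by simp
  \<comment> \<open>The coordinates x^2 - y^2 and 2 x y of T^2 are both divisible by p.\<close>
  have "int p dvd x \<and> int p dvd y"
  proof (cases "int p dvd x")
    case True
    have "int p dvd x * x - (x * x - y * y)" by (rule dvd_diff[OF dvd_mult[OF True] pd])
    hence "int p dvd y * y" by simp
    thus ?thesis using True pp by (simp add: prime_dvd_mult_iff)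
  next
    case False
    hence y: "int p dvd y" using pxy by simp
    have "int p dvd (x * x - y * y) + y * y" by (rule dvd_add[OF pd dvd_mult[OF y]])
    hence "int p dvd x * x" by simp
    thus ?thesis using False pp by (simp add: prime_dvd_mult_iff)
  qed
  then obtain x' y' where x'y': "x = int p * x'" "y = int p * y'" by (elim conjE dvdE)
  have p0: "int p \<noteq> 0" using p(2) by simp
  have "int p * (int p * (x' * x' - y' * y')) = int p * (int d' * i)"
    using e1 unfolding x'y' dp by (simp add: algebra_simps)
  hence "int d' * i = int p * (x' * x' - y' * y')" using p0 by simp
  hence "int p dvd int d' * i" by simp
  hence pi: "int p dvd i" using pp p(4) by (simp add: prime_dvd_mult_iff)
  have "int p * (int p * (2 * x' * y')) = int p * (int d' * j)"
    using e2 unfolding x'y' dp by (simp add: algebra_simps)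
  hence "int d' * j = int p * (2 * x' * y')" using p0 by simp
  hence "int p dvd int d' * j" by simp
  hence pj: "int p dvd j" using pp p(4) by (simp add: prime_dvd_mult_iff)
  have "\<bar>Re S\<bar> \<le> 4" "\<bar>Im S\<bar> \<le> 4" using abs_Re_le_cmod[of S] abs_Im_le_cmod[of S] S4 by linarith+
  hence le4: "\<bar>i\<bar> \<le> 4" "\<bar>j\<bar> \<le> 4" by (simp_all add: ij)
  have "z = 0" if z: "int p dvd z" "\<bar>z\<bar> \<le> 4" for z
  proof (rule ccontr)
    assume "z \<noteq> 0"
    hence "\<bar>int p\<bar> \<le> \<bar>z\<bar>" by (rule dvd_imp_le_int) (rule z(1))
    thus False using z(2) p(2) by simp
  qed
  hence "i = 0" "j = 0" using pi pj le4 by simp_all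
  hence "S = 0" by (simp add: ij)
  hence "\<tau> \<zeta> = \<zeta>" by (simp add: S_def)
  hence "\<zeta> \<in> gauss_rat" by (rule qconj_fixed[OF \<zeta>M])
  moreover have "inverse \<zeta> = cnj \<zeta>" using vv(2) by (simp add: \<zeta>_def)
  hence "alg_int (inverse \<zeta>)" using alg_int_cnj[OF \<zeta>A] by simp
  moreover have "\<zeta> \<noteq> 0" using \<zeta>1 by auto
  ultimately show ?thesis unfolding \<zeta>_def[symmetric] using gauss_unit_alg_int \<zeta>A by blast
qed

end

section \<open>Quadratic residues\<close>

lemma QuadRes_iff: "QuadRes l a \<longleftrightarrow> (\<exists>y. l dvd y * y - a)"
  by (simp add: QuadRes_def cong_iff_dvd_diff power2_eq_square)

lemma QuadRes_mult:
  assumes "QuadRes l a" "QuadRes l b" shows "QuadRes l (a * b)"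
proof -
  obtain y z where yz: "l dvd y * y - a" "l dvd z * z - b" using assms unfolding QuadRes_iff by blast
  have "l dvd (y * y - a) * (z * z) + (z * z - b) * a" by (rule dvd_add[OF dvd_mult2[OF yz(1)] dvd_mult2[OF yz(2)]])
  moreover have "(y * y - a) * (z * z) + (z * z - b) * a = (y * z) * (y * z) - a * b" by (simp add: algebra_simps)
  ultimately show ?thesis unfolding QuadRes_iff by metis
qed

lemma QuadRes_cong: "l dvd a - b \<Longrightarrow> QuadRes l a \<Longrightarrow> QuadRes l b"
  unfolding QuadRes_iff
proof (elim exE)
  fix y assume "l dvd a - b" "l dvd y * y - a"
  hence "l dvd (y * y - a) + (a - b)" by (intro dvd_add)
  thus "\<exists>y. l dvd y * y - b" by (intro exI[of _ y]) simp
qed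

text \<open>With i the inverse of a modulo l, b is congruent to i^2 a (a b), a product of
  residues.\<close>

lemma QuadRes_cancel:
  assumes "prime l" "\<not> l dvd a" "QuadRes l a" "QuadRes l (a * b)" shows "QuadRes l b"
proof -
  have "coprime a l" using assms(1,2) by (metis coprime_commute prime_imp_coprime)
  moreover obtain i m where "i * a + m * l = gcd a l" using bezout_int by blast
  ultimately have im: "i * a + m * l = 1" by simp
  have "QuadRes l (i * i)" unfolding QuadRes_iff by (intro exI[of _ i]) simp
  hence q: "QuadRes l (i * i * (a * (a * b)))" by (rule QuadRes_mult[OF _ QuadRes_mult[OF assms(3,4)]])
  have "i * a = 1 - m * l" using im by simp
  have "i * i * (a * (a * b)) - b = (i * a) * (i * a) * b - b" by (simp only: mult_ac)
  also have "\<dots> = l * (m * b * (m * l - 2))" unfolding \<open>i * a = 1 - m * l\<close> by (simp add: algebra_simps)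
  finally have "l dvd i * i * (a * (a * b)) - b" by simp
  thus ?thesis using q by (rule QuadRes_cong)
qed

lemma gauss_prime_ii_square:
  assumes "gauss_prime \<rho> l" "gauss_dvd \<rho> (\<i> - of_int j)" shows "int l dvd j * j + 1"
proof -
  have "gauss_dvd \<rho> ((\<i> - of_int j) * (- (\<i> + of_int j)))"
    by (rule gauss_dvd_mult[OF assms(2)]) (intro gauss_int_intros)
  moreover have "(\<i> - of_int j) * (- (\<i> + of_int j)) = of_int (j * j + 1)" by (simp add: algebra_simps)
  ultimately show ?thesis using gauss_prime_dvd_of_int[OF assms(1), of "j * j + 1"] by simp
qed

text \<open>The residue map of \<rho> sends \<i> to j, so a square modulo \<rho> becomes a square
  modulo the rational prime l.\<close>

lemma gauss_prime_QuadRes: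
  assumes "gauss_prime \<rho> l" "gauss_dvd \<rho> (\<i> - of_int j)"
    and ex: "\<exists>z\<in>gauss_int. gauss_dvd \<rho> (z * z - (of_int a + of_int b * \<i>))"
  shows "QuadRes l (a + b * j)"
proof -
  obtain z where z: "z \<in> gauss_int" "gauss_dvd \<rho> (z * z - (of_int a + of_int b * \<i>))" using ex by blast
  obtain t where t: "gauss_dvd \<rho> (z - of_int t)" using gauss_prime_residue[OF assms(2) z(1)] .
  have "gauss_dvd \<rho> (z * z - (of_int a + of_int b * \<i>) + (\<i> - of_int j) * of_int b - (z - of_int t) * (z + of_int t))"
    by (rule gauss_dvd_diff[OF gauss_dvd_add[OF z(2) gauss_dvd_mult[OF assms(2)]] gauss_dvd_mult[OF t]])
       (intro gauss_int_intros z(1))+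
  moreover have "z * z - (of_int a + of_int b * \<i>) + (\<i> - of_int j) * of_int b - (z - of_int t) * (z + of_int t)
      = of_int (t * t - (a + b * j))" by (simp add: algebra_simps)
  ultimately have "int l dvd t * t - (a + b * j)" using gauss_prime_dvd_of_int[OF assms(1)] by metis
  thus ?thesis unfolding QuadRes_iff by blast
qed

text \<open>(1 + j)^2 = 2 j when j^2 = -1, so j and 2 have the same quadratic character modulo an
  odd prime. This is how questions about \<i> become questions about 2.\<close>

lemma QuadRes_two_times_root:
  assumes "l dvd j * j + 1" shows "QuadRes l (2 * j)" "QuadRes l (-1)"
proof -
  have "(1 + j) * (1 + j) - 2 * j = j * j + 1" by (simp add: algebra_simps)
  thus "QuadRes l (2 * j)" unfolding QuadRes_iff using assms by metis
  show "QuadRes l (-1)" unfolding QuadRes_iff using assms by (intro exI[of _ j]) simp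
qed

lemma nat_square_even_exponent:
  fixes l n m :: nat
  assumes "prime l" "\<not> l dvd n" "l ^ b * n = m * m" shows "even b"
  using assms(3)
proof (induction b arbitrary: m rule: less_induct)
  case (less b)
  show ?case
  proof (cases "b < 2")
    case True
    moreover have "b \<noteq> 1" using nat_odd_exponent_nonsquare[OF assms(1,2)] less.prems by auto
    ultimately have "b = 0" by simp
    thus ?thesis by simp
  next
    case False
    define c where "c = b - 2"
    have b: "b = Suc (Suc c)" using False by (simp add: c_def)
    have l0: "l > 0" using assms(1) by (rule prime_gt_0_nat)
    have eq: "l * (l * (l ^ c * n)) = m * m" using less.prems by (simp add: b mult_ac)
    have "l dvd m * m" unfolding eq[symmetric] by (rule dvd_triv_left)
    hence "l dvd m" using assms(1) by (simp add: prime_dvd_mult_iff)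
    then obtain k where k: "m = l * k" by (elim dvdE)
    have "l * (l * (l ^ c * n)) = l * (l * (k * k))" using eq unfolding k by (simp only: mult_ac)
    hence "l ^ c * n = k * k" using l0 by simp
    hence "even c" by (rule less.IH[rotated]) (simp add: b)
    thus ?thesis by (simp add: b)
  qed
qed

section \<open>Trivial square classes from the negative Pell equation\<close>

context gauss_ext
begin

text \<open>Formally, the square of sqrt(x + \<i>) + sqrt(x - \<i>) is 2 \<epsilon> with the unit
  \<epsilon> = x + y s. Multiplying that sum by sqrt(x + \<i>) gives z = x + \<i> + y s, so z^2 = 2
  (x + \<i>) \<epsilon>, and the factor 2 is absorbed by (1 + \<i>)^2 = 2 \<i>.\<close>

lemma negative_pell_square:
  assumes "x * x + 1 = d * (y * y)"
  shows "sq_equiv M (of_nat x + \<i>) 1"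
proof -
  have eq: "complex_of_nat x * of_nat x + 1 = of_nat d * (of_nat y * of_nat y)"
    using arg_cong[OF assms, of complex_of_nat] by (simp only: of_nat_add of_nat_mult of_nat_1)
  define \<epsilon> where "\<epsilon> = of_nat x + of_nat y * s"
  define \<epsilon>' where "\<epsilon>' = of_nat y * s - of_nat x"
  have sM: "s \<in> M" by (rule gen_in_adj)
  have iM: "\<i> \<in> M" by (rule M_int) simp
  have "\<epsilon> * \<epsilon>' = of_nat y * of_nat y * (s * s) - of_nat x * of_nat x"
    by (simp add: \<epsilon>_def \<epsilon>'_def algebra_simps)
  also have "\<dots> = 1" unfolding s_square using eq by (simp add: algebra_simps)
  finally have ee: "\<epsilon> * \<epsilon>' = 1" .
  have sA: "alg_int s" by (rule alg_int_sqrtD) (simp add: s_square)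
  have unit: "unit_of M (- \<i> * \<epsilon>)"
  proof -
    have "(- \<i> * \<epsilon>) * (\<i> * \<epsilon>') = - (\<i> * \<i>) * (\<epsilon> * \<epsilon>')" by (simp add: algebra_simps)
    hence "(- \<i> * \<epsilon>) * (\<i> * \<epsilon>') = 1" unfolding ee by simp
    hence inv: "inverse (- \<i> * \<epsilon>) = \<i> * \<epsilon>'" by (rule inverse_unique)
    have "\<epsilon> \<noteq> 0" using ee by auto
    moreover have "- \<i> * \<epsilon> \<in> M" unfolding \<epsilon>_def using sM iM by (intro M_closed)
    moreover have "alg_int (- \<i> * \<epsilon>)" unfolding \<epsilon>_def
      by (rule alg_int_mult[OF alg_int_minus[OF alg_int_ii] alg_int_add[OF alg_int_of_nat alg_int_mult[OF alg_int_of_nat sA]]])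
    moreover have "alg_int (\<i> * \<epsilon>')" unfolding \<epsilon>'_def
      by (rule alg_int_mult[OF alg_int_ii alg_int_diff[OF alg_int_mult[OF alg_int_of_nat sA] alg_int_of_nat]])
    ultimately show ?thesis unfolding unit_of_def inv by simp
  qed
  define z where "z = of_nat x + \<i> + of_nat y * s"
  have "z * z = of_nat x * of_nat x - 1 + of_nat y * of_nat y * (s * s) + 2 * \<i> * of_nat x
      + 2 * (of_nat x + \<i>) * of_nat y * s"
    by (simp add: z_def algebra_simps)
  also have "\<dots> = 2 * ((of_nat x + \<i>) * \<epsilon>)"
    unfolding s_square using eq by (simp add: \<epsilon>_def algebra_simps)
  finally have zz: "z * z = 2 * ((of_nat x + \<i>) * \<epsilon>)" .
  have x0: "of_nat x + \<i> \<noteq> 0" by (simp add: complex_eq_iff)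
  have e0: "\<epsilon> \<noteq> 0" using ee by auto
  have z0: "z \<noteq> 0" using zz x0 e0 by auto
  have l2: "(1 + \<i>) * (1 + \<i>) = 2 * \<i>" by (simp add: algebra_simps)
  show ?thesis
  proof (rule sq_equivI[OF unit])
    show "z / (1 + \<i>) \<in> M" unfolding z_def using sM iM by (intro M_closed)
    have "1 + \<i> \<noteq> 0" by (simp add: complex_eq_iff)
    thus "z / (1 + \<i>) \<noteq> 0" using z0 by simp
    have "1 * (z / (1 + \<i>) * (z / (1 + \<i>))) = (z * z) / ((1 + \<i>) * (1 + \<i>))" by simp
    also have "\<dots> = (of_nat x + \<i>) * (- \<i> * \<epsilon>)" unfolding zz l2 by (simp add: field_simps)
    finally show "(of_nat x + \<i>) * (- \<i> * \<epsilon>) = 1 * (z / (1 + \<i>) * (z / (1 + \<i>)))" by simp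
  qed
qed

text \<open>The square-free part r of x + \<i> has norm d up to squares. This relation, recorded by
  \<open>t\<close>, keeps r from being a unit and will pin down its prime factors.\<close>

lemma negative_pell_radical:
  assumes "x * x + 1 = d * (y * y)"
  shows "\<exists>r t. gauss_radical r \<and> sq_equiv M r 1 \<and> gauss_dvd r (of_nat (4 * d * d)) \<and>
     t \<in> gauss_rat \<and> of_nat d * (r * cnj r) = t * t"
proof -
  define z where "z = of_nat x + \<i>"
  have zI: "z \<in> gauss_int" unfolding z_def by (intro gauss_int_intros)
  have z0: "z \<noteq> 0" by (simp add: z_def complex_eq_iff)
  obtain r c where rc: "gauss_radical r" "c \<in> gauss_rat" "c \<noteq> 0" "z = r * (c * c)"
    using gauss_radical_kernel[OF gauss_int_rat[OF zI] z0] .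
  have "sq_equiv M z r" unfolding rc(4)
    by (rule sq_equiv_square[OF adj_subfield base_subset[OF rc(2)] rc(3)])
  moreover have "sq_equiv M z 1" unfolding z_def by (rule negative_pell_square[OF assms])
  ultimately have r1: "sq_equiv M r 1"
    using sq_equiv_trans[OF adj_subfield sq_equiv_sym[OF adj_subfield]] by blast
  have "gauss_dvd r (of_nat (4 * d * d))"
    by (rule radical_divides_disc[OF rc(1) square_gen_ring[OF R_subring] sq_equiv_sym[OF adj_subfield r1]])
  moreover define t where "t = of_nat d * of_nat y / (c * cnj c)"
  have "t \<in> gauss_rat" unfolding t_def
    by (intro subfield_divide subfield_mult subfield_of_nat gauss_rat_subfield rc gauss_rat_cnj)
  moreover have "of_nat d * (r * cnj r) = t * t"
  proof -
    have "z * cnj z = of_nat (x * x + 1)" by (simp add: z_def algebra_simps)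
    hence "(r * cnj r) * ((c * cnj c) * (c * cnj c)) = of_nat d * (of_nat y * of_nat y)"
      unfolding assms rc(4) by (simp add: mult_ac)
    moreover have "c * cnj c \<noteq> 0" using rc(3) by simp
    ultimately show ?thesis by (simp add: t_def field_simps)
  qed
  ultimately show ?thesis using rc(1) r1 by blast
qed

end

section \<open>The fields of the theorem\<close>

text \<open>The residue hypotheses say that no two of the three symbols equal 1. Together with
  \<open>recip\<close> they are symmetric in the two primes, so \<open>swap\<close> turns every
  result about adjoining sqrt p into one about sqrt q.\<close>

locale two_primes =
  fixes p q :: nat and e f g h :: int
  assumes p: "prime p" "p mod 4 = 1" and q: "prime q" "q mod 4 = 1" and pq: "p \<noteq> q"
    and recip: "QuadRes p q \<longleftrightarrow> QuadRes q p"
    and res1: "\<not> (QuadRes q p \<and> QuadRes p 2)" and res2: "\<not> (QuadRes q p \<and> QuadRes q 2)"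
    and res3: "\<not> (QuadRes p 2 \<and> QuadRes q 2)"
    and ef: "int p = e ^ 2 + 4 * f ^ 2" and gh: "int q = g ^ 2 + 4 * h ^ 2"
begin

lemma swap: "two_primes q p g h e f"
  by unfold_locales (use p q pq recip res1 res2 res3 ef gh in auto)

text \<open>\<open>Q\<close> carries the factor 2 so that \<open>D = P * Q\<close>; thus
  \<open>k\<close>, \<open>M1\<close> and \<open>M2\<close> are the three intermediate fields of
  \<open>K\<close> over \<open>gauss_rat\<close>.\<close>

definition "P = complex_of_real (sqrt (real p))"
definition "Q = complex_of_real (sqrt (real (2 * q)))"
definition "D = complex_of_real (sqrt (real (2 * p * q)))"
definition "\<pi> = complex_of_int e + 2 * \<i> * of_int f"
definition "\<xi> = complex_of_int g + 2 * \<i> * of_int h"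
definition "\<pi>' = complex_of_int e - 2 * \<i> * of_int f"
definition "\<xi>' = complex_of_int g - 2 * \<i> * of_int h"
definition "lam = 1 + \<i>"

lemma ge5: "p \<ge> 5" "q \<ge> 5"
proof -
  have "l \<ge> 5" if "prime l" "l mod 4 = 1" for l :: nat
  proof (rule ccontr)
    assume "\<not> l \<ge> 5"
    hence "l < 5" by simp
    hence "l = 0 \<or> l = 1 \<or> l = 2 \<or> l = 3 \<or> l = 4" by linarith
    thus False using that by auto
  qed
  thus "p \<ge> 5" "q \<ge> 5" using p q by auto
qed

lemma ndvd: "\<not> p dvd 2" "\<not> q dvd 2" "\<not> 2 dvd p" "\<not> 2 dvd q" "\<not> p dvd q" "\<not> q dvd p"
proof -
  show "\<not> p dvd 2" "\<not> q dvd 2" using ge5 dvd_imp_le[of p 2] dvd_imp_le[of q 2] by auto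
  show "\<not> 2 dvd p" "\<not> 2 dvd q" using p(2) q(2) by presburger+
  show "\<not> p dvd q" "\<not> q dvd p" using primes_dvd_imp_eq p q pq by metis+
qed

lemma square_exponents:
  assumes "2 ^ a * p ^ b * q ^ c = m * m"
  shows "even a" "even b" "even c"
proof -
  have pr: "prime (2 :: nat)" by (rule two_is_prime_nat)
  have pw: "\<not> l dvd x ^ n * y ^ k" if "prime l" "\<not> l dvd x" "\<not> l dvd y" for l x y n k :: nat
    using that by (auto simp: prime_dvd_mult_iff dest: prime_dvd_power)
  show "even a"
    by (rule nat_square_even_exponent[OF pr pw[OF pr ndvd(3,4)]]) (use assms in \<open>simp only: mult_ac\<close>)
  show "even b"
    by (rule nat_square_even_exponent[OF p(1) pw[OF p(1) ndvd(1,5)]]) (use assms in \<open>simp only: mult_ac\<close>)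
  show "even c"
    by (rule nat_square_even_exponent[OF q(1) pw[OF q(1) ndvd(2,6)]]) (use assms in \<open>simp only: mult_ac\<close>)
qed

lemma nonsq: "2 * p * q \<noteq> m * m" "p \<noteq> m * m" "2 * q \<noteq> m * m" "2 * p \<noteq> m * m"
proof -
  show "2 * p * q \<noteq> m * m" using square_exponents[of 1 1 1 m] by auto
  show "p \<noteq> m * m" using square_exponents[of 0 1 0 m] by auto
  show "2 * q \<noteq> m * m" using square_exponents[of 1 0 1 m] by auto
  show "2 * p \<noteq> m * m" using square_exponents[of 1 1 0 m] by auto
qed

sublocale gk: gauss_ext "2 * p * q" D
  by unfold_locales (use nonsq(1) in \<open>simp_all add: D_def\<close>)

sublocale g1: gauss_ext p P
  by unfold_locales (use nonsq(2) in \<open>simp_all add: P_def\<close>)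

sublocale g2: gauss_ext "2 * q" Q
  by unfold_locales (use nonsq(3) in \<open>simp_all add: Q_def\<close>)

abbreviation "k \<equiv> adj gauss_rat D"
abbreviation "M1 \<equiv> adj gauss_rat P"
abbreviation "M2 \<equiv> adj gauss_rat Q"
definition "K = adj k P"

lemma D_eq: "D = P * Q"
proof -
  have "sqrt (real (2 * p * q)) = sqrt (real p) * sqrt (real (2 * q))"
    by (simp add: real_sqrt_mult mult_ac)
  thus ?thesis by (simp only: D_def P_def Q_def of_real_mult)
qed

lemma square_in_k:
  assumes "of_nat n = z * z" "z \<in> k"
  shows "\<exists>m :: nat. n = m * m \<or> n * (2 * p * q) = m * m"
proof -
  have "of_nat n \<in> gauss_rat" by (rule subfield_of_nat[OF gauss_rat_subfield])
  from gk.square_in_adjD[OF this assms(2,1)]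
  obtain y where y: "y \<in> gauss_rat" "of_nat n = y * y \<or> of_nat n * (D * D) = y * y" by blast
  hence "of_nat n = y * y \<or> of_nat (n * (2 * p * q)) = y * y" by (simp add: gk.s_square)
  thus ?thesis using nat_square_gauss_rat[OF _ y(1)] by blast
qed

sublocale gK: quad_ext k P
proof
  show "is_subfield k" by (rule gk.adj_subfield)
  show "P * P \<in> k" unfolding g1.s_square by (rule subfield_of_nat[OF gk.adj_subfield])
  show "P \<notin> k"
  proof
    assume "P \<in> k"
    then obtain m :: nat where "p = m * m \<or> p * (2 * p * q) = m * m"
      using square_in_k[OF g1.s_square[symmetric]] by blast
    thus False using nonsq(2)[of m] square_exponents[of 1 2 1 m] by (auto simp: power2_eq_square mult_ac)
  qed
qed

lemma square_in_K:
  assumes "of_nat n = z * z" "z \<in> K"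
  shows "\<exists>m :: nat. n = m * m \<or> n * (2 * p * q) = m * m \<or> n * p = m * m \<or> n * p * (2 * p * q) = m * m"
proof -
  have "of_nat n \<in> k" by (rule subfield_of_nat[OF gk.adj_subfield])
  from gK.square_in_adjD[OF this assms(2)[unfolded K_def] assms(1)]
  obtain y where y: "y \<in> k" "of_nat n = y * y \<or> of_nat n * (P * P) = y * y" by blast
  hence "of_nat n = y * y \<or> of_nat (n * p) = y * y" by (simp add: g1.s_square)
  thus ?thesis using square_in_k[OF _ y(1)] by blast
qed

lemma K_subfield: "is_subfield K" unfolding K_def by (rule gK.adj_subfield)

lemma k_K: "x \<in> k \<Longrightarrow> x \<in> K" unfolding K_def by (rule gK.base_subset)

lemma \<pi>': "\<pi>' = cnj \<pi>" and \<xi>': "\<xi>' = cnj \<xi>"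
  by (simp_all add: \<pi>_def \<pi>'_def \<xi>_def \<xi>'_def)

lemma gauss_prime_\<pi>: "gauss_prime \<pi> p" and gauss_prime_\<xi>: "gauss_prime \<xi> q"
  and gauss_prime_lam: "gauss_prime lam 2"
proof -
  have "gauss_prime (of_int a + 2 * \<i> * of_int b) l" if "int l = a ^ 2 + 4 * b ^ 2" "prime l" for a b l
  proof -
    have "complex_of_int a + 2 * \<i> * of_int b \<in> gauss_int" by (intro gauss_int_intros)
    moreover have "(complex_of_int a + 2 * \<i> * of_int b) * cnj (of_int a + 2 * \<i> * of_int b) = of_int (a ^ 2 + 4 * b ^ 2)"
      by (simp add: power2_eq_square algebra_simps)
    ultimately show ?thesis using that(2) unfolding gauss_prime_def that(1)[symmetric] by simp
  qed
  thus "gauss_prime \<pi> p" "gauss_prime \<xi> q" using ef gh p q by (simp_all add: \<pi>_def \<xi>_def)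
  show "gauss_prime lam 2" unfolding gauss_prime_def lam_def
    by (auto intro!: gauss_int_intros simp: algebra_simps)
qed

lemma gauss_prime_\<pi>': "gauss_prime \<pi>' p" and gauss_prime_\<xi>': "gauss_prime \<xi>' q"
  unfolding \<pi>' \<xi>' by (rule gauss_prime_cnj[OF gauss_prime_\<pi>], rule gauss_prime_cnj[OF gauss_prime_\<xi>])

lemma ints: "\<pi> \<in> gauss_int" "\<pi>' \<in> gauss_int" "\<xi> \<in> gauss_int" "\<xi>' \<in> gauss_int" "lam \<in> gauss_int"
  using gauss_prime_\<pi> gauss_prime_\<pi>' gauss_prime_\<xi> gauss_prime_\<xi>' gauss_prime_lam
  by (simp_all add: gauss_prime_def)

lemma nonzeros: "\<pi> \<noteq> 0" "\<pi>' \<noteq> 0" "\<xi> \<noteq> 0" "\<xi>' \<noteq> 0" "lam \<noteq> 0"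
  using gauss_prime_nonzero gauss_prime_\<pi> gauss_prime_\<pi>' gauss_prime_\<xi> gauss_prime_\<xi>' gauss_prime_lam
  by blast+

lemma norms: "\<pi> * \<pi>' = of_nat p" "\<xi> * \<xi>' = of_nat q" "lam * cnj lam = 2" "lam * lam = 2 * \<i>"
  using gauss_prime_\<pi> gauss_prime_\<xi> gauss_prime_lam
  by (simp_all add: gauss_prime_def \<pi>' \<xi>' lam_def algebra_simps)

text \<open>The norm equation makes \<i> a square modulo \<rho>, that is, j a residue modulo l; as 2
  j is always a residue, so is 2.\<close>

lemma residue_ii:
  assumes "gauss_prime \<rho> l" "l \<in> {p, q}" "z \<in> k" "m \<in> gauss_rat" "m \<noteq> 0" "z * gk.\<tau> z = \<i> * (m * m)"
    and D': "of_nat (2 * p * q) = \<rho> * D'" "D' \<in> gauss_int" "\<not> gauss_dvd \<rho> D'"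
  shows "QuadRes l 2"
proof -
  obtain X Y where XY: "X \<in> gauss_rat" "Y \<in> gauss_rat" "z = X + Y * D" "gk.\<tau> z = X - Y * D"
    using assms(3) by (rule gk.adjE)
  have "z * gk.\<tau> z = X * X - (D * D) * (Y * Y)" unfolding XY(4) unfolding XY(3) by (simp add: algebra_simps)
  hence "X * X - \<i> * (m * m) = \<rho> * D' * (Y * Y)" unfolding assms(6) gk.s_square D'(1) by (simp add: algebra_simps)
  from norm_form_residue_rat[OF assms(1) D'(2,3) gauss_int_ii XY(1,2) assms(4,5) this]
  have ex: "\<exists>w\<in>gauss_int. gauss_dvd \<rho> (w * w - (of_int 0 + of_int 1 * \<i>))" by simp
  obtain j where j: "gauss_dvd \<rho> (\<i> - of_int j)" using gauss_prime_residue_ii[OF assms(1)] .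
  have "QuadRes l (0 + 1 * j)" by (rule gauss_prime_QuadRes[OF assms(1) j ex])
  hence qj: "QuadRes l j" by simp
  have jj: "int l dvd j * j + 1" by (rule gauss_prime_ii_square[OF assms(1) j])
  have pl: "prime (int l)" using assms(1) by (simp add: gauss_prime_def)
  have "\<not> int l dvd j"
  proof
    assume "int l dvd j"
    hence "int l dvd (j * j + 1) - j * j" by (intro dvd_diff jj dvd_mult)
    thus False using pl by (simp add: prime_int_iff)
  qed
  moreover have "QuadRes l (j * 2)" using QuadRes_two_times_root(1)[OF jj] by (simp add: mult.commute)
  ultimately show ?thesis using QuadRes_cancel[OF pl _ qj] by blast
qed

text \<open>Conjugate primes above an odd l are coprime: a common one would divide \<rho> + cnj
  \<rho> = 2 a, so l would divide a and b, and l^2 would divide l.\<close>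

lemma not_dvd_cofactor:
  "\<not> gauss_dvd \<pi> (of_nat (2 * q) * \<pi>')" "\<not> gauss_dvd \<xi> (of_nat (2 * p) * \<xi>')"
proof -
  have *: "\<not> gauss_dvd \<rho> (of_nat n * cnj \<rho>)"
    if \<rho>: "gauss_prime \<rho> l" "\<rho> = of_int a + 2 * \<i> * of_int b" "int l = a ^ 2 + 4 * b ^ 2" "\<not> l dvd n" "\<not> l dvd 2"
    for \<rho> l n a b
  proof
    assume "gauss_dvd \<rho> (of_nat n * cnj \<rho>)"
    hence "gauss_dvd \<rho> (of_nat n) \<or> gauss_dvd \<rho> (cnj \<rho>)"
      using gauss_prime_dvd_mult[OF \<rho>(1)] \<rho>(1) by (simp add: gauss_prime_def gauss_int_cnj)
    thus False
    proof
      assume "gauss_dvd \<rho> (of_nat n)"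
      hence "int l dvd int n" using gauss_prime_dvd_of_int[OF \<rho>(1), of "int n"] by simp
      thus False using \<rho>(4) by simp
    next
      assume "gauss_dvd \<rho> (cnj \<rho>)"
      hence "gauss_dvd \<rho> (\<rho> + cnj \<rho>)" by (rule gauss_dvd_add[OF gauss_dvd_refl])
      moreover have "\<rho> + cnj \<rho> = of_int (2 * a)" by (simp add: \<rho>(2))
      ultimately have "int l dvd 2 * a" using gauss_prime_dvd_of_int[OF \<rho>(1)] by metis
      moreover have pl: "prime (int l)" using \<rho>(1) by (simp add: gauss_prime_def)
      moreover have "\<not> int l dvd 2" using \<rho>(5) by (metis of_nat_dvd_iff of_nat_numeral)
      ultimately have la: "int l dvd a" by (simp add: prime_dvd_mult_iff)
      have "int l dvd int l - a * a" by (intro dvd_diff dvd_mult la) simp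
      hence "int l dvd 2 * 2 * (b * b)" using \<rho>(3) by (simp add: power2_eq_square)
      hence lb: "int l dvd b" unfolding prime_dvd_mult_iff[OF pl] using \<open>\<not> int l dvd 2\<close> by (simp only: simp_thms)
      obtain a' b' where ab: "a = int l * a'" "b = int l * b'" using la lb by (elim dvdE)
      have "(int l * a') ^ 2 + 4 * (int l * b') ^ 2 = int l * (int l * (a' * a' + 4 * (b' * b')))"
        by (simp add: power2_eq_square algebra_simps)
      with \<rho>(3) have "int l * 1 = int l * (int l * (a' * a' + 4 * (b' * b')))"
        unfolding ab mult_1_right by (rule trans)
      moreover have "int l \<noteq> 0" using pl by auto
      ultimately have "1 = int l * (a' * a' + 4 * (b' * b'))" by (simp only: mult_cancel_left simp_thms)
      hence "int l dvd 1" by (metis dvd_triv_left)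
      thus False using pl by (simp add: prime_int_iff)
    qed
  qed
  have "\<not> p dvd 2 * q" "\<not> q dvd 2 * p" using ndvd p q by (simp_all add: prime_dvd_mult_iff)
  thus "\<not> gauss_dvd \<pi> (of_nat (2 * q) * \<pi>')" "\<not> gauss_dvd \<xi> (of_nat (2 * p) * \<xi>')"
    unfolding \<pi>' \<xi>'
    using *[OF gauss_prime_\<pi> \<pi>_def ef _ ndvd(1)] *[OF gauss_prime_\<xi> \<xi>_def gh _ ndvd(2)] by blast+
qed

lemma cofactor:
  "of_nat (2 * p * q) = \<pi> * (of_nat (2 * q) * \<pi>')" "of_nat (2 * p * q) = \<xi> * (of_nat (2 * p) * \<xi>')"
  "of_nat (2 * q) * \<pi>' \<in> gauss_int" "of_nat (2 * p) * \<xi>' \<in> gauss_int"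
proof -
  have "of_nat (2 * p * q) = of_nat (2 * q) * (\<pi> * \<pi>')" unfolding norms(1) by simp
  also have "\<dots> = \<pi> * (of_nat (2 * q) * \<pi>')" by (simp only: mult_ac)
  finally show "of_nat (2 * p * q) = \<pi> * (of_nat (2 * q) * \<pi>')" .
  have "of_nat (2 * p * q) = of_nat (2 * p) * (\<xi> * \<xi>')" unfolding norms(2) by simp
  also have "\<dots> = \<xi> * (of_nat (2 * p) * \<xi>')" by (simp only: mult_ac)
  finally show "of_nat (2 * p * q) = \<xi> * (of_nat (2 * p) * \<xi>')" .
qed (intro gauss_int_mult gauss_int_of_nat ints)+

text \<open>Reduction at \<pi> and at \<xi> would make 2 a residue modulo both primes, which
  \<open>res3\<close> forbids.\<close>

lemma ii_not_norm:
  assumes "z \<in> k" "m \<in> gauss_rat" "m \<noteq> 0" "\<nu> \<in> {\<i>, -\<i>}"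
  shows "z * gk.\<tau> z \<noteq> \<nu> * (m * m)"
proof
  assume eq: "z * gk.\<tau> z = \<nu> * (m * m)"
  obtain m' where m': "m' \<in> gauss_rat" "m' \<noteq> 0" "z * gk.\<tau> z = \<i> * (m' * m')"
  proof (cases "\<nu> = \<i>")
    case True
    thus ?thesis using that[of m] assms eq by simp
  next
    case False
    \<comment> \<open>- \<i> m^2 = \<i> (\<i> m)^2 reduces the second unit to the first.\<close>
    hence "z * gk.\<tau> z = \<i> * ((\<i> * m) * (\<i> * m))" using assms(4) eq by (simp add: algebra_simps)
    thus ?thesis using that[of "\<i> * m"] assms subfield_mult[OF gauss_rat_subfield gauss_rat_ii] by simp
  qed
  have "QuadRes p 2"
    by (rule residue_ii[OF gauss_prime_\<pi> _ assms(1) m' cofactor(1,3) not_dvd_cofactor(1)]) simp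
  moreover have "QuadRes q 2"
    by (rule residue_ii[OF gauss_prime_\<xi> _ assms(1) m' cofactor(2,4) not_dvd_cofactor(2)]) simp
  ultimately show False using res3 by simp
qed

lemma prime_ints: "prime (int p)" "prime (int q)" using p q by simp_all

lemma not_dvd_int: "\<not> int p dvd int q" "\<not> int q dvd int p" "\<not> int p dvd 2" "\<not> int q dvd 2"
  using ndvd by (simp_all, metis of_nat_dvd_iff of_nat_numeral, metis of_nat_dvd_iff of_nat_numeral)

text \<open>From p u = c^2 the norm of c is a unit times p; up to replacing c by \<i> c this reads
  X^2 - 2 p q Y^2 = \<i>^b p with b = 0 or 1. Reducing at \<xi>, and at \<pi> after dividing by p,
  gives two residue conditions that together contradict \<open>res1\<close> for b = 0 and
  \<open>res2\<close> for b = 1.\<close>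

lemma p_not_square_unit: "\<not> sq_equiv k (of_nat p) 1"
proof
  assume "sq_equiv k (of_nat p) 1"
  then obtain u c where u: "unit_of k u" "c \<in> k" "c \<noteq> 0" "of_nat p * u = c * c"
    unfolding sq_equiv_def by auto
  have uM: "u \<in> k" using u(1) by (simp add: unit_of_def)
  have p0: "complex_of_nat p \<noteq> 0" using ge5 by simp
  have pM: "of_nat p \<in> k" by (rule subfield_of_nat[OF gk.adj_subfield])
  define n where "n = c * gk.\<tau> c / of_nat p"
  have "(c * gk.\<tau> c) * (c * gk.\<tau> c) = (c * c) * (gk.\<tau> c * gk.\<tau> c)" by (simp only: mult_ac)
  also have "gk.\<tau> c * gk.\<tau> c = of_nat p * gk.\<tau> u"
    unfolding gk.qconj_mult[OF u(2,2), symmetric] u(4)[symmetric] gk.qconj_mult[OF pM uM] by simp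
  finally have nn: "n * n = u * gk.\<tau> u" using p0 by (simp add: n_def u(4)[symmetric] mult_ac)
  define \<nu> where "\<nu> = u * gk.\<tau> u"
  have \<nu>: "\<nu> \<in> {1, -1, \<i>, -\<i>}" unfolding \<nu>_def by (rule gk.norm_unit[OF u(1)])
  have nQ: "n \<in> gauss_rat" unfolding n_def
    by (rule subfield_divide[OF gauss_rat_subfield gk.norm_in_base[OF u(2)] subfield_of_nat[OF gauss_rat_subfield]])
  have "\<nu> \<in> gauss_int" using \<nu> by (auto intro: gauss_int_intros)
  have nI: "n \<in> gauss_int"
    by (rule gauss_int_sqrtD[OF nQ]) (use \<open>\<nu> \<in> gauss_int\<close> nn in \<open>simp add: \<nu>_def\<close>)
  have "n * (n * cnj \<nu>) = (n * n) * cnj \<nu>" by (simp only: mult.assoc)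
  also have "\<dots> = \<nu> * cnj \<nu>" by (simp only: nn \<nu>_def)
  also have "\<dots> = 1" using \<nu> by auto
  finally have "n * (n * cnj \<nu>) = 1" .
  hence n: "n \<in> {1, -1, \<i>, -\<i>}"
    by (rule gauss_unit_cases[OF nI gauss_int_mult[OF nI gauss_int_cnj[OF \<open>\<nu> \<in> gauss_int\<close>]]])
  have cn: "c * gk.\<tau> c = n * of_nat p" using p0 by (simp add: n_def)
  \<comment> \<open>\<tau> fixes \<i>, so multiplying c by \<i> changes the sign of its norm; this
    reduces n to 1 or \<i>.\<close>
  obtain c' b where c': "c' \<in> k" "b = 0 \<or> b = (1 :: nat)" "c' * gk.\<tau> c' = \<i> ^ b * of_nat p"
  proof (cases "n \<in> {1, \<i>}")
    case True
    thus ?thesis using that[of c 0] that[of c 1] u(2) cn by auto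
  next
    case False
    have iI: "\<i> \<in> gauss_int" by simp
    have ic: "\<i> * c \<in> k" by (rule gk.adj_mult[OF gk.M_int[OF iI] u(2)])
    have "(\<i> * c) * gk.\<tau> (\<i> * c) = - (c * gk.\<tau> c)"
      unfolding gk.qconj_mult[OF gk.M_int[OF iI] u(2)] by (simp add: algebra_simps)
    hence "(\<i> * c) * gk.\<tau> (\<i> * c) = - n * of_nat p" unfolding cn by simp
    thus ?thesis using that[of "\<i> * c" 0] that[of "\<i> * c" 1] ic False n by auto
  qed
  define M where "M = \<i> ^ b * of_nat p"
  obtain X Y where XY: "X \<in> gauss_rat" "Y \<in> gauss_rat" "c' = X + Y * D" "gk.\<tau> c' = X - Y * D"
    using c'(1) by (rule gk.adjE)
  have "c' * gk.\<tau> c' = X * X - (D * D) * (Y * Y)" unfolding XY(4) unfolding XY(3) by (simp add: algebra_simps)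
  hence eq: "X * X - of_nat (2 * p * q) * (Y * Y) = M" unfolding gk.s_square M_def c'(3) by simp
  have MI: "M \<in> gauss_int" unfolding M_def by (intro gauss_int_intros)
  have one: "1 \<in> gauss_rat" by (rule subfield_1[OF gauss_rat_subfield])
  have eq1: "X * X - M * (1 * 1) = \<xi> * (of_nat (2 * p) * \<xi>') * (Y * Y)"
    using eq unfolding cofactor(2) by (simp add: algebra_simps)
  have ex1: "\<exists>z\<in>gauss_int. gauss_dvd \<xi> (z * z - M)"
    by (rule norm_form_residue_rat[OF gauss_prime_\<xi> cofactor(4) not_dvd_cofactor(2) MI XY(1,2) one _ eq1]) simp
  \<comment> \<open>Dividing the equation by p and multiplying by 2 q shows that (2 q Y)^2 + 2 q
    \<i>^b is 2 p q times the square of X / p, again a norm form.\<close>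
  define M' where "M' = - (of_nat (2 * q) * \<i> ^ b)"
  have M'I: "M' \<in> gauss_int" unfolding M'_def by (intro gauss_int_intros)
  have "X * X = of_nat p * (\<i> ^ b + of_nat (2 * q) * (Y * Y))"
    using eq by (simp add: M_def algebra_simps)
  hence eqX: "(X / of_nat p) * (X / of_nat p) * of_nat p = \<i> ^ b + of_nat (2 * q) * (Y * Y)"
    using p0 by (simp add: field_simps)
  have eq2: "(of_nat (2 * q) * Y) * (of_nat (2 * q) * Y) - M' * (1 * 1)
     = \<pi> * (of_nat (2 * q) * \<pi>') * ((X / of_nat p) * (X / of_nat p))"
  proof -
    have "\<pi> * (of_nat (2 * q) * \<pi>') * ((X / of_nat p) * (X / of_nat p))
        = of_nat (2 * q) * ((X / of_nat p) * (X / of_nat p) * (\<pi> * \<pi>'))" by (simp only: mult_ac)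
    also have "\<dots> = of_nat (2 * q) * (\<i> ^ b + of_nat (2 * q) * (Y * Y))" unfolding norms(1) eqX ..
    finally show ?thesis by (simp add: M'_def algebra_simps)
  qed
  have QY: "of_nat (2 * q) * Y \<in> gauss_rat" "X / of_nat p \<in> gauss_rat"
    by (intro subfield_mult subfield_divide subfield_of_nat gauss_rat_subfield XY)+
  have ex2: "\<exists>z\<in>gauss_int. gauss_dvd \<pi> (z * z - M')"
    by (rule norm_form_residue_rat[OF gauss_prime_\<pi> cofactor(3) not_dvd_cofactor(1) M'I QY one _ eq2]) simp
  obtain j where j: "gauss_dvd \<pi> (\<i> - of_int j)" using gauss_prime_residue_ii[OF gauss_prime_\<pi>] .
  have jj: "int p dvd j * j + 1" by (rule gauss_prime_ii_square[OF gauss_prime_\<pi> j])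
  obtain i where i: "gauss_dvd \<xi> (\<i> - of_int i)" using gauss_prime_residue_ii[OF gauss_prime_\<xi>] .
  have ii: "int q dvd i * i + 1" by (rule gauss_prime_ii_square[OF gauss_prime_\<xi> i])
  have neg: "QuadRes l b" if "QuadRes l (- b)" "QuadRes l (-1)" for l b
    using QuadRes_mult[OF that] by simp
  from c'(2) show False
  proof
    assume b: "b = 0"
    have "QuadRes q (int p + 0 * i)"
      by (rule gauss_prime_QuadRes[OF gauss_prime_\<xi> i]) (use ex1 in \<open>simp add: M_def b\<close>)
    hence qp: "QuadRes q p" by simp
    have "QuadRes p (- (2 * int q) + 0 * j)"
      by (rule gauss_prime_QuadRes[OF gauss_prime_\<pi> j]) (use ex2 in \<open>simp add: M'_def b\<close>)
    hence "QuadRes p (2 * int q)" using neg[OF _ QuadRes_two_times_root(2)[OF jj]] by simp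
    hence "QuadRes p (int q * 2)" by (simp add: mult.commute)
    moreover have "QuadRes p (int q)" using qp recip by simp
    ultimately have "QuadRes p 2" using QuadRes_cancel[OF prime_ints(1) not_dvd_int(1)] by blast
    thus False using res1 qp by simp
  next
    \<comment> \<open>The residues \<open>2 * i\<close> modulo q and \<open>2 * j\<close> modulo p
      remove the images of \<i> from the two conditions.\<close>
    assume b: "b = 1"
    have "QuadRes q (0 + int p * i)"
      by (rule gauss_prime_QuadRes[OF gauss_prime_\<xi> i]) (use ex1 in \<open>simp add: M_def b mult.commute\<close>)
    hence "QuadRes q ((int p * i) * (2 * i))"
      using QuadRes_mult[OF _ QuadRes_two_times_root(1)[OF ii]] by simp
    moreover have "int q dvd (int p * i) * (2 * i) - - (int p * 2)"
    proof -
      have "(int p * i) * (2 * i) - - (int p * 2) = (i * i + 1) * (int p * 2)" by (simp add: algebra_simps)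
      thus ?thesis using dvd_mult2[OF ii] by metis
    qed
    ultimately have "QuadRes q (- (int p * 2))" using QuadRes_cong by blast
    hence q2p: "QuadRes q (int p * 2)" by (rule neg[OF _ QuadRes_two_times_root(2)[OF ii]])
    have "QuadRes p (0 + (- (2 * int q)) * j)"
      by (rule gauss_prime_QuadRes[OF gauss_prime_\<pi> j]) (use ex2 in \<open>simp add: M'_def b\<close>)
    hence "QuadRes p (- (2 * int q) * j)" by simp
    hence "QuadRes p ((- (2 * int q) * j) * (2 * j))"
      by (rule QuadRes_mult[OF _ QuadRes_two_times_root(1)[OF jj]])
    moreover have "int p dvd (- (2 * int q) * j) * (2 * j) - (2 * 2) * int q"
    proof -
      have "(- (2 * int q) * j) * (2 * j) - (2 * 2) * int q = (j * j + 1) * (- 4 * int q)"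
        by (simp add: algebra_simps)
      thus ?thesis using dvd_mult2[OF jj] by metis
    qed
    ultimately have "QuadRes p ((2 * 2) * int q)" using QuadRes_cong by blast
    moreover have "QuadRes p (2 * 2)" unfolding QuadRes_iff by (intro exI[of _ 2]) simp
    moreover have "\<not> int p dvd 2 * 2" unfolding prime_dvd_mult_iff[OF prime_ints(1)] using not_dvd_int(3) by simp
    ultimately have "QuadRes p (int q)" using QuadRes_cancel[OF prime_ints(1)] by blast
    hence qp: "QuadRes q (int p)" using recip by simp
    have "QuadRes q 2" by (rule QuadRes_cancel[OF prime_ints(2) not_dvd_int(2) qp q2p])
    thus False using res2 qp by simp
  qed
qed

end

lemma gauss_unit_of:
  assumes "is_subfield F" "\<i> \<in> F" "\<nu> \<in> {1, -1, \<i>, -\<i>}" shows "unit_of F \<nu>"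
proof -
  have "\<nu> \<in> F" using assms subfield_1[OF assms(1)] subfield_minus[OF assms(1)] by auto
  moreover have "alg_int \<nu>" "alg_int (inverse \<nu>)"
    using assms(3) alg_int_minus[OF alg_int_1] alg_int_minus[OF alg_int_ii] by auto
  ultimately show ?thesis using assms(3) unfolding unit_of_def by auto
qed

lemma sq_equiv_move:
  assumes F: "is_subfield F" and y: "y \<in> F" "y \<noteq> 0" and xy: "sq_equiv F (x * y) z"
  shows "sq_equiv F x (z * y)"
proof -
  have "sq_equiv F (x * (y * y)) (z * y)"
    using sq_equiv_mult[OF F xy sq_equiv_refl[OF F], of y] by (simp only: mult.assoc)
  thus ?thesis by (rule sq_equiv_trans[OF F sq_equiv_sym[OF F sq_equiv_square[OF F y]]])
qed

lemma gauss_dvd_prime_exponent: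
  assumes "gauss_prime \<rho> l" "r \<in> gauss_int" "m \<in> gauss_int" "gauss_dvd r (\<rho> * m)"
  obtains a r' where "a \<le> (1 :: nat)" "r' \<in> gauss_int" "r = \<rho> ^ a * r'" "gauss_dvd r' m"
proof -
  from gauss_dvd_prime_times[OF assms] show ?thesis
  proof
    assume "\<exists>r'\<in>gauss_int. r = \<rho> * r' \<and> gauss_dvd r' m"
    thus ?thesis using that[of 1] by auto
  next
    assume "gauss_dvd r m"
    thus ?thesis using that[of 0 r] assms(2) by simp
  qed
qed

text \<open>The exponent is halved three times. It is 8 because (1 + \<i>)^8 = 16, the power of 2 in
  \<open>4 * d * d\<close> for d = 2 p q.\<close>

lemma gauss_radical_dvd_power8:
  assumes "gauss_radical r" "x \<in> gauss_int" "gauss_dvd r (x ^ 8)" shows "gauss_dvd r x"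
proof -
  have rad: "\<And>x. x \<in> gauss_int \<Longrightarrow> gauss_dvd r (x * x) \<Longrightarrow> gauss_dvd r x"
    using assms(1) by (simp add: gauss_radical_def)
  have "x ^ 4 * x ^ 4 = x ^ 8" "x ^ 2 * x ^ 2 = x ^ 4" by (simp_all flip: power_add)
  hence "gauss_dvd r (x ^ 4 * x ^ 4)" and e: "x ^ 2 * x ^ 2 = x ^ 4" using assms(3) by (simp_all only:)
  from rad[OF gauss_int_power[OF assms(2)] this(1)] have "gauss_dvd r (x ^ 4)" .
  hence "gauss_dvd r (x ^ 2 * x ^ 2)" by (simp only: e)
  hence "gauss_dvd r (x ^ 2)" by (rule rad[OF gauss_int_power[OF assms(2)]])
  hence "gauss_dvd r (x * x)" by (simp only: power2_eq_square)
  thus ?thesis by (rule rad[OF assms(2)])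
qed

lemma prime_divides_factor:
  fixes a b l n :: nat
  assumes "prime l" "a * b = l * n"
  shows "(\<exists>a'. a = l * a' \<and> a' * b = n) \<or> (\<exists>b'. b = l * b' \<and> a * b' = n)"
proof -
  have l0: "l > 0" using assms(1) by (rule prime_gt_0_nat)
  have "l dvd a * b" unfolding assms(2) by simp
  hence "l dvd a \<or> l dvd b" using assms(1) by (simp add: prime_dvd_mult_iff)
  thus ?thesis
  proof
    assume "l dvd a"
    then obtain a' where a': "a = l * a'" by (elim dvdE)
    have "l * (a' * b) = l * n" using assms(2) unfolding a' by (simp only: mult.assoc)
    hence "a' * b = n" using l0 by simp
    thus ?thesis using a' by blast
  next
    assume "l dvd b"
    then obtain b' where b': "b = l * b'" by (elim dvdE)
    have "l * (a * b') = l * n" using assms(2) unfolding b' by (simp only: mult_ac)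
    hence "a * b' = n" using l0 by simp
    thus ?thesis using b' by blast
  qed
qed

text \<open>The square of the quotient is the relative norm of the unit u, so integrality of the
  quotient and of its inverse follows by taking roots.\<close>

lemma relative_norm_unit:
  assumes "quad_ext E w" and r: "r \<in> E" "r \<noteq> 0"
    and u: "unit_of (adj E w) u" and \<beta>: "\<beta> \<in> adj E w" "\<beta> \<noteq> 0" "r * u = \<beta> * \<beta>"
  shows "unit_of E (\<beta> * qconj E w \<beta> / r)"
proof -
  interpret quad_ext E w by (rule assms(1))
  let ?\<sigma> = "qconj E w"
  have uu: "u \<in> adj E w" "u \<noteq> 0" "alg_int u" "alg_int (inverse u)" using u by (auto simp: unit_of_def)
  define v where "v = \<beta> * ?\<sigma> \<beta> / r"
  have vE: "v \<in> E" unfolding v_def by (rule subfield_divide[OF sub norm_in_base[OF \<beta>(1)] r(1)])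
  have v0: "v \<noteq> 0" using \<beta> r qconj_0_iff[OF \<beta>(1)] by (simp add: v_def)
  have "?\<sigma> \<beta> * ?\<sigma> \<beta> = r * ?\<sigma> u"
    unfolding qconj_mult[OF \<beta>(1,1), symmetric] \<beta>(3)[symmetric] qconj_mult[OF base_subset[OF r(1)] uu(1)]
    using r by simp
  moreover have "v * v = (\<beta> * \<beta>) * (?\<sigma> \<beta> * ?\<sigma> \<beta>) / (r * r)" by (simp add: v_def mult_ac)
  ultimately have vv: "v * v = u * ?\<sigma> u" using r(2) by (simp add: \<beta>(3)[symmetric])
  have "alg_int (v * v)" unfolding vv by (rule alg_int_mult[OF uu(3) alg_int_qconj[OF uu(1,3)]])
  hence 1: "alg_int v" by (rule alg_int_sqrtD)
  have iu: "inverse u \<in> adj E w" by (rule subfield_inverse[OF adj_subfield uu(1)])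
  have ii: "inverse v * inverse v = inverse u * ?\<sigma> (inverse u)"
    unfolding qconj_inverse[OF uu(1)] inverse_mult_distrib[symmetric] vv ..
  have "alg_int (inverse v * inverse v)" unfolding ii by (rule alg_int_mult[OF uu(4) alg_int_qconj[OF iu uu(4)]])
  hence 2: "alg_int (inverse v)" by (rule alg_int_sqrtD)
  show ?thesis unfolding unit_of_def v_def[symmetric] using vE v0 1 2 by simp
qed

section \<open>Relations between the Gaussian primes in \<open>k\<close> and in
  \<open>K\<close>\<close>

context two_primes
begin

lemma k_subfield: "is_subfield k" by (rule gk.adj_subfield)

lemma k_ints: "\<pi> \<in> k" "\<pi>' \<in> k" "\<xi> \<in> k" "\<xi>' \<in> k" "lam \<in> k" "\<i> \<in> k"
  by (rule gk.M_int, (rule ints gauss_int_ii))+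

lemma unit_k: "\<nu> \<in> {1, -1, \<i>, -\<i>} \<Longrightarrow> unit_of k \<nu>"
  by (rule gauss_unit_of[OF k_subfield k_ints(6)])

lemma sq_equiv_pq: "sq_equiv k (of_nat p * of_nat q) 1"
proof (rule sq_equivI)
  show "unit_of k (-\<i>)" by (rule unit_k) simp
  show "D / lam \<in> k" by (rule subfield_divide[OF k_subfield gk.gen_in_adj k_ints(5)])
  show "D / lam \<noteq> 0" using gk.s_nonzero nonzeros by simp
  have "D / lam * (D / lam) = of_nat (2 * p * q) / (2 * \<i>)"
    unfolding times_divide_times_eq gk.s_square norms(4) ..
  also have "\<dots> = of_nat p * of_nat q * (-\<i>)" by (simp add: field_simps)
  finally show "of_nat p * of_nat q * (-\<i>) = 1 * (D / lam * (D / lam))" by simp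
qed

lemma nonzero_pq: "complex_of_nat p \<noteq> 0" "complex_of_nat q \<noteq> 0"
  using ge5 by simp_all

lemma sq_equiv_q_p: "sq_equiv k (of_nat q) (of_nat p)"
  using sq_equiv_move[OF k_subfield subfield_of_nat[OF k_subfield] nonzero_pq(1), of "of_nat q" 1] sq_equiv_pq
  by (simp add: mult.commute)

text \<open>16 p^2 q^2 divides the eighth power of the product of the five Gaussian primes, so a
  square-free r divides the product itself and is a unit times a subproduct.\<close>

lemma radical_factorization:
  assumes "gauss_radical r" "gauss_dvd r (of_nat (16 * p * p * q * q))"
  obtains \<nu> a0 a1 a2 a3 a4 where "\<nu> \<in> {1, -1, \<i>, -\<i>}"
    "a0 \<le> 1" "a1 \<le> 1" "a2 \<le> 1" "a3 \<le> 1" "a4 \<le> (1 :: nat)"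
    "r = \<nu> * (lam ^ a0 * \<pi> ^ a1 * \<pi>' ^ a2 * \<xi> ^ a3 * \<xi>' ^ a4)"
    "r * cnj r = of_nat (2 ^ a0 * p ^ (a1 + a2) * q ^ (a3 + a4))"
proof -
  define L where "L = lam * (\<pi> * (\<pi>' * (\<xi> * (\<xi>' * 1))))"
  note I = ints gauss_int_1 gauss_int_mult
  have LI: "L \<in> gauss_int" unfolding L_def by (intro I)
  have "lam ^ 8 = (lam * lam) ^ 4" by (simp flip: power2_eq_square power_mult)
  also have "\<dots> = 16 * \<i> ^ 4" unfolding norms(4) by (simp add: power_mult_distrib)
  also have "\<dots> = 16" by (simp add: power4_eq_xxxx)
  finally have l8: "lam ^ 8 = 16" .
  have "L = lam * ((\<pi> * \<pi>') * (\<xi> * \<xi>'))" by (simp add: L_def mult_ac)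
  hence "L = lam * (of_nat p * of_nat q)" by (simp only: norms)
  hence "L ^ 8 = 16 * (of_nat p ^ 8 * of_nat q ^ 8)" by (simp only: power_mult_distrib l8)
  also have "\<dots> = of_nat (16 * p * p * q * q) * of_nat (p ^ 6 * q ^ 6)" by (simp add: eval_nat_numeral mult_ac)
  finally have "L ^ 8 = of_nat (16 * p * p * q * q) * of_nat (p ^ 6 * q ^ 6)" .
  hence "gauss_dvd r (L ^ 8)" using gauss_dvd_mult[OF assms(2) gauss_int_of_nat, of "p ^ 6 * q ^ 6"] by simp
  hence rL: "gauss_dvd r L" by (rule gauss_radical_dvd_power8[OF assms(1) LI])
  have rI: "r \<in> gauss_int" using assms(1) by (simp add: gauss_radical_def)
  obtain a0 r0 where 0: "a0 \<le> (1 :: nat)" "r0 \<in> gauss_int" "r = lam ^ a0 * r0"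
      "gauss_dvd r0 (\<pi> * (\<pi>' * (\<xi> * (\<xi>' * 1))))"
    by (rule gauss_dvd_prime_exponent[OF gauss_prime_lam rI _ rL[unfolded L_def]]) (intro I)
  obtain a1 r1 where 1: "a1 \<le> (1 :: nat)" "r1 \<in> gauss_int" "r0 = \<pi> ^ a1 * r1"
      "gauss_dvd r1 (\<pi>' * (\<xi> * (\<xi>' * 1)))"
    by (rule gauss_dvd_prime_exponent[OF gauss_prime_\<pi> 0(2) _ 0(4)]) (intro I)
  obtain a2 r2 where 2: "a2 \<le> (1 :: nat)" "r2 \<in> gauss_int" "r1 = \<pi>' ^ a2 * r2"
      "gauss_dvd r2 (\<xi> * (\<xi>' * 1))"
    by (rule gauss_dvd_prime_exponent[OF gauss_prime_\<pi>' 1(2) _ 1(4)]) (intro I)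
  obtain a3 r3 where 3: "a3 \<le> (1 :: nat)" "r3 \<in> gauss_int" "r2 = \<xi> ^ a3 * r3"
      "gauss_dvd r3 (\<xi>' * 1)"
    by (rule gauss_dvd_prime_exponent[OF gauss_prime_\<xi> 2(2) _ 2(4)]) (intro I)
  obtain a4 r4 where 4: "a4 \<le> (1 :: nat)" "r4 \<in> gauss_int" "r3 = \<xi>' ^ a4 * r4"
      "gauss_dvd r4 1"
    by (rule gauss_dvd_prime_exponent[OF gauss_prime_\<xi>' 3(2) _ 3(4)]) (intro I)
  obtain c where c: "c \<in> gauss_int" "1 = r4 * c" using 4(4) unfolding gauss_dvd_def by blast
  have \<nu>: "r4 \<in> {1, -1, \<i>, -\<i>}" by (rule gauss_unit_cases[OF 4(2) c(1) c(2)[symmetric]])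
  have r: "r = r4 * (lam ^ a0 * \<pi> ^ a1 * \<pi>' ^ a2 * \<xi> ^ a3 * \<xi>' ^ a4)"
    unfolding 0(3) 1(3) 2(3) 3(3) 4(3) by (simp only: mult_ac)
  have "r * cnj r = (r4 * cnj r4) * ((lam * cnj lam) ^ a0 * (\<pi> * \<pi>') ^ a1 * (\<pi> * \<pi>') ^ a2 * (\<xi> * \<xi>') ^ a3 * (\<xi> * \<xi>') ^ a4)"
    unfolding r by (simp add: power_mult_distrib \<pi>' \<xi>' mult_ac)
  also have "r4 * cnj r4 = 1" using \<nu> by auto
  finally have "r * cnj r = of_nat (2 ^ a0 * p ^ (a1 + a2) * q ^ (a3 + a4))"
    unfolding norms by (simp add: power_add mult_ac)
  thus ?thesis using that[OF \<nu> 0(1) 1(1) 2(1) 3(1) 4(1) r] by simp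
qed

lemma minus_one_residue: "QuadRes p (-1)" "QuadRes q (-1)"
proof -
  have "QuadRes l (-1)" if \<rho>: "gauss_prime \<rho> l" for \<rho> l
  proof -
    obtain j where "gauss_dvd \<rho> (\<i> - of_int j)" using gauss_prime_residue_ii[OF \<rho>] .
    from gauss_prime_ii_square[OF \<rho> this] show ?thesis by (rule QuadRes_two_times_root(2))
  qed
  thus "QuadRes p (-1)" "QuadRes q (-1)" using gauss_prime_\<pi> gauss_prime_\<xi> by blast+
qed

text \<open>Multiplying the equation by b or by a gives (b w)^2 = b modulo a and (a z)^2 = - a
  modulo b.\<close>

lemma pell_residue:
  fixes a b z w :: nat and l :: nat
  assumes "b * (w * w) = a * (z * z) + 1"
  shows "l dvd a \<Longrightarrow> QuadRes l b" and "l dvd b \<Longrightarrow> QuadRes l (-1) \<Longrightarrow> QuadRes l a"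
proof -
  have eq: "int b * (int w * int w) = int a * (int z * int z) + 1"
    using arg_cong[OF assms, of int] by (simp only: of_nat_add of_nat_mult of_nat_1)
  show "QuadRes l b" if "l dvd a"
  proof -
    have "(int b * int w) * (int b * int w) - int b = int b * (int b * (int w * int w) - 1)"
      by (simp add: algebra_simps)
    also have "\<dots> = int a * (int b * (int z * int z))" unfolding eq by simp
    finally have "int l dvd (int b * int w) * (int b * int w) - int b" using that by simp
    thus ?thesis unfolding QuadRes_iff by blast
  qed
  show "QuadRes l a" if "l dvd b" "QuadRes l (-1)"
  proof -
    have "(int a * int z) * (int a * int z) - - int a = int a * (int a * (int z * int z) + 1)"
      by (simp add: algebra_simps)
    also have "\<dots> = int b * (int a * (int w * int w))" unfolding eq[symmetric] by simp
    finally have "int l dvd (int a * int z) * (int a * int z) - - int a" using that by simp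
    hence "QuadRes l (- int a)" unfolding QuadRes_iff by blast
    from QuadRes_mult[OF this that(2)] show ?thesis by simp
  qed
qed

text \<open>In a factorization a b = 2 p q left by the descent, p and q in the same factor make 2 a
  residue modulo both unless the other factor is 1. In different factors they give two of the three
  symbols the value 1.\<close>

lemma negative_pell_2pq: obtains x y :: nat where "x * x + 1 = 2 * p * q * (y * y)"
proof (rule negative_pell[of "2 * p * q"])
  show "\<And>m. 2 * p * q \<noteq> m * m" by (rule nonsq(1))
  have "odd (p * q)" using ndvd by simp
  then obtain n where "p * q = 2 * n + 1" by (elim oddE)
  hence e: "2 * p * q = 4 * n + 2" by simp
  have "(4 * n + 2) mod 4 = 2" by presburger
  thus "(2 * p * q) mod 4 = 1 \<or> (2 * p * q) mod 4 = 2" unfolding e by (rule disjI2)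
next
  fix a b z w :: nat
  assume ab: "a * b = 2 * p * q" and eq: "b * (w * w) = a * (z * z) + 1"
  note A = pell_residue(1)[OF eq]
  have Bp: "QuadRes p a" if "p dvd b" by (rule pell_residue(2)[OF eq that minus_one_residue(1)])
  have Bq: "QuadRes q a" if "q dvd b" by (rule pell_residue(2)[OF eq that minus_one_residue(2)])
  have 1: "\<not> (QuadRes p (2 * int q) \<and> QuadRes q p)"
  proof
    assume h: "QuadRes p (2 * int q) \<and> QuadRes q p"
    hence "QuadRes p (int q * 2)" by (simp add: mult.commute)
    moreover have "QuadRes p q" using h recip by simp
    ultimately have "QuadRes p 2" using QuadRes_cancel[OF prime_ints(1) not_dvd_int(1)] by blast
    thus False using h res1 by simp
  qed
  have 2: "\<not> (QuadRes q (2 * int p) \<and> QuadRes p q)"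
  proof
    assume h: "QuadRes q (2 * int p) \<and> QuadRes p q"
    hence "QuadRes q (int p * 2)" by (simp add: mult.commute)
    moreover have qp: "QuadRes q p" using h recip by simp
    ultimately have "QuadRes q 2" using QuadRes_cancel[OF prime_ints(2) not_dvd_int(2)] by blast
    thus False using qp res2 by simp
  qed
  have fin: "a' = 1 \<and> b' = 2 \<or> a' = 2 \<and> b' = 1" if h: "a' * b' = 2" for a' b' :: nat
  proof -
    have "a' dvd a' * b'" by simp
    hence "a' dvd 2" unfolding h .
    hence "a' \<le> 2" by (rule dvd_imp_le) simp
    hence "a' = 0 \<or> a' = 1 \<or> a' = 2" by linarith
    thus ?thesis using h by auto
  qed
  have "a * b = p * (q * 2)" using ab by (simp add: mult_ac)
  from prime_divides_factor[OF p(1) this] show "a = 1 \<or> b = 1"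
  proof (elim disjE exE conjE)
    fix a1 assume a1: "a = p * a1" "a1 * b = q * 2"
    from prime_divides_factor[OF q(1) a1(2)] show ?thesis
    proof (elim disjE exE conjE)
      fix a2 assume a2: "a1 = q * a2" "a2 * b = 2"
      have "QuadRes p b" "QuadRes q b" using A[of p] A[of q] a1 a2 by simp_all
      thus ?thesis using fin[OF a2(2)] res3 by auto
    next
      fix b2 assume b2: "b = q * b2" "a1 * b2 = 2"
      have "QuadRes p b" "QuadRes q a" using A[of p] Bq a1 b2 by simp_all
      thus ?thesis using fin[OF b2(2)] 1 2 a1 b2 by (auto simp: mult.commute)
    qed
  next
    fix b1 assume b1: "b = p * b1" "a * b1 = q * 2"
    from prime_divides_factor[OF q(1) b1(2)] show ?thesis
    proof (elim disjE exE conjE)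
      fix a2 assume a2: "a = q * a2" "a2 * b1 = 2"
      have "QuadRes p a" "QuadRes q b" using A[of q] Bp a2 b1 by simp_all
      thus ?thesis using fin[OF a2(2)] 1 2 a2 b1 by (auto simp: mult.commute)
    next
      fix b2 assume b2: "b1 = q * b2" "a * b2 = 2"
      have "QuadRes p a" "QuadRes q a" using Bp Bq b1 b2 by simp_all
      thus ?thesis using fin[OF b2(2)] res3 by auto
    qed
  qed
qed (rule that)

text \<open>The square-free part of x + \<i> for x^2 + 1 = 2 p q y^2 is trivial in \<open>k\<close>.
  Its norm is 2 p q up to squares, so it is \<open>lam\<close> times one prime above p times one
  prime above q. Which primes occur is not determined, hence the two alternatives.\<close>

lemma lam_relation:
  "sq_equiv k (lam * \<xi>) \<pi> \<and> sq_equiv k (lam * \<xi>') \<pi>' \<or> sq_equiv k (lam * \<xi>) \<pi>' \<and> sq_equiv k (lam * \<xi>') \<pi>"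
proof -
  obtain x y where xy: "x * x + 1 = 2 * p * q * (y * y)" using negative_pell_2pq .
  obtain r t where r: "gauss_radical r" "sq_equiv k r 1" "gauss_dvd r (of_nat (4 * (2 * p * q) * (2 * p * q)))"
    "t \<in> gauss_rat" "of_nat (2 * p * q) * (r * cnj r) = t * t"
    using gk.negative_pell_radical[OF xy] by blast
  have "4 * (2 * p * q) * (2 * p * q) = 16 * p * p * q * q" by simp
  hence "gauss_dvd r (of_nat (16 * p * p * q * q))" using r(3) by metis
  then obtain \<nu> a0 a1 a2 a3 a4 where fac: "\<nu> \<in> {1, -1, \<i>, -\<i>}"
    "a0 \<le> 1" "a1 \<le> 1" "a2 \<le> 1" "a3 \<le> 1" "a4 \<le> (1 :: nat)"
    "r = \<nu> * (lam ^ a0 * \<pi> ^ a1 * \<pi>' ^ a2 * \<xi> ^ a3 * \<xi>' ^ a4)"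
    "r * cnj r = of_nat (2 ^ a0 * p ^ (a1 + a2) * q ^ (a3 + a4))"
    using radical_factorization[OF r(1)] by metis
  have "of_nat (2 ^ (a0 + 1) * p ^ (a1 + a2 + 1) * q ^ (a3 + a4 + 1)) = t * t"
    unfolding r(5)[symmetric] fac(8) by (simp add: mult_ac)
  then obtain m where "2 ^ (a0 + 1) * p ^ (a1 + a2 + 1) * q ^ (a3 + a4 + 1) = m * m"
    using nat_square_gauss_rat[OF _ r(4)] by metis
  note ev = square_exponents[OF this]
  define mon where "mon = lam ^ a0 * \<pi> ^ a1 * \<pi>' ^ a2 * \<xi> ^ a3 * \<xi>' ^ a4"
  have "sq_equiv k (mon * \<nu>) mon" by (rule sq_equiv_unit[OF k_subfield unit_k[OF fac(1)]])
  hence rm: "sq_equiv k r mon" unfolding fac(7) mon_def[symmetric] by (simp only: mult.commute)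
  have m1: "sq_equiv k mon 1"
    by (rule sq_equiv_trans[OF k_subfield sq_equiv_sym[OF k_subfield rm] r(2)])
  \<comment> \<open>The second relation is the first one multiplied by q \<sim> p with squares
    removed: x q = x' x^2 and y p = y' y^2.\<close>
  have key: "sq_equiv k (lam * x) y \<and> sq_equiv k (lam * x') y'"
    if h: "x * x' = of_nat q" "y * y' = of_nat p" "x \<in> k" "y \<in> k" "x \<noteq> 0" "y \<noteq> 0"
      "sq_equiv k (lam * x * y) 1" for x x' y y'
  proof -
    have 1: "sq_equiv k (lam * x) y" using sq_equiv_move[OF k_subfield h(4,6,7)] by simp
    have 2: "sq_equiv k (lam * x * of_nat q) (y * of_nat p)"
      by (rule sq_equiv_mult[OF k_subfield 1 sq_equiv_q_p])
    have "lam * x * of_nat q = lam * x' * (x * x)" "y * of_nat p = y' * (y * y)"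
      unfolding h(1,2)[symmetric] by (simp_all only: mult_ac)
    hence 3: "sq_equiv k (lam * x * of_nat q) (lam * x')" and 4: "sq_equiv k (y * of_nat p) y'"
      using sq_equiv_square[OF k_subfield h(3,5)] sq_equiv_square[OF k_subfield h(4,6)] by (simp_all only:)
    have "sq_equiv k (lam * x') y'"
      by (rule sq_equiv_trans[OF k_subfield sq_equiv_sym[OF k_subfield 3] sq_equiv_trans[OF k_subfield 2 4]])
    with 1 show ?thesis by (rule conjI)
  qed
  have e: "a0 = 1" "a1 = 1 \<and> a2 = 0 \<or> a1 = 0 \<and> a2 = 1" "a3 = 1 \<and> a4 = 0 \<or> a3 = 0 \<and> a4 = 1"
    using ev fac(2-6) by presburger+
  have pp: "\<pi>' * \<pi> = of_nat p" "\<xi>' * \<xi> = of_nat q" using norms by (simp_all add: mult.commute)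
  from e(2,3) show ?thesis
  proof (elim disjE conjE)
    assume "a1 = 1" "a2 = 0" "a3 = 1" "a4 = 0"
    hence "sq_equiv k (lam * \<xi> * \<pi>) 1" using m1 e(1) by (simp add: mon_def mult_ac)
    from key[OF norms(2,1) k_ints(3,1) nonzeros(3,1) this] show ?thesis by simp
  next
    assume "a1 = 1" "a2 = 0" "a3 = 0" "a4 = 1"
    hence "sq_equiv k (lam * \<xi>' * \<pi>) 1" using m1 e(1) by (simp add: mon_def mult_ac)
    from key[OF pp(2) norms(1) k_ints(4,1) nonzeros(4,1) this] show ?thesis by simp
  next
    assume "a1 = 0" "a2 = 1" "a3 = 1" "a4 = 0"
    hence "sq_equiv k (lam * \<xi> * \<pi>') 1" using m1 e(1) by (simp add: mon_def mult_ac)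
    from key[OF norms(2) pp(1) k_ints(3,2) nonzeros(3,2) this] show ?thesis by simp
  next
    assume "a1 = 0" "a2 = 1" "a3 = 0" "a4 = 1"
    hence "sq_equiv k (lam * \<xi>' * \<pi>') 1" using m1 e(1) by (simp add: mon_def mult_ac)
    from key[OF pp(2,1) k_ints(4,2) nonzeros(4,2) this] show ?thesis by simp
  qed
qed

lemma sq_equiv_kK: "sq_equiv k x y \<Longrightarrow> sq_equiv K x y"
  by (erule sq_equiv_mono[rotated]) (use k_K in blast)

lemma P_in_K: "P \<in> K" unfolding K_def by (rule gK.gen_in_adj)

lemma sq_equiv_K_p: "sq_equiv K (of_nat p) 1"
  using sq_equiv_square[OF K_subfield P_in_K g1.s_nonzero, of 1] by (simp add: g1.s_square)

lemma sq_equiv_K_q: "sq_equiv K (of_nat q) 1"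
  by (rule sq_equiv_trans[OF K_subfield sq_equiv_kK[OF sq_equiv_q_p] sq_equiv_K_p])

lemma M1_K: "x \<in> M1 \<Longrightarrow> x \<in> K"
proof (erule g1.adjE)
  fix a b assume *: "a \<in> gauss_rat" "b \<in> gauss_rat" "x = a + b * P"
  thus "x \<in> K" using P_in_K k_K[OF gk.base_subset] by (auto intro!: subfield_intros[OF K_subfield])
qed

lemma negative_pell_p: obtains x y :: nat where "x * x + 1 = p * (y * y)"
proof (rule negative_pell[of p])
  show "\<And>m. p \<noteq> m * m" by (rule nonsq(2))
  show "p mod 4 = 1 \<or> p mod 4 = 2" using p by simp
  show "a = 1 \<or> b = 1" if h: "a * b = p" for a b :: nat
  proof -
    have "a dvd a * b" by simp
    hence "a = 1 \<or> a = p" using p(1) unfolding h prime_nat_iff by simp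
    moreover have "p > 0" using p(1) by (rule prime_gt_0_nat)
    ultimately show ?thesis using h by auto
  qed
qed (rule that)

text \<open>The square-free part of x + \<i> for x^2 + 1 = p y^2 has norm p up to squares, so it is
  one of the primes above p up to a unit and a factor q, which is trivial in \<open>K\<close>. The
  other prime follows because their product p is the square of \<open>P\<close>.\<close>

lemma sq_equiv_K_\<pi>: "sq_equiv K \<pi> 1" "sq_equiv K \<pi>' 1"
proof -
  obtain x y where xy: "x * x + 1 = p * (y * y)" using negative_pell_p .
  obtain r t where r: "gauss_radical r" "sq_equiv M1 r 1" "gauss_dvd r (of_nat (4 * p * p))"
    "t \<in> gauss_rat" "of_nat p * (r * cnj r) = t * t"
    using g1.negative_pell_radical[OF xy] by blast
  have "of_nat (16 * p * p * q * q) = complex_of_nat (4 * p * p) * of_nat (4 * q * q)" by simp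
  hence "gauss_dvd r (of_nat (16 * p * p * q * q))"
    using gauss_dvd_mult[OF r(3) gauss_int_of_nat, of "4 * q * q"] by (simp only:)
  then obtain \<nu> a0 a1 a2 a3 a4 where fac: "\<nu> \<in> {1, -1, \<i>, -\<i>}"
    "a0 \<le> 1" "a1 \<le> 1" "a2 \<le> 1" "a3 \<le> 1" "a4 \<le> (1 :: nat)"
    "r = \<nu> * (lam ^ a0 * \<pi> ^ a1 * \<pi>' ^ a2 * \<xi> ^ a3 * \<xi>' ^ a4)"
    "r * cnj r = of_nat (2 ^ a0 * p ^ (a1 + a2) * q ^ (a3 + a4))"
    using radical_factorization[OF r(1)] by metis
  have "of_nat (2 ^ a0 * p ^ (a1 + a2 + 1) * q ^ (a3 + a4)) = t * t"
    unfolding r(5)[symmetric] fac(8) by (simp add: mult_ac)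
  then obtain m where "2 ^ a0 * p ^ (a1 + a2 + 1) * q ^ (a3 + a4) = m * m"
    using nat_square_gauss_rat[OF _ r(4)] by metis
  note ev = square_exponents[OF this]
  have e: "a0 = 0" "a1 = 1 \<and> a2 = 0 \<or> a1 = 0 \<and> a2 = 1" "a3 = 1 \<and> a4 = 1 \<or> a3 = 0 \<and> a4 = 0"
    using ev fac(2-6) by presburger+
  have rK: "sq_equiv K r 1" by (rule sq_equiv_mono[OF _ r(2)]) (use M1_K in blast)
  define mon where "mon = \<pi> ^ a1 * \<pi>' ^ a2"
  have "r = mon * (\<xi> ^ a3 * \<xi>' ^ a4) * \<nu>" unfolding fac(7) mon_def e(1) by (simp add: mult_ac)
  hence r1: "sq_equiv K r (mon * (\<xi> ^ a3 * \<xi>' ^ a4))"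
    using sq_equiv_unit[OF K_subfield gauss_unit_of[OF K_subfield k_K[OF k_ints(6)] fac(1)]] by (simp only:)
  have "sq_equiv K (\<xi> ^ a3 * \<xi>' ^ a4) 1"
    using e(3) sq_equiv_K_q sq_equiv_refl[OF K_subfield] by (auto simp: norms)
  hence r2: "sq_equiv K (mon * (\<xi> ^ a3 * \<xi>' ^ a4)) (mon * 1)"
    by (rule sq_equiv_mult[OF K_subfield sq_equiv_refl[OF K_subfield]])
  have "sq_equiv K (mon * 1) 1"
    by (rule sq_equiv_trans[OF K_subfield sq_equiv_sym[OF K_subfield sq_equiv_trans[OF K_subfield r1 r2]] rK])
  hence mon: "sq_equiv K mon 1" by simp
  have other: "sq_equiv K y 1" if "sq_equiv K x 1" "x * y = of_nat p" "x \<in> k" "x \<noteq> 0" for x y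
  proof -
    have "sq_equiv K (y * x) 1" using that(2) sq_equiv_K_p by (simp add: mult.commute)
    hence "sq_equiv K y (1 * x)" by (rule sq_equiv_move[OF K_subfield k_K[OF that(3)] that(4)])
    hence "sq_equiv K y x" by simp
    thus ?thesis by (rule sq_equiv_trans[OF K_subfield _ that(1)])
  qed
  from e(2) have "sq_equiv K \<pi> 1 \<and> sq_equiv K \<pi>' 1"
  proof
    assume "a1 = 1 \<and> a2 = 0"
    hence "sq_equiv K \<pi> 1" using mon by (simp add: mon_def)
    thus ?thesis using other[OF _ norms(1) k_ints(1) nonzeros(1)] by simp
  next
    assume "a1 = 0 \<and> a2 = 1"
    hence "sq_equiv K \<pi>' 1" using mon by (simp add: mon_def)
    thus ?thesis using other[of \<pi>' \<pi>] norms(1) k_ints(2) nonzeros(2) by (simp add: mult.commute)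
  qed
  thus "sq_equiv K \<pi> 1" "sq_equiv K \<pi>' 1" by auto
qed

lemma sq_equiv_K_monomial: "sq_equiv K (\<pi> ^ m * \<pi>' ^ n) 1"
proof -
  have pw: "sq_equiv K (x ^ n) 1" if "sq_equiv K x 1" for x n
  proof (induction n)
    case 0
    show ?case by (simp add: sq_equiv_refl[OF K_subfield])
  next
    case (Suc n)
    show ?case using sq_equiv_mult[OF K_subfield that Suc] by simp
  qed
  show ?thesis using sq_equiv_mult[OF K_subfield pw[OF sq_equiv_K_\<pi>(1)] pw[OF sq_equiv_K_\<pi>(2)]] by simp
qed

section \<open>Relative norms to the three intermediate fields\<close>

sublocale gK1: quad_ext M1 Q
proof
  show "is_subfield M1" by (rule g1.adj_subfield)
  show "Q * Q \<in> M1" unfolding g2.s_square by (rule subfield_of_nat[OF g1.adj_subfield])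
  show "Q \<notin> M1"
  proof
    assume "Q \<in> M1"
    from g1.square_in_adjD[OF subfield_of_nat[OF gauss_rat_subfield] this g2.s_square[symmetric]]
    obtain y where y: "y \<in> gauss_rat" "of_nat (2 * q) = y * y \<or> of_nat (2 * q * p) = y * y"
      unfolding g1.s_square of_nat_mult[symmetric] by blast
    then obtain m :: nat where "2 * q = m * m \<or> 2 * q * p = m * m" using nat_square_gauss_rat[OF _ y(1)] by metis
    thus False using nonsq(3)[of m] nonsq(1)[of m] by (auto simp: mult_ac)
  qed
qed

sublocale gK2: quad_ext M2 P
proof
  show "is_subfield M2" by (rule g2.adj_subfield)
  show "P * P \<in> M2" unfolding g1.s_square by (rule subfield_of_nat[OF g2.adj_subfield])
  show "P \<notin> M2"
  proof
    assume "P \<in> M2"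
    from g2.square_in_adjD[OF subfield_of_nat[OF gauss_rat_subfield] this g1.s_square[symmetric]]
    obtain y where y: "y \<in> gauss_rat" "of_nat p = y * y \<or> of_nat (p * (2 * q)) = y * y"
      unfolding g2.s_square of_nat_mult[symmetric] by blast
    then obtain m :: nat where "p = m * m \<or> p * (2 * q) = m * m" using nat_square_gauss_rat[OF _ y(1)] by metis
    thus False using nonsq(2)[of m] nonsq(1)[of m] by (auto simp: mult_ac)
  qed
qed

lemma K_coords:
  assumes "\<beta> \<in> K"
  obtains a b c d where "a \<in> gauss_rat" "b \<in> gauss_rat" "c \<in> gauss_rat" "d \<in> gauss_rat"
    "\<beta> = a + b * P + c * Q + d * D"
proof -
  obtain x y where xy: "x \<in> k" "y \<in> k" "\<beta> = x + y * P" using assms unfolding K_def by (rule gK.adjE)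
  obtain a d where ae: "a \<in> gauss_rat" "d \<in> gauss_rat" "x = a + d * D" using xy(1) by (rule gk.adjE)
  obtain b c where bc: "b \<in> gauss_rat" "c \<in> gauss_rat" "y = b + c * D" using xy(2) by (rule gk.adjE)
  have "\<beta> = a + b * P + (c * (P * P)) * Q + d * D"
    unfolding xy(3) ae(3) bc(3) by (simp add: D_eq algebra_simps)
  moreover have "c * (P * P) \<in> gauss_rat" unfolding g1.s_square
    by (rule subfield_mult[OF gauss_rat_subfield bc(2) subfield_of_nat[OF gauss_rat_subfield]])
  ultimately show ?thesis using that ae bc by blast
qed

text \<open>Writing the conjugates over all three intermediate fields in the one basis 1, P, Q, D
  over \<open>gauss_rat\<close> makes their products comparable.\<close>

lemma K_conjugates:
  assumes "a \<in> gauss_rat" "b \<in> gauss_rat" "c \<in> gauss_rat" "d \<in> gauss_rat"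
  defines "\<beta> \<equiv> a + b * P + c * Q + d * D"
  shows "qconj k P \<beta> = a - b * P - c * Q + d * D"
    and "qconj M1 Q \<beta> = a + b * P - c * Q - d * D" "\<beta> \<in> adj M1 Q"
    and "qconj M2 P \<beta> = a - b * P + c * Q - d * D" "\<beta> \<in> adj M2 P"
proof -
  have DP: "c / of_nat p * D * P = c * Q"
  proof -
    have "c / of_nat p * D * P = c / of_nat p * (P * P) * Q" by (simp add: D_eq)
    thus ?thesis unfolding g1.s_square using nonzero_pq by simp
  qed
  have cp: "c / of_nat p \<in> gauss_rat" by (intro subfield_divide subfield_of_nat gauss_rat_subfield assms)
  have "\<beta> = (a + d * D) + (b + c / of_nat p * D) * P" using DP by (simp add: \<beta>_def algebra_simps)
  hence "qconj k P \<beta> = (a + d * D) - (b + c / of_nat p * D) * P"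
    using gK.qconj_eq[OF adjI[OF assms(1,4)] adjI[OF assms(2) cp]] by (simp only:)
  thus "qconj k P \<beta> = a - b * P - c * Q + d * D" using DP by (simp add: algebra_simps)
  have 1: "\<beta> = (a + b * P) + (c + d * P) * Q" by (simp add: \<beta>_def D_eq algebra_simps)
  show "\<beta> \<in> adj M1 Q" unfolding 1 by (rule adjI[OF adjI[OF assms(1,2)] adjI[OF assms(3,4)]])
  have "qconj M1 Q \<beta> = (a + b * P) - (c + d * P) * Q"
    unfolding 1 by (rule gK1.qconj_eq[OF adjI[OF assms(1,2)] adjI[OF assms(3,4)]])
  thus "qconj M1 Q \<beta> = a + b * P - c * Q - d * D" by (simp add: D_eq algebra_simps)
  have 2: "\<beta> = (a + c * Q) + (b + d * Q) * P" by (simp add: \<beta>_def D_eq algebra_simps)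
  show "\<beta> \<in> adj M2 P" unfolding 2 by (rule adjI[OF adjI[OF assms(1,3)] adjI[OF assms(2,4)]])
  have "qconj M2 P \<beta> = (a + c * Q) - (b + d * Q) * P"
    unfolding 2 by (rule gK2.qconj_eq[OF adjI[OF assms(1,3)] adjI[OF assms(2,4)]])
  thus "qconj M2 P \<beta> = a - b * P + c * Q - d * D" by (simp add: D_eq algebra_simps)
qed

lemma cnj_sqrt: "cnj P = P" "cnj Q = Q" "cnj D = D"
  by (simp_all add: P_def Q_def D_def)

text \<open>\<zeta> = v / cnj v is a fourth root of unity, hence fixed by the automorphism; so
  \<zeta>^2 is the norm of v divided by its complex conjugate, which is 1 for a norm of 1 or
  -1.\<close>

lemma unit_real_or_imaginary:
  assumes "gauss_ext d s" "unit_of (adj gauss_rat s) v"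
    "prime l" "l \<ge> 5" "d = l * d'" "\<not> l dvd d'"
    and \<nu>: "v * qconj gauss_rat s v = \<nu>" "\<nu> = 1 \<or> \<nu> = -1"
  shows "cnj v = v \<or> cnj v = - v"
proof -
  interpret gauss_ext d s by (rule assms(1))
  have v: "v \<in> adj gauss_rat s" "v \<noteq> 0" using assms(2) by (auto simp: unit_of_def)
  define \<zeta> where "\<zeta> = v / cnj v"
  have \<zeta>: "\<zeta> \<in> {1, -1, \<i>, -\<i>}" unfolding \<zeta>_def by (rule unit_div_cnj[OF assms(2-6)])
  hence \<zeta>I: "\<zeta> \<in> gauss_int" by (auto intro: gauss_int_intros)
  have "\<zeta> * \<zeta> = \<zeta> * qconj gauss_rat s \<zeta>" using \<zeta>I by simp
  also have "\<dots> = (v * qconj gauss_rat s v) / cnj (v * qconj gauss_rat s v)"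
    unfolding \<zeta>_def by (simp add: qconj_divide[OF v(1) cnj_M[OF v(1)]] cnj_\<tau>[OF v(1)])
  also have "\<dots> = 1" unfolding \<nu>(1) using \<nu>(2) by auto
  finally have "\<zeta> = 1 \<or> \<zeta> = -1" using \<zeta> by auto
  moreover have v\<zeta>: "v = \<zeta> * cnj v" using v(2) by (simp add: \<zeta>_def)
  ultimately show ?thesis
  proof (elim disjE)
    assume "\<zeta> = 1"
    thus ?thesis using v\<zeta> by simp
  next
    assume "\<zeta> = -1"
    hence "v = - cnj v" using v\<zeta> by simp
    hence "cnj v = - v" by (metis minus_minus)
    thus ?thesis by (rule disjI2)
  qed
qed

text \<open>Let r u = \<beta>^2. The relative norm of \<beta> to each intermediate field, divided by
  r, is a unit of norm \<nu>. By \<open>ii_not_norm\<close>, \<nu> is 1 or -1, so these units are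
  real or purely imaginary, and so is their product V. Since V r = \<nu> \<beta>^2, complex
  conjugation yields r cnj r = (r cnj \<beta> / \<beta>)^2 up to sign, and \<i> absorbs the
  sign.\<close>

lemma absolute_norm_square_in_K:
  assumes r: "r \<in> gauss_int" "r \<noteq> 0" and rK: "sq_equiv K r 1"
  shows "\<exists>z\<in>K. r * cnj r = z * z"
proof -
  obtain u \<beta> where u: "unit_of K u" "\<beta> \<in> K" "\<beta> \<noteq> 0" "r * u = \<beta> * \<beta>"
    using rK unfolding sq_equiv_def by auto
  obtain a b c d where co: "a \<in> gauss_rat" "b \<in> gauss_rat" "c \<in> gauss_rat" "d \<in> gauss_rat"
    and \<beta>: "\<beta> = a + b * P + c * Q + d * D" using K_coords[OF u(2)] .
  have uK': "u \<in> K" using u(1) by (simp add: unit_of_def)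
  obtain a' b' c' d' where co': "a' \<in> gauss_rat" "b' \<in> gauss_rat" "c' \<in> gauss_rat" "d' \<in> gauss_rat"
    and u': "u = a' + b' * P + c' * Q + d' * D"
    using K_coords[OF uK'] .
  define b0 where "b0 = a - b * P - c * Q + d * D"
  define b1 where "b1 = a + b * P - c * Q - d * D"
  define b2 where "b2 = a - b * P + c * Q - d * D"
  note cj = K_conjugates[OF co, folded \<beta> b0_def b1_def b2_def]
  have uK: "unit_of (adj k P) u" "unit_of (adj M1 Q) u" "unit_of (adj M2 P) u"
    using u(1) K_conjugates(3,5)[OF co'] unfolding u'[symmetric] unit_of_def K_def by auto
  have v0: "unit_of k (\<beta> * b0 / r)"
    using relative_norm_unit[OF gK.quad_ext_axioms gk.M_int[OF r(1)] r(2) uK(1) u(2)[unfolded K_def] u(3,4)]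
    unfolding cj(1) .
  have v1: "unit_of M1 (\<beta> * b1 / r)"
    using relative_norm_unit[OF gK1.quad_ext_axioms g1.M_int[OF r(1)] r(2) uK(2) cj(3) u(3,4)]
    unfolding cj(2) .
  have v2: "unit_of M2 (\<beta> * b2 / r)"
    using relative_norm_unit[OF gK2.quad_ext_axioms g2.M_int[OF r(1)] r(2) uK(3) cj(5) u(3,4)]
    unfolding cj(4) .
  define n where "n = \<beta> * b0 * b1 * b2"
  define \<nu> where "\<nu> = n / (r * r)"
  have sq: "P * P = of_nat p" "Q * Q = of_nat (2 * q)" "D * D = of_nat (2 * p * q)"
    by (rule g1.s_square g2.s_square gk.s_square)+
  note QC = subfield_add[OF gauss_rat_subfield] subfield_diff[OF gauss_rat_subfield]
    subfield_mult[OF gauss_rat_subfield] subfield_of_nat[OF gauss_rat_subfield]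
    subfield_numeral[OF gauss_rat_subfield] co
  \<comment> \<open>The conjugate of each relative norm is the product of the two remaining
    conjugates of \<beta>, so all three units have the same norm.\<close>
  have t0: "gk.\<tau> (\<beta> * b0) = b1 * b2"
  proof -
    define X where "X = a * a + d * d * (D * D) - b * b * (P * P) - c * c * (Q * Q)"
    define Y where "Y = 2 * a * d - 2 * b * c"
    have XY: "X \<in> gauss_rat" "Y \<in> gauss_rat" unfolding X_def Y_def sq by (intro QC)+
    have "\<beta> * b0 = X + Y * D" "b1 * b2 = X - Y * D"
      unfolding \<beta> b0_def b1_def b2_def X_def Y_def D_eq by (simp_all add: algebra_simps)
    thus ?thesis using gk.qconj_eq[OF XY] by simp
  qed
  have t1: "g1.\<tau> (\<beta> * b1) = b0 * b2"
  proof -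
    define X where "X = a * a + b * b * (P * P) - (Q * Q) * (c * c + d * d * (P * P))"
    define Y where "Y = 2 * a * b - 2 * (Q * Q) * c * d"
    have XY: "X \<in> gauss_rat" "Y \<in> gauss_rat" unfolding X_def Y_def sq by (intro QC)+
    have "\<beta> * b1 = X + Y * P" "b0 * b2 = X - Y * P"
      unfolding \<beta> b0_def b1_def b2_def X_def Y_def D_eq by (simp_all add: algebra_simps)
    thus ?thesis using g1.qconj_eq[OF XY] by simp
  qed
  have t2: "g2.\<tau> (\<beta> * b2) = b0 * b1"
  proof -
    define X where "X = a * a + c * c * (Q * Q) - (P * P) * (b * b + d * d * (Q * Q))"
    define Y where "Y = 2 * a * c - 2 * (P * P) * b * d"
    have XY: "X \<in> gauss_rat" "Y \<in> gauss_rat" unfolding X_def Y_def sq by (intro QC)+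
    have "\<beta> * b2 = X + Y * Q" "b0 * b1 = X - Y * Q"
      unfolding \<beta> b0_def b1_def b2_def X_def Y_def D_eq by (simp_all add: algebra_simps)
    thus ?thesis using g2.qconj_eq[OF XY] by simp
  qed
  have m0: "\<beta> * b0 \<in> k" using gK.norm_in_base[OF u(2)[unfolded K_def]] unfolding cj(1) .
  have m1: "\<beta> * b1 \<in> M1" using gK1.norm_in_base[OF cj(3)] unfolding cj(2) .
  have m2: "\<beta> * b2 \<in> M2" using gK2.norm_in_base[OF cj(5)] unfolding cj(4) .
  have n0: "\<beta> * b0 / r * gk.\<tau> (\<beta> * b0 / r) = \<nu>"
    unfolding gk.qconj_divide[OF m0 gk.M_int[OF r(1)]] t0 using r by (simp add: \<nu>_def n_def mult_ac)
  have n1: "\<beta> * b1 / r * g1.\<tau> (\<beta> * b1 / r) = \<nu>"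
    unfolding g1.qconj_divide[OF m1 g1.M_int[OF r(1)]] t1 using r by (simp add: \<nu>_def n_def mult_ac)
  have n2: "\<beta> * b2 / r * g2.\<tau> (\<beta> * b2 / r) = \<nu>"
    unfolding g2.qconj_divide[OF m2 g2.M_int[OF r(1)]] t2 using r by (simp add: \<nu>_def n_def mult_ac)
  have \<nu>4: "\<nu> \<in> {1, -1, \<i>, -\<i>}" using gk.norm_unit[OF v0] unfolding n0 .
  have "\<nu> \<notin> {\<i>, -\<i>}"
  proof
    assume "\<nu> \<in> {\<i>, -\<i>}"
    moreover have "\<beta> * b0 / r \<in> k" using v0 by (simp add: unit_of_def)
    ultimately show False
      using ii_not_norm[OF _ subfield_1[OF gauss_rat_subfield], of "\<beta> * b0 / r" \<nu>] n0 by simp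
  qed
  hence \<nu>: "\<nu> = 1 \<or> \<nu> = -1" using \<nu>4 by auto
  have nd: "\<not> p dvd 2 * q" using ndvd p by (simp add: prime_dvd_mult_iff)
  have c0: "cnj (\<beta> * b0 / r) = \<beta> * b0 / r \<or> cnj (\<beta> * b0 / r) = - (\<beta> * b0 / r)"
    by (rule unit_real_or_imaginary[OF gk.gauss_ext_axioms v0 p(1) ge5(1) _ nd n0 \<nu>]) simp
  have "\<not> p dvd 1" using ge5 by simp
  have c1: "cnj (\<beta> * b1 / r) = \<beta> * b1 / r \<or> cnj (\<beta> * b1 / r) = - (\<beta> * b1 / r)"
    by (rule unit_real_or_imaginary[OF g1.gauss_ext_axioms v1 p(1) ge5(1), where d' = 1, OF _ \<open>\<not> p dvd 1\<close> n1 \<nu>]) simp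
  have c2: "cnj (\<beta> * b2 / r) = \<beta> * b2 / r \<or> cnj (\<beta> * b2 / r) = - (\<beta> * b2 / r)"
    by (rule unit_real_or_imaginary[OF g2.gauss_ext_axioms v2 q(1) ge5(2) _ ndvd(2) n2 \<nu>]) simp
  define V where "V = (\<beta> * b0 / r) * (\<beta> * b1 / r) * (\<beta> * b2 / r)"
  have cV: "cnj V = V \<or> cnj V = - V" 
  proof -
    have "cnj V = cnj (\<beta> * b0 / r) * cnj (\<beta> * b1 / r) * cnj (\<beta> * b2 / r)"
      by (simp only: V_def complex_cnj_mult)
    thus ?thesis using c0 c1 c2 unfolding V_def
      by (elim disjE) (simp_all only: mult_minus_left mult_minus_right minus_minus simp_thms)
  qed
  have nrr: "n = \<nu> * (r * r)" using r by (simp add: \<nu>_def)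
  have "V * (r * r * r) = \<beta> * \<beta> * n" using r by (simp add: V_def n_def mult_ac)
  hence "V * r * (r * r) = \<beta> * \<beta> * \<nu> * (r * r)" unfolding nrr by (simp only: mult_ac)
  hence Vr: "V * r = \<beta> * \<beta> * \<nu>" using r(2) by simp
  have "cnj V * cnj r = cnj (V * r)" by simp
  also have "\<dots> = cnj \<beta> * cnj \<beta> * \<nu>" unfolding Vr using \<nu> by auto
  finally have cVr: "cnj V * cnj r = cnj \<beta> * cnj \<beta> * \<nu>" .
  have \<nu>0: "\<nu> \<noteq> 0" using \<nu> by auto
  have V0: "V \<noteq> 0" using Vr u(3) \<nu>0 by auto
  define z where "z = r * cnj \<beta> / \<beta>"
  have "z * z = r * r * (cnj \<beta> * cnj \<beta> * \<nu>) / (\<beta> * \<beta> * \<nu>)" using \<nu>0 by (simp add: z_def)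
  also have "\<dots> = r * r * (cnj V * cnj r) / (V * r)" unfolding Vr cVr ..
  finally have zz: "z * z = r * cnj r \<or> z * z = - (r * cnj r)" using cV r(2) V0 by auto
  have "cnj \<beta> = cnj a + cnj b * P + cnj c * Q + cnj d * D" unfolding \<beta> by (simp add: cnj_sqrt)
  moreover have "Q = D / P" using D_eq g1.s_nonzero by simp
  hence QK: "Q \<in> K" using subfield_divide[OF K_subfield k_K[OF gk.gen_in_adj] P_in_K] by simp
  have cK: "cnj x \<in> K" if "x \<in> gauss_rat" for x by (rule k_K[OF gk.base_subset[OF gauss_rat_cnj[OF that]]])
  ultimately have "cnj \<beta> \<in> K"
    using co P_in_K QK k_K[OF gk.gen_in_adj] by (auto intro!: subfield_add[OF K_subfield] subfield_mult[OF K_subfield])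
  hence zK: "z \<in> K" unfolding z_def
    by (intro subfield_divide[OF K_subfield] subfield_mult[OF K_subfield] k_K[OF gk.M_int[OF r(1)]] u(2))
  from zz show ?thesis
  proof
    assume "z * z = r * cnj r"
    thus ?thesis using zK by (intro bexI[of _ z]) simp_all
  next
    assume "z * z = - (r * cnj r)"
    moreover have "(\<i> * z) * (\<i> * z) = - (z * z)" by (simp add: algebra_simps)
    ultimately show ?thesis using subfield_mult[OF K_subfield k_K[OF k_ints(6)] zK]
      by (intro bexI[of _ "\<i> * z"]) simp_all
  qed
qed

text \<open>A natural number becomes a square in \<open>K\<close> only in the square classes of 1,
  p, 2 q and 2 p q, so 2 and q have exponents of equal parity in the norm of r. Thus
  \<open>lam\<close> occurs with exactly one prime above q, or is absent while both or none of these
  occur; \<open>lam_relation\<close> and q \<sim> p express each case by the primes above p.\<close>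

lemma radical_capitulating:
  assumes r: "gauss_radical r" "gauss_dvd r (of_nat (16 * p * p * q * q))" and rK: "sq_equiv K r 1"
  shows "\<exists>m n. sq_equiv k r (\<pi> ^ m * \<pi>' ^ n)"
proof -
  obtain \<nu> a0 a1 a2 a3 a4 where fac: "\<nu> \<in> {1, -1, \<i>, -\<i>}"
    "a0 \<le> 1" "a1 \<le> 1" "a2 \<le> 1" "a3 \<le> 1" "a4 \<le> (1 :: nat)"
    "r = \<nu> * (lam ^ a0 * \<pi> ^ a1 * \<pi>' ^ a2 * \<xi> ^ a3 * \<xi>' ^ a4)"
    "r * cnj r = of_nat (2 ^ a0 * p ^ (a1 + a2) * q ^ (a3 + a4))"
    using radical_factorization[OF r] by metis
  have "r \<in> gauss_int" "r \<noteq> 0" using r(1) by (auto simp: gauss_radical_def)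
  from absolute_norm_square_in_K[OF this rK] obtain z where z: "z \<in> K" "r * cnj r = z * z" by blast
  define N where "N = 2 ^ a0 * p ^ (a1 + a2) * q ^ (a3 + a4)"
  have "of_nat N = z * z" using z(2) fac(8) by (simp add: N_def)
  from square_in_K[OF this z(1)] obtain m
    where "N = m * m \<or> N * (2 * p * q) = m * m \<or> N * p = m * m \<or> N * p * (2 * p * q) = m * m" by blast
  hence "even (a0 + (a3 + a4))"
  proof (elim disjE)
    assume "N = m * m"
    from square_exponents[OF this[unfolded N_def]] show ?thesis by simp
  next
    assume "N * (2 * p * q) = m * m"
    hence "2 ^ (a0 + 1) * p ^ (a1 + a2 + 1) * q ^ (a3 + a4 + 1) = m * m" by (simp add: N_def mult_ac)
    from square_exponents[OF this] show ?thesis by simp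
  next
    assume "N * p = m * m"
    hence "2 ^ a0 * p ^ (a1 + a2 + 1) * q ^ (a3 + a4) = m * m" by (simp add: N_def mult_ac)
    from square_exponents[OF this] show ?thesis by simp
  next
    assume "N * p * (2 * p * q) = m * m"
    hence "2 ^ (a0 + 1) * p ^ (a1 + a2 + 2) * q ^ (a3 + a4 + 1) = m * m" by (simp add: N_def mult_ac power2_eq_square)
    from square_exponents[OF this] show ?thesis by simp
  qed
  hence ev: "a0 = 0 \<and> a3 = 0 \<and> a4 = 0 \<or> a0 = 0 \<and> a3 = 1 \<and> a4 = 1
      \<or> a0 = 1 \<and> a3 = 1 \<and> a4 = 0 \<or> a0 = 1 \<and> a3 = 0 \<and> a4 = 1"
    using fac(2-6) by presburger
  define y where "y = lam ^ a0 * \<xi> ^ a3 * \<xi>' ^ a4"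
  have y: "\<exists>i j. sq_equiv k y (\<pi> ^ i * \<pi>' ^ j)"
    using ev
  proof (elim disjE conjE)
    assume "a0 = 0" "a3 = 0" "a4 = 0"
    hence "y = \<pi> ^ 0 * \<pi>' ^ 0" by (simp add: y_def)
    hence "sq_equiv k y (\<pi> ^ 0 * \<pi>' ^ 0)" by (simp only: sq_equiv_refl[OF k_subfield])
    thus ?thesis by (intro exI)
  next
    assume "a0 = 0" "a3 = 1" "a4 = 1"
    hence "y = of_nat q" using norms(2) by (simp add: y_def)
    hence "sq_equiv k y (\<pi> ^ 1 * \<pi>' ^ 1)" using sq_equiv_q_p norms(1) by simp
    thus ?thesis by blast
  next
    assume "a0 = 1" "a3 = 1" "a4 = 0"
    hence "y = lam * \<xi>" by (simp add: y_def)
    hence "sq_equiv k y (\<pi> ^ 1 * \<pi>' ^ 0) \<or> sq_equiv k y (\<pi> ^ 0 * \<pi>' ^ 1)" using lam_relation by auto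
    thus ?thesis by blast
  next
    assume "a0 = 1" "a3 = 0" "a4 = 1"
    hence "y = lam * \<xi>'" by (simp add: y_def)
    hence "sq_equiv k y (\<pi> ^ 1 * \<pi>' ^ 0) \<or> sq_equiv k y (\<pi> ^ 0 * \<pi>' ^ 1)" using lam_relation by auto
    thus ?thesis by blast
  qed
  then obtain i j where ij: "sq_equiv k y (\<pi> ^ i * \<pi>' ^ j)" by blast
  have "r = (\<pi> ^ a1 * \<pi>' ^ a2) * y * \<nu>" unfolding fac(7) y_def by (simp only: mult_ac)
  hence 1: "sq_equiv k r ((\<pi> ^ a1 * \<pi>' ^ a2) * y)"
    using sq_equiv_unit[OF k_subfield unit_k[OF fac(1)]] by (simp only:)
  have 2: "sq_equiv k ((\<pi> ^ a1 * \<pi>' ^ a2) * y) ((\<pi> ^ a1 * \<pi>' ^ a2) * (\<pi> ^ i * \<pi>' ^ j))"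
    by (rule sq_equiv_mult[OF k_subfield sq_equiv_refl[OF k_subfield] ij])
  have "sq_equiv k r ((\<pi> ^ a1 * \<pi>' ^ a2) * (\<pi> ^ i * \<pi>' ^ j))"
    by (rule sq_equiv_trans[OF k_subfield 1 2])
  moreover have "(\<pi> ^ a1 * \<pi>' ^ a2) * (\<pi> ^ i * \<pi>' ^ j) = \<pi> ^ (a1 + i) * \<pi>' ^ (a2 + j)"
    by (simp add: power_add mult_ac)
  ultimately show ?thesis by metis
qed

section \<open>Independence of the primes above p in \<open>k\<close>\<close>

lemma half_discriminant: "2 * p * q = p * (2 * q)" "\<not> p dvd 2 * q"
  using ndvd p by (simp_all add: prime_dvd_mult_iff)

text \<open>From x u = c^2 the element w = x cnj c / c has square p cnj u / u, where cnj u / u is a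
  fourth root of unity by \<open>unit_div_cnj\<close>. Multiplying w by \<i> or \<open>lam\<close>
  as needed turns the square into p or 2 p, neither of which is a square in
  \<open>k\<close>.\<close>

lemma prime_not_square_unit:
  assumes x: "x \<in> k" "x * cnj x = of_nat p" shows "\<not> sq_equiv k x 1"
proof
  assume "sq_equiv k x 1"
  then obtain u c where u: "unit_of k u" "c \<in> k" "c \<noteq> 0" "x * u = c * c"
    unfolding sq_equiv_def by auto
  have u0: "u \<noteq> 0" using u(1) by (simp add: unit_of_def)
  have x0: "x \<noteq> 0" using x(2) nonzero_pq(1) by auto
  have "u / cnj u \<in> {1, -1, \<i>, -\<i>}"
    by (rule gk.unit_div_cnj[OF u(1) p(1) ge5(1) half_discriminant])
  moreover have "cnj z \<in> {1, -1, \<i>, -\<i>}" if "z \<in> {1, -1, \<i>, -\<i>}" for z using that by auto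
  ultimately have "cnj (u / cnj u) \<in> {1, -1, \<i>, -\<i>}" by blast
  hence \<zeta>: "cnj u / u \<in> {1, -1, \<i>, -\<i>}" by simp
  define w where "w = x * cnj c / c"
  have wk: "w \<in> k" unfolding w_def
    by (rule subfield_divide[OF k_subfield subfield_mult[OF k_subfield x(1) gk.cnj_M[OF u(2)]] u(2)])
  have "cnj c * cnj c = cnj x * cnj u" using arg_cong[OF u(4), of cnj] by simp
  moreover have "w * w = x * x * (cnj c * cnj c) / (c * c)" by (simp add: w_def mult_ac)
  ultimately have "w * w = x * x * (cnj x * cnj u) / (x * u)" using u(4) by simp
  also have "\<dots> = (x * cnj x) * (cnj u / u)" using x0 u0 by simp
  finally have ww: "w * w = of_nat p * (cnj u / u)" unfolding x(2) .
  have sq: False if "of_nat p = z * z \<or> of_nat (2 * p) = z * z" "z \<in> k" for z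
  proof -
    have 1: "p \<noteq> m * m" "p * (2 * p * q) \<noteq> m * m" "2 * p \<noteq> m * m" "2 * p * (2 * p * q) \<noteq> m * m" for m
    proof -
      show "p \<noteq> m * m" "2 * p \<noteq> m * m" by (rule nonsq)+
      show "p * (2 * p * q) \<noteq> m * m" using square_exponents(1)[of 1 2 1 m] by (auto simp: power2_eq_square mult_ac)
      show "2 * p * (2 * p * q) \<noteq> m * m" using square_exponents(3)[of 2 2 1 m] by (auto simp: power2_eq_square mult_ac)
    qed
    from that(1) show False
    proof
      assume "of_nat p = z * z"
      from square_in_k[OF this that(2)] show False using 1 by blast
    next
      assume "of_nat (2 * p) = z * z"
      from square_in_k[OF this that(2)] show False using 1 by blast
    qed
  qed
  have iw: "\<i> * w \<in> k" "lam * w \<in> k" "\<i> * (lam * w) \<in> k"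
    by (intro subfield_mult[OF k_subfield] k_ints wk)+
  have sqs: "(\<i> * w) * (\<i> * w) = - (w * w)" "(lam * w) * (lam * w) = 2 * \<i> * (w * w)"
      "(\<i> * (lam * w)) * (\<i> * (lam * w)) = - (2 * \<i> * (w * w))"
  proof -
    show "(\<i> * w) * (\<i> * w) = - (w * w)" by (simp add: algebra_simps)
    have "(lam * w) * (lam * w) = (lam * lam) * (w * w)" by (simp only: mult_ac)
    thus 1: "(lam * w) * (lam * w) = 2 * \<i> * (w * w)" unfolding norms(4) .
    have "(\<i> * (lam * w)) * (\<i> * (lam * w)) = - ((lam * w) * (lam * w))" by (simp add: algebra_simps)
    thus "(\<i> * (lam * w)) * (\<i> * (lam * w)) = - (2 * \<i> * (w * w))" unfolding 1 .
  qed
  from \<zeta> consider "cnj u / u = 1" | "cnj u / u = -1" | "cnj u / u = \<i>" | "cnj u / u = -\<i>" by auto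
  thus False
  proof cases
    case 1
    thus False using sq[of w] ww wk by simp
  next
    case 2
    thus False using sq[of "\<i> * w"] sqs(1) ww iw by simp
  next
    case 3
    hence "- (2 * \<i> * (w * w)) = of_nat (2 * p)" unfolding ww by (simp add: algebra_simps)
    thus False using sq[of "\<i> * (lam * w)"] sqs(3) iw by simp
  next
    case 4
    hence "2 * \<i> * (w * w) = of_nat (2 * p)" unfolding ww by (simp add: algebra_simps)
    thus False using sq[of "lam * w"] sqs(2) iw by simp
  qed
qed

text \<open>The two primes above p and their product p all have nontrivial square classes, so the
  two classes are independent over the field with two elements.\<close>

lemma monomial_square_unit:
  assumes "sq_equiv k (\<pi> ^ m * \<pi>' ^ n) 1" shows "even m \<and> even n"
proof -
  define y where "y = \<pi> ^ (m div 2) * \<pi>' ^ (n div 2)"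
  define x where "x = \<pi> ^ (m mod 2) * \<pi>' ^ (n mod 2)"
  have yk: "y \<in> k" "y \<noteq> 0"
    unfolding y_def using nonzeros by (auto intro!: gk.M_int gauss_int_mult gauss_int_power ints)
  have half: "z ^ l = z ^ (l mod 2) * (z ^ (l div 2) * z ^ (l div 2))" for z :: complex and l :: nat
  proof -
    have "z ^ l = z ^ (l mod 2 + (l div 2 + l div 2))" by (simp add: mult_2[symmetric])
    thus ?thesis by (simp only: power_add)
  qed
  have "\<pi> ^ m * \<pi>' ^ n = x * (y * y)"
    unfolding x_def y_def by (subst half[of \<pi> m], subst half[of \<pi>' n]) (simp only: mult_ac)
  hence "sq_equiv k (\<pi> ^ m * \<pi>' ^ n) x" using sq_equiv_square[OF k_subfield yk, of x] by simp
  from sq_equiv_trans[OF k_subfield sq_equiv_sym[OF k_subfield this] assms]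
  have x1: "sq_equiv k x 1" .
  have 1: "\<not> sq_equiv k \<pi> 1" by (rule prime_not_square_unit[OF k_ints(1)]) (simp add: norms(1) \<pi>'[symmetric])
  have 2: "\<not> sq_equiv k \<pi>' 1"
    by (rule prime_not_square_unit[OF k_ints(2)]) (simp add: \<pi>' mult.commute[of "cnj \<pi>"] norms(1)[unfolded \<pi>'])
  have "m mod 2 = 0 \<or> m mod 2 = 1" "n mod 2 = 0 \<or> n mod 2 = 1" by presburger+
  thus ?thesis
  proof (elim disjE)
    assume "m mod 2 = 0" "n mod 2 = 0"
    thus ?thesis by presburger
  next
    assume "m mod 2 = 0" "n mod 2 = 1"
    thus ?thesis using x1 2 by (simp add: x_def)
  next
    assume "m mod 2 = 1" "n mod 2 = 0"
    thus ?thesis using x1 1 by (simp add: x_def)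
  next
    assume "m mod 2 = 1" "n mod 2 = 1"
    thus ?thesis using x1 p_not_square_unit norms(1) by (simp add: x_def)
  qed
qed

section \<open>The capitulation kernel\<close>

abbreviation "Rk \<equiv> ring_of_integers k"
abbreviation "RK \<equiv> ring_of_integers K"

lemma trace_one:
  obtains \<omega> where "\<omega> \<in> ring_of_integers (adj k P)" "\<omega> + qconj k P \<omega> = 1"
proof
  let ?\<omega> = "1 / 2 + 1 / 2 * P"
  have h: "1 / 2 \<in> k" using subfield_divide[OF k_subfield subfield_1[OF k_subfield] subfield_numeral[OF k_subfield]] by blast
  show "?\<omega> + qconj k P ?\<omega> = 1" unfolding gK.qconj_eq[OF h h] by simp
  define j where "j = p div 4"
  have "p = 4 * j + 1" using p(2) by (simp add: j_def) presburger
  hence "complex_of_nat p = of_nat (4 * j + 1)" by (rule arg_cong)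
  hence PP: "P * P = 4 * of_nat j + 1" unfolding g1.s_square by simp
  have "?\<omega> * ?\<omega> - ?\<omega> = (P * P - 1) / 4" by (simp add: field_simps)
  hence "?\<omega> * ?\<omega> - 1 * ?\<omega> + (- of_nat j) = 0" unfolding PP by simp
  hence "alg_int ?\<omega>" by (intro alg_int_quadratic[of 1 "- of_nat j"] gauss_int_intros)
  thus "?\<omega> \<in> ring_of_integers (adj k P)" by (rule ring_of_integersI[OF adjI[OF h h]])
qed

lemma capitulates_iff:
  assumes I: "nonzero_ideal Rk I"
  shows "is_principal RK (gen_ideal RK I) \<longleftrightarrow>
    (\<exists>a m n. square_gen Rk I a \<and> sq_equiv k a (\<pi> ^ m * \<pi>' ^ n))"
proof
  assume pr: "is_principal RK (gen_ideal RK I)"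
  obtain \<omega> where \<omega>: "\<omega> \<in> ring_of_integers (adj k P)" "\<omega> + qconj k P \<omega> = 1" using trace_one .
  from gK.capitulation_square[OF I pr[unfolded K_def] \<omega>]
  obtain a where a: "square_gen Rk I a" "sq_equiv K a 1" unfolding K_def by blast
  have ak: "a \<in> k" "a \<noteq> 0" using square_genD(2,3)[OF a(1)] by (auto simp: ring_of_integers_def)
  obtain \<nu> n where n: "\<nu> \<in> {1, -1, \<i>, -\<i>}" "n \<in> gauss_int" "n \<noteq> 0" "a * gk.\<tau> a = \<nu> * (n * n)"
    using gk.square_gen_norm[OF a(1)] by blast
  have "\<nu> \<notin> {\<i>, -\<i>}" using ii_not_norm[OF ak(1) gauss_int_rat[OF n(2)] n(3)] n(4) by blast
  hence "\<nu> = 1 \<or> \<nu> = -1" using n(1) by auto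
  \<comment> \<open>\<tau> fixes \<i>, so v has norm v^2, and the norm of a v becomes exactly n^2,
    as Hilbert 90 requires.\<close>
  then obtain v where v: "v = 1 \<or> v = \<i>" "(v * v) * \<nu> = 1"
  proof
    assume "\<nu> = 1"
    thus ?thesis by (intro that[of 1]) simp_all
  next
    assume "\<nu> = -1"
    thus ?thesis by (intro that[of \<i>]) simp_all
  qed
  have vI: "v \<in> gauss_int" using v(1) by auto
  have vu: "unit_of k v" by (rule unit_k) (use v(1) in auto)
  have av: "a * v \<in> k" "a * v \<noteq> 0" using subfield_mult[OF k_subfield ak(1) gk.M_int[OF vI]] ak v(1) by auto
  have "(a * v) * gk.\<tau> (a * v) = (a * gk.\<tau> a) * (v * v)"
    unfolding gk.qconj_mult[OF ak(1) gk.M_int[OF vI]] using vI by (simp add: mult_ac)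
  also have "\<dots> = ((v * v) * \<nu>) * (n * n)" unfolding n(4) by (simp only: mult_ac)
  finally have nn: "(a * v) * gk.\<tau> (a * v) = n * n" unfolding v(2) by simp
  obtain r where r: "r \<in> gauss_rat" "r \<noteq> 0" "sq_equiv k (a * v) r"
    using gk.sq_equiv_of_norm_square[OF av gauss_int_rat[OF n(2)] n(3) nn] by blast
  obtain r0 where r0: "gauss_radical r0" "sq_equiv k r r0" using gk.sq_equiv_radical[OF r(1,2)] by blast
  have "sq_equiv k a (a * v)" by (rule sq_equiv_sym[OF k_subfield sq_equiv_unit[OF k_subfield vu]])
  from sq_equiv_trans[OF k_subfield this sq_equiv_trans[OF k_subfield r(3) r0(2)]]
  have ar0: "sq_equiv k a r0" .
  have "gauss_dvd r0 (of_nat (4 * (2 * p * q) * (2 * p * q)))"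
    by (rule gk.radical_divides_disc[OF r0(1) a(1) ar0])
  moreover have "4 * (2 * p * q) * (2 * p * q) = 16 * p * p * q * q" by simp
  ultimately have dv: "gauss_dvd r0 (of_nat (16 * p * p * q * q))" by metis
  have "sq_equiv K r0 1"
    by (rule sq_equiv_trans[OF K_subfield sq_equiv_sym[OF K_subfield sq_equiv_kK[OF ar0]] a(2)])
  from radical_capitulating[OF r0(1) dv this]
  obtain m l where "sq_equiv k r0 (\<pi> ^ m * \<pi>' ^ l)" by blast
  from sq_equiv_trans[OF k_subfield ar0 this]
  show "\<exists>a m n. square_gen Rk I a \<and> sq_equiv k a (\<pi> ^ m * \<pi>' ^ n)" using a(1) by blast
next
  assume "\<exists>a m n. square_gen Rk I a \<and> sq_equiv k a (\<pi> ^ m * \<pi>' ^ n)"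
  then obtain a m n where a: "square_gen Rk I a" "sq_equiv k a (\<pi> ^ m * \<pi>' ^ n)" by blast
  have aK: "sq_equiv K a 1"
    by (rule sq_equiv_trans[OF K_subfield sq_equiv_kK[OF a(2)] sq_equiv_K_monomial])
  show "is_principal RK (gen_ideal RK I)"
    by (rule sq_equiv_1_imp_principal[OF k_subfield refl K_subfield _ a(1) aK]) (use k_K in blast)
qed

lemma sq_equiv_power: "sq_equiv k x y \<Longrightarrow> sq_equiv k (x ^ n) (y ^ n)"
  by (induction n) (simp_all add: sq_equiv_refl[OF k_subfield] sq_equiv_mult[OF k_subfield])

text \<open>Both orders of the pairing are allowed, since \<open>lam_relation\<close> does not
  decide them. Exponents matter modulo 2 only, and \<open>monomial_square_unit\<close> keeps the
  four remaining classes distinct.\<close>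

theorem capitulation_kernel:
  assumes A: "square_gen Rk A a" and B: "square_gen Rk B b"
    and ab: "sq_equiv k a \<pi> \<and> sq_equiv k b \<pi>' \<or> sq_equiv k a \<pi>' \<and> sq_equiv k b \<pi>"
  shows "cap_kernel Rk RK = class_subgroup2 Rk A B \<and> card (cap_kernel Rk RK) = 4"
proof -
  have R: "subring_set Rk" by (rule ring_of_integers_subring[OF k_subfield])
  have ak: "a \<in> k" "a \<noteq> 0" "b \<in> k" "b \<noteq> 0"
    using square_genD(2,3)[OF A] square_genD(2,3)[OF B] by (auto simp: ring_of_integers_def)
  define C where "C = (\<lambda>m n. ideal_mult Rk (ideal_pow Rk A m) (ideal_pow Rk B n))"
  have C: "square_gen Rk (C m n) (a ^ m * b ^ n)" for m n
    unfolding C_def by (rule square_gen_mult[OF R square_gen_pow[OF R A] square_gen_pow[OF R B]])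
  have Cn: "nonzero_ideal Rk (C m n)" for m n by (rule square_gen_nonzero[OF R C])
  have sub: "class_subgroup2 Rk A B = {ideal_class Rk (C m n) | m n. True}"
    unfolding class_subgroup2_def C_def ..
  have conv: "\<exists>m' n'. sq_equiv k (a ^ m * b ^ n) (\<pi> ^ m' * \<pi>' ^ n') \<and>
      sq_equiv k (\<pi> ^ m * \<pi>' ^ n) (a ^ m' * b ^ n') \<and> (even m' \<and> even n' \<longleftrightarrow> even m \<and> even n)" for m n
    using ab
  proof (elim disjE conjE)
    assume 1: "sq_equiv k a \<pi>" "sq_equiv k b \<pi>'"
    have 2: "sq_equiv k (a ^ m * b ^ n) (\<pi> ^ m * \<pi>' ^ n)"
      by (rule sq_equiv_mult[OF k_subfield sq_equiv_power[OF 1(1)] sq_equiv_power[OF 1(2)]])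
    show ?thesis using 2 sq_equiv_sym[OF k_subfield 2] by (intro exI[of _ m] exI[of _ n] conjI refl)
  next
    assume 1: "sq_equiv k a \<pi>'" "sq_equiv k b \<pi>"
    have 2: "sq_equiv k (a ^ m * b ^ n) (\<pi>' ^ m * \<pi> ^ n)" for m n
      by (rule sq_equiv_mult[OF k_subfield sq_equiv_power[OF 1(1)] sq_equiv_power[OF 1(2)]])
    have "sq_equiv k (a ^ m * b ^ n) (\<pi> ^ n * \<pi>' ^ m)" using 2[of m n] by (simp only: mult.commute)
    moreover have "sq_equiv k (\<pi> ^ m * \<pi>' ^ n) (a ^ n * b ^ m)"
      using sq_equiv_sym[OF k_subfield 2[of n m]] by (simp only: mult.commute)
    ultimately show ?thesis by (intro exI[of _ n] exI[of _ m]) auto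
  qed
  have even: "even m \<and> even n" if "sq_equiv k (a ^ m * b ^ n) 1" for m n
  proof -
    obtain m' n' where 1: "sq_equiv k (a ^ m * b ^ n) (\<pi> ^ m' * \<pi>' ^ n')" "even m' \<and> even n' \<longleftrightarrow> even m \<and> even n"
      using conv[of m n] by blast
    from sq_equiv_trans[OF k_subfield sq_equiv_sym[OF k_subfield 1(1)] that]
    show ?thesis using monomial_square_unit 1(2) by blast
  qed
  have class_eq: "ideal_class Rk I = ideal_class Rk J"
    if "square_gen Rk I x" "square_gen Rk J y" "sq_equiv k x y" for I J x y
    unfolding ideal_class_eq_iff[OF R square_gen_nonzero[OF R that(1)] square_gen_nonzero[OF R that(2)]]
    by (rule sq_equiv_imp_ideal_equiv[OF k_subfield refl that])
  have "cap_kernel Rk RK = {ideal_class Rk (C m n) | m n. True}"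
  proof (intro equalityI subsetI)
    fix c assume "c \<in> cap_kernel Rk RK"
    then obtain I where I: "nonzero_ideal Rk I" "c = ideal_class Rk I" "is_principal RK (gen_ideal RK I)"
      unfolding cap_kernel_def by blast
    obtain x m n where x: "square_gen Rk I x" "sq_equiv k x (\<pi> ^ m * \<pi>' ^ n)"
      using capitulates_iff[OF I(1)] I(3) by blast
    obtain m' n' where 1: "sq_equiv k (\<pi> ^ m * \<pi>' ^ n) (a ^ m' * b ^ n')" using conv[of m n] by blast
    have "c = ideal_class Rk (C m' n')"
      unfolding I(2) by (rule class_eq[OF x(1) C sq_equiv_trans[OF k_subfield x(2) 1]])
    thus "c \<in> {ideal_class Rk (C m n) | m n. True}" by blast
  next
    fix c assume "c \<in> {ideal_class Rk (C m n) | m n. True}"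
    then obtain m n where c: "c = ideal_class Rk (C m n)" by blast
    obtain m' n' where "sq_equiv k (a ^ m * b ^ n) (\<pi> ^ m' * \<pi>' ^ n')" using conv[of m n] by blast
    hence "is_principal RK (gen_ideal RK (C m n))" using capitulates_iff[OF Cn] C by blast
    thus "c \<in> cap_kernel Rk RK" unfolding cap_kernel_def class_group_def c using Cn by blast
  qed
  moreover have "{ideal_class Rk (C m n) | m n. True} = (\<lambda>(m, n). ideal_class Rk (C m n)) ` ({0, 1} \<times> {0, 1})"
  proof (intro equalityI subsetI)
    fix c assume "c \<in> {ideal_class Rk (C m n) | m n. True}"
    then obtain m n where c: "c = ideal_class Rk (C m n)" by blast
    define y where "y = a ^ (m div 2) * b ^ (n div 2)"
    have y: "y \<in> k" "y \<noteq> 0"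
    proof -
      have "x ^ i \<in> k" if "x \<in> k" for x i
        using that by (induction i) (simp_all add: subfield_1[OF k_subfield] subfield_mult[OF k_subfield])
      thus "y \<in> k" unfolding y_def using ak by (intro subfield_mult[OF k_subfield])
      show "y \<noteq> 0" unfolding y_def using ak by simp
    qed
    have half: "z ^ l = z ^ (l mod 2) * (z ^ (l div 2) * z ^ (l div 2))" for z :: complex and l :: nat
    proof -
      have "z ^ l = z ^ (l mod 2 + (l div 2 + l div 2))" by (simp add: mult_2[symmetric])
      thus ?thesis by (simp only: power_add)
    qed
    have "a ^ m * b ^ n = a ^ (m mod 2) * b ^ (n mod 2) * (y * y)"
      unfolding y_def by (subst half[of a m], subst half[of b n]) (simp only: mult_ac)
    hence "sq_equiv k (a ^ m * b ^ n) (a ^ (m mod 2) * b ^ (n mod 2))"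
      using sq_equiv_square[OF k_subfield y] by (simp only:)
    hence "c = ideal_class Rk (C (m mod 2) (n mod 2))" unfolding c by (rule class_eq[OF C C])
    moreover have "(m mod 2, n mod 2) \<in> {0, 1} \<times> {0, 1}" by auto
    ultimately show "c \<in> (\<lambda>(m, n). ideal_class Rk (C m n)) ` ({0, 1} \<times> {0, 1})" by (metis (no_types, lifting) case_prod_conv image_eqI)
  qed auto
  moreover have "inj_on (\<lambda>(m, n). ideal_class Rk (C m n)) ({0, 1} \<times> {0, 1})"
  proof (rule inj_onI, clarify)
    fix m n m' n' :: nat
    assume mem: "m \<in> {0, 1}" "n \<in> {0, 1}" "m' \<in> {0, 1}" "n' \<in> {0, 1}"
      and "ideal_class Rk (C m n) = ideal_class Rk (C m' n')"
    hence "ideal_equiv Rk (C m n) (C m' n')" using ideal_class_eq_iff[OF R Cn Cn] by simp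
    from ideal_equiv_imp_sq_equiv[OF k_subfield refl C C this]
    have e: "sq_equiv k (a ^ m * b ^ n) (a ^ m' * b ^ n')" .
    define y where "y = a ^ m' * b ^ n'"
    have "y \<in> Rk" unfolding y_def by (rule square_genD(2)[OF C])
    hence y: "y \<in> k" "y \<noteq> 0" using square_genD(3)[OF C, of m' n'] by (simp_all add: y_def ring_of_integers_def)
    \<comment> \<open>Multiplying by y instead of dividing changes the quotient by a square only;
      exponents from {0, 1} with an even sum are equal.\<close>
    have "sq_equiv k ((a ^ m * b ^ n) * y) (1 * (y * y))"
      using sq_equiv_mult[OF k_subfield e sq_equiv_refl[OF k_subfield, of y]] by (simp add: y_def)
    from sq_equiv_trans[OF k_subfield this sq_equiv_square[OF k_subfield y]]
    have "sq_equiv k ((a ^ m * b ^ n) * y) 1" .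
    hence "sq_equiv k (a ^ (m + m') * b ^ (n + n')) 1" by (simp add: y_def power_add mult_ac)
    from even[OF this] show "m = m' \<and> n = n'" using mem by auto
  qed
  ultimately show ?thesis unfolding sub by (simp add: card_image)
qed

end

section \<open>From generated subfields to the theorem\<close>

lemma gauss_rat_subset:
  assumes "is_subfield F" "\<i> \<in> F" shows "gauss_rat \<subseteq> F"
proof
  fix z assume z: "z \<in> gauss_rat"
  have "complex_of_real x \<in> \<rat>" if "x \<in> \<rat>" for x
    using that by (rule Rats_cases) simp
  hence "complex_of_real (Re z) \<in> \<rat>" "complex_of_real (Im z) \<in> \<rat>"
    using z unfolding gauss_rat_def by simp_all
  from this[THEN subfield_Rats[OF assms(1)]]
  have "complex_of_real (Re z) + \<i> * complex_of_real (Im z) \<in> F"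
    by (intro subfield_add[OF assms(1)] subfield_mult[OF assms(1) assms(2)])
  moreover have "complex_of_real (Re z) + \<i> * complex_of_real (Im z) = z" by (simp add: complex_eq_iff)
  ultimately show "z \<in> F" by simp
qed

lemma adj_subset: "is_subfield F \<Longrightarrow> E \<subseteq> F \<Longrightarrow> w \<in> F \<Longrightarrow> adj E w \<subseteq> F"
  unfolding adj_def by (auto intro!: subfield_add subfield_mult)

lemma subfield_gen_eqI:
  assumes "is_subfield F" "S \<subseteq> F" "\<And>F'. is_subfield F' \<Longrightarrow> S \<subseteq> F' \<Longrightarrow> F \<subseteq> F'"
  shows "subfield_gen S = F"
  unfolding subfield_gen_def using assms by blast

lemma Legendre_eq_minus_one: "Legendre a l = -1 \<Longrightarrow> \<not> QuadRes l a"
  by (auto simp: Legendre_def split: if_splits)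

lemma QuadRes_reciprocity:
  fixes p q :: nat
  assumes "prime p" "prime q" "p mod 4 = 1" "q mod 4 = 1" "p \<noteq> q"
  shows "QuadRes p q \<longleftrightarrow> QuadRes q p"
proof -
  have "l > 2" if "prime l" "l mod 4 = 1" for l :: nat
    using prime_ge_2_nat[OF that(1)] that(2) by (cases "l = 2") auto
  hence "2 < p" "2 < q" using assms by auto
  hence "Legendre p q * Legendre q p = (-1 :: int) ^ ((p - 1) div 2 * ((q - 1) div 2))"
    using Quadratic_Reciprocity assms by blast
  moreover have "even ((p - 1) div 2)" using assms(3) by presburger
  ultimately have eq: "Legendre p q * Legendre q p = 1" by simp
  have nz: "Legendre (int a) (int l) = (if QuadRes l a then 1 else -1)" if "prime a" "prime l" "a \<noteq> l" for a l :: nat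
  proof -
    have "\<not> l dvd a" using primes_dvd_imp_eq[OF that(2,1)] that(3) by auto
    thus ?thesis by (simp add: Legendre_def cong_0_iff)
  qed
  show ?thesis using eq nz[OF assms(1,2,5)] nz[OF assms(2,1) assms(5)[symmetric]] by (auto split: if_splits)
qed

lemma gauss_prime_radical:
  assumes "gauss_prime \<rho> l" shows "gauss_radical \<rho>"
  unfolding gauss_radical_def
proof (intro conjI ballI impI)
  show "\<rho> \<in> gauss_int" using assms unfolding gauss_prime_def by blast
  show "\<rho> \<noteq> 0" using assms by (rule gauss_prime_nonzero)
  show "gauss_dvd \<rho> x" if "x \<in> gauss_int" "gauss_dvd \<rho> (x * x)" for x
    using gauss_prime_dvd_mult[OF assms that(1,1,2)] by blast
qed

text \<open>The theorem does not exclude \<open>p\<^sub>1 = p\<^sub>2\<close>. In that case \<open>k\<close> is the eighth cyclotomic field, in which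
  no odd prime ramifies, so the ideal \<open>H\<^sub>1\<close> does not exist.\<close>
lemma equal_primes_impossible:
  assumes p: "prime p" "p mod 4 = 1" and H: "square_gen (ring_of_integers k) H \<pi>1"
    and k: "k = subfield_gen {complex_of_real (sqrt (real (2 * p * p))), \<i>}"
    and \<pi>1: "gauss_prime \<pi>1 p"
  shows False
proof -
  define s where "s = complex_of_real (sqrt (real 2))"
  have ns: "2 \<noteq> m * m" for m :: nat
    using nat_odd_exponent_nonsquare[of 2 1 m] two_is_prime_nat by simp
  interpret gauss_ext 2 s by unfold_locales (use ns in \<open>simp_all add: s_def\<close>)
  have p0: "complex_of_nat p \<noteq> 0" using prime_gt_0_nat[OF p(1)] by simp
  have "sqrt (real (2 * p * p)) = real p * sqrt (real 2)" by (simp add: real_sqrt_mult)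
  hence ps: "complex_of_real (sqrt (real (2 * p * p))) = of_nat p * s" unfolding s_def by simp
  have "k = M"
    unfolding k ps
  proof (rule subfield_gen_eqI[OF adj_subfield])
    show "{of_nat p * s, \<i>} \<subseteq> M"
      using gen_in_adj M_int[OF gauss_int_ii] M_closed by auto
    fix F' assume F': "is_subfield F'" "{of_nat p * s, \<i>} \<subseteq> F'"
    hence "(of_nat p * s) / of_nat p \<in> F'" by (intro subfield_divide subfield_of_nat) auto
    hence "s \<in> F'" using p0 by simp
    thus "M \<subseteq> F'" using F' by (intro adj_subset gauss_rat_subset) auto
  qed
  \<comment> \<open>The bound \<open>4 * d * d\<close> is 16 for d = 2, and no odd prime divides
    it.\<close>
  hence "gauss_dvd \<pi>1 (of_nat (4 * 2 * 2))"
    using radical_divides_disc[OF gauss_prime_radical[OF \<pi>1]] H sq_equiv_refl[OF adj_subfield] by simp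
  hence "int p dvd 16" using gauss_prime_dvd_of_int[OF \<pi>1, of 16] by simp
  hence "int p dvd int (2 ^ 4)" by simp
  hence "p dvd 2 ^ 4" by (simp only: of_nat_dvd_iff)
  hence "p dvd 2" by (rule prime_dvd_power[OF p(1)])
  hence "p = 2" using primes_dvd_imp_eq[OF p(1) two_is_prime_nat] by simp
  thus False using p(2) by simp
qed

context two_primes
begin

lemma k_eq: "subfield_gen {complex_of_real (sqrt (real (2 * p * q))), \<i>} = k"
  unfolding D_def[symmetric]
proof (rule subfield_gen_eqI[OF k_subfield])
  show "{D, \<i>} \<subseteq> k" using gk.gen_in_adj k_ints(6) by simp
  show "k \<subseteq> F'" if "is_subfield F'" "{D, \<i>} \<subseteq> F'" for F'
    using that by (intro adj_subset gauss_rat_subset) auto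
qed

lemma K_eq: "subfield_gen {complex_of_real (sqrt (real (2 * p * q))), \<i>, complex_of_real (sqrt (real p))} = K"
  unfolding D_def[symmetric] P_def[symmetric]
proof (rule subfield_gen_eqI[OF K_subfield])
  show "{D, \<i>, P} \<subseteq> K" using k_K gk.gen_in_adj k_ints(6) P_in_K by simp
  show "K \<subseteq> F'" if "is_subfield F'" "{D, \<i>, P} \<subseteq> F'" for F'
    unfolding K_def using that by (intro adj_subset gauss_rat_subset) auto
qed

end

theorem theorem43:
  fixes p1 p2 :: nat and e f g h :: int
    and H0 H1 H2 :: "complex set"
  defines "k \<equiv> subfield_gen {complex_of_real (sqrt (real (2 * p1 * p2))), \<i>}"
    and "K1 \<equiv> subfield_gen {complex_of_real (sqrt (real (2 * p1 * p2))), \<i>,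
                             complex_of_real (sqrt (real p1))}"
    and "K2 \<equiv> subfield_gen {complex_of_real (sqrt (real (2 * p1 * p2))), \<i>,
                             complex_of_real (sqrt (real p2))}"
    and "\<pi>1 \<equiv> of_int e + 2 * \<i> * of_int f"
    and "\<pi>2 \<equiv> of_int e - 2 * \<i> * of_int f"
  assumes "prime p1" and "prime p2"
    and "p1 mod 4 = 1" and "p2 mod 4 = 1"
    and "(Legendre (int p1) (int p2) = -1 \<and> Legendre 2 (int p1) = -1) \<or>
         (Legendre (int p1) (int p2) = -1 \<and> Legendre 2 (int p2) = -1) \<or>
         (Legendre 2 (int p1) = -1 \<and> Legendre 2 (int p2) = -1)"
    and "int p1 = e ^ 2 + 4 * f ^ 2" and "int p2 = g ^ 2 + 4 * h ^ 2"
    and "prime_ideal (ring_of_integers k) H0"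
    and "ideal_mult (ring_of_integers k) H0 H0 = principal_ideal (ring_of_integers k) (1 + \<i>)"
    and "prime_ideal (ring_of_integers k) H1"
    and "ideal_mult (ring_of_integers k) H1 H1 = principal_ideal (ring_of_integers k) \<pi>1"
    and "prime_ideal (ring_of_integers k) H2"
    and "ideal_mult (ring_of_integers k) H2 H2 = principal_ideal (ring_of_integers k) \<pi>2"
  shows "card (cap_kernel (ring_of_integers k) (ring_of_integers K1)) = 4
       \<and> card (cap_kernel (ring_of_integers k) (ring_of_integers K2)) = 4
       \<and> cap_kernel (ring_of_integers k) (ring_of_integers K1)
           = class_subgroup2 (ring_of_integers k) H1 H2
       \<and> cap_kernel (ring_of_integers k) (ring_of_integers K2)
           = class_subgroup2 (ring_of_integers k)
               (ideal_mult (ring_of_integers k) H0 H1) (ideal_mult (ring_of_integers k) H0 H2)"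
proof -
  let ?R = "ring_of_integers k"
  have int_ring: "\<pi>1 \<in> ?R" "\<pi>2 \<in> ?R" "1 + \<i> \<in> ?R" and R: "subring_set ?R" and prim: "gauss_prime \<pi>1 p1"
  proof -
    have "is_subfield k" unfolding k_def
      by (simp add: subfield_gen_def is_subfield_def)
    hence kF: "is_subfield k" .
    have ik: "\<i> \<in> k" unfolding k_def subfield_gen_def by blast
    have "x \<in> ?R" if "x \<in> gauss_int" for x
      using that gauss_rat_subset[OF kF ik] gauss_int_rat gauss_int_alg_int
      by (intro ring_of_integersI) blast+
    moreover have "\<pi>1 \<in> gauss_int" "\<pi>2 \<in> gauss_int" "1 + \<i> \<in> gauss_int"
      unfolding \<pi>1_def \<pi>2_def by (intro gauss_int_intros)+
    ultimately show "\<pi>1 \<in> ?R" "\<pi>2 \<in> ?R" "1 + \<i> \<in> ?R" by blast+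
    show "subring_set ?R" by (rule ring_of_integers_subring[OF kF])
    have "\<pi>1 * cnj \<pi>1 = of_int (e ^ 2 + 4 * f ^ 2)"
      by (simp add: \<pi>1_def power2_eq_square algebra_simps)
    thus "gauss_prime \<pi>1 p1" unfolding gauss_prime_def
      using \<open>\<pi>1 \<in> gauss_int\<close> assms(6) assms(11)[symmetric] by simp
  qed
  have \<pi>12: "\<pi>2 = cnj \<pi>1" by (simp add: \<pi>1_def \<pi>2_def)
  have nz: "\<pi>1 \<noteq> 0" "\<pi>2 \<noteq> 0" "1 + \<i> \<noteq> 0"
    using gauss_prime_nonzero[OF prim] by (simp_all add: \<pi>12 complex_eq_iff)
  have H0: "square_gen ?R H0 (1 + \<i>)" and H1: "square_gen ?R H1 \<pi>1" and H2: "square_gen ?R H2 \<pi>2"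
    unfolding square_gen_def using assms(13-18) int_ring nz by (simp_all add: prime_ideal_def)
  have ne: "p1 \<noteq> p2"
  proof
    assume "p1 = p2"
    hence "k = subfield_gen {complex_of_real (sqrt (real (2 * p1 * p1))), \<i>}" by (simp add: k_def)
    from equal_primes_impossible[OF assms(6,8) H1 this prim] show False .
  qed
  interpret T: two_primes p1 p2 e f g h
  proof
    have "\<not> (QuadRes p2 p1) \<and> \<not> QuadRes p1 2 \<or> \<not> (QuadRes p2 p1) \<and> \<not> QuadRes p2 2 \<or> \<not> QuadRes p1 2 \<and> \<not> QuadRes p2 2"
      using assms(10) Legendre_eq_minus_one by blast
    thus "\<not> (QuadRes p2 p1 \<and> QuadRes p1 2)" "\<not> (QuadRes p2 p1 \<and> QuadRes p2 2)" "\<not> (QuadRes p1 2 \<and> QuadRes p2 2)"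
      by blast+
    show "QuadRes p1 p2 \<longleftrightarrow> QuadRes p2 p1" by (rule QuadRes_reciprocity[OF assms(6-9) ne])
  qed (use assms(6-9,11,12) ne in simp_all)
  \<comment> \<open>With the primes exchanged, \<pi>1 and \<pi>2 take the places of
    \<open>\<xi>\<close> and \<open>\<xi>'\<close>.\<close>
  interpret T': two_primes p2 p1 g h e f by (rule T.swap)
  have k: "k = T.k" unfolding k_def T.k_eq ..
  have k': "k = T'.k" unfolding k_def T'.k_eq[symmetric] by (simp only: mult.assoc mult.commute[of p1])
  have K1: "K1 = T.K" unfolding K1_def T.K_eq ..
  have K2: "K2 = T'.K" unfolding K2_def T'.K_eq[symmetric] by (simp only: mult.assoc mult.commute[of p1])
  have eqs: "T.\<pi> = \<pi>1" "T.\<pi>' = \<pi>2" "T'.\<xi> = \<pi>1" "T'.\<xi>' = \<pi>2"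
    by (simp_all add: T.\<pi>_def T.\<pi>'_def T'.\<xi>_def T'.\<xi>'_def \<pi>1_def \<pi>2_def)
  have c1: "cap_kernel ?R (ring_of_integers K1) = class_subgroup2 ?R H1 H2 \<and> card (cap_kernel ?R (ring_of_integers K1)) = 4"
    unfolding k K1
    by (rule T.capitulation_kernel[OF H1[unfolded k] H2[unfolded k]])
       (use sq_equiv_refl[OF T.k_subfield] in \<open>simp add: eqs\<close>)
  \<comment> \<open>The squares of H0 H1 and H0 H2 are generated by \<open>lam\<close> times \<pi>1
    and \<pi>2. By \<open>lam_relation\<close> these are equivalent in \<open>k\<close> to the
    primes above p2, whose square classes become trivial in \<open>K2\<close>.\<close>
  have c2: "cap_kernel ?R (ring_of_integers K2) = class_subgroup2 ?R (ideal_mult ?R H0 H1) (ideal_mult ?R H0 H2)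
      \<and> card (cap_kernel ?R (ring_of_integers K2)) = 4"
    unfolding k' K2
    by (rule T'.capitulation_kernel[OF square_gen_mult[OF R H0 H1, unfolded k'] square_gen_mult[OF R H0 H2, unfolded k']])
       (use T'.lam_relation in \<open>simp add: eqs T'.lam_def\<close>)
  show ?thesis
    by (intro conjI c1[THEN conjunct1] c1[THEN conjunct2] c2[THEN conjunct1] c2[THEN conjunct2])
qed

end
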